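(* Let $P$ be a simplicial poset of rank $d$ with face ring $A_P$ over $\mathbb Q$, atoms $x_1,\dots,x_n$, and a fixed linear system of parameters $\theta_1,\dots,\theta_d\in(A_P)_1$ spanning $\Theta$ and generating the polynomial subring $\mathbb Q[\Theta]\subset A_P$. Assume: (1) every element of rank $d-1$ of $P$ lies below exactly two elements of rank $d$; (2) there are signs $\operatorname{sgn}(y)\in\{\pm1\}$ for the elements $y$ of rank $d$ such that $\sum_{\operatorname{rank}y=d}\operatorname{sgn}(y)\langle y\rangle$ is a cycle in the cellular chain complex $C_*(\Gamma(P);\mathbb Z)$. Then for every $\alpha\in A_P$ the element $$\operatorname{ind}_T(\alpha):=\sum_{\operatorname{rank}y=d}\frac{\operatorname{sgn}(y)\,\iota_y(\alpha)}{m(y)\prod_{i\in\mathcal A(y)}\theta_i(y)}$$ of the fraction field of $\mathbb Q[\Theta]$ actually lies in $\mathbb Q[\Theta]$.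
   Context: A simplicial poset is a finite poset $P$ with smallest element $\hat 0$ such that every interval $[\hat 0,y]$ is a boolean algebra; $y$ has rank $i$ if $[\hat 0,y]$ is the boolean algebra of subsets of an $i$-element set, and $\operatorname{rank}P$ is the maximal rank; rank-one elements are atoms. Face ring: if $P$ has elements $\hat 0,y_1,\dots,y_p$, $A_P=\mathbb Q[y_1,\dots,y_p]/\mathcal I_P$ where $\mathcal I_P$ is generated by $y_iy_j-(y_i\wedge y_j)\sum_z z$ ($z$ over all minimal upper bounds of $y_i,y_j$, sum $0$ if none; $\hat 0$ identified with $1$), graded by $\deg y_i=\operatorname{rank}y_i$. A linear system of parameters is a sequence of $d$ degree-one elements over whose generated subring $A_P$ is a finitely generated module. For $y$ of rank $d$, the epimorphism $A_P\to A_{[\hat 0,y]}$ (sending elements of $P$ not $\le y$ to $0$, others to themselves) restricts to an isomorphism $\mathbb Q[\Theta]\to A_{[\hat 0,y]}$, and $\iota_y\colon A_P\to\mathbb Q[\Theta]$ is the composite of this epimorphism with the inverse of that isomorphism. $\mathcal A(y)=\{i:x_i\le y\}$ (a $d$-element set) and $\theta_i(y)=\iota_y(x_i)$ for $i\in\mathcal A(y)$; these form a basis of $\Theta$. Orient $\Theta$ by the ordered basis $(\theta_1,\dots,\theta_d)$ and order $\mathcal A(y)=\{i_1,\dots,i_d\}$ so that $(\theta_{i_1}(y),\dots,\theta_{i_d}(y))$ is positively oriented; $m(y)>0$ is the determinant of the linear map sending this ordered basis to $(\theta_1,\dots,\theta_d)$. $\Gamma(P)$ is the CW complex obtained by taking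 for each $y\in P\setminus\{\hat 0\}$ a geometric simplex with face poset $[\hat 0,y]$ and gluing according to the order of $P$; its $(d-1)$-cells are the rank-$d$ elements and its $(d-2)$-cells the rank-$(d-1)$ elements. $\langle y\rangle$ denotes the $(d-1)$-cell $y$ oriented as the simplex with ordered vertices $(x_{i_1},\dots,x_{i_d})$, whose boundary is $\sum_k(-1)^{k-1}$ times its face omitting $x_{i_k}$ (each such face being the unique rank-$(d-1)$ element $z\le y$ with $\mathcal A(z)=\mathcal A(y)\setminus\{i_k\}$, with the induced vertex order).
   Formalization: For d = 1 the cycle condition is taken in the augmented complex (boundary of an atom is the smallest element), so the two signs must be opposite; in the unaugmented complex the claim fails: two atoms, θ = x₁ + x₂, both signs +, ind_T(1) = 2/θ. *)

theory Defs
  imports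
    "HOL-Algebra.QuotRing"
    "HOL-Algebra.Generated_Rings"
    "HOL-Library.Poly_Mapping"
    "Jordan_Normal_Form.Determinant"
begin

section \<open>Simplicial posets\<close>

text \<open>A poset is a set of elements of a type of class \<^class>\<open>order\<close>, with the order of that type.\<close>

definition pbot :: "'a::order set \<Rightarrow> 'a" where
  "pbot P = (LEAST b. b \<in> P)"

definition below :: "'a::order set \<Rightarrow> 'a \<Rightarrow> 'a set" where
  "below P y = {x \<in> P. x \<le> y}"

definition has_rank :: "'a::order set \<Rightarrow> 'a \<Rightarrow> nat \<Rightarrow> bool" where
  "has_rank P y i \<longleftrightarrow>
     (\<exists>f. bij_betw f (Pow {..<i}) (below P y) \<and>
          (\<forall>A \<in> Pow {..<i}. \<forall>B \<in> Pow {..<i}. f A \<le> f B \<longleftrightarrow> A \<subseteq> B))"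

definition simplicial_poset :: "'a::order set \<Rightarrow> bool" where
  "simplicial_poset P \<longleftrightarrow>
     finite P \<and> (\<exists>b \<in> P. \<forall>x \<in> P. b \<le> x) \<and> (\<forall>y \<in> P. \<exists>i. has_rank P y i)"

definition prank :: "'a::order set \<Rightarrow> 'a \<Rightarrow> nat" where
  "prank P y = (THE i. has_rank P y i)"

definition poset_rank :: "'a::order set \<Rightarrow> nat" where
  "poset_rank P = Max (prank P ` P)"

definition elements_of_rank :: "'a::order set \<Rightarrow> nat \<Rightarrow> 'a set" where
  "elements_of_rank P i = {y \<in> P. prank P y = i}"

definition minimal_upper_bounds :: "'a::order set \<Rightarrow> 'a \<Rightarrow> 'a \<Rightarrow> 'a set" where
  "minimal_upper_bounds P a b =
     {z \<in> P. a \<le> z \<and> b \<le> z \<and> (\<forall>w \<in> P. a \<le> w \<and> b \<le> w \<and> w \<le> z \<longrightarrow> w = z)}"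

text \<open>In a simplicial poset this exists as soon as \<open>a\<close> and \<open>b\<close> have a common upper bound.\<close>

definition pmeet :: "'a::order set \<Rightarrow> 'a \<Rightarrow> 'a \<Rightarrow> 'a" where
  "pmeet P a b = (GREATEST c. c \<in> P \<and> c \<le> a \<and> c \<le> b)"

text \<open>\<open>\<A>(y)\<close>, for atoms listed as \<open>x 1, \<dots>, x n\<close>.\<close>

definition atoms_below :: "nat \<Rightarrow> (nat \<Rightarrow> 'a::order) \<Rightarrow> 'a \<Rightarrow> nat set" where
  "atoms_below n x y = {i \<in> {1..n}. x i \<le> y}"


section \<open>The face ring over the rationals\<close>

type_synonym 'a monom = "'a \<Rightarrow>\<^sub>0 nat"
type_synonym 'a qpoly = "'a monom \<Rightarrow>\<^sub>0 rat"

definition qpoly_ring :: "'a set \<Rightarrow> 'a qpoly ring" where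
  "qpoly_ring V =
     \<lparr>carrier = {p. \<forall>m \<in> Poly_Mapping.keys p. Poly_Mapping.keys m \<subseteq> V},
      monoid.mult = (*), one = 1, zero = 0, add = (+)\<rparr>"

text \<open>The variable attached to a poset element; the smallest element is identified with \<open>1\<close>.\<close>

definition pvar :: "'a::order set \<Rightarrow> 'a \<Rightarrow> 'a qpoly" where
  "pvar P y =
     (if y = pbot P then 1 else Poly_Mapping.single (Poly_Mapping.single y 1) 1)"

definition poly_of_poset :: "'a::order set \<Rightarrow> 'a qpoly ring" where
  "poly_of_poset P = qpoly_ring (P - {pbot P})"

text \<open>If \<open>a\<close>, \<open>b\<close> have no common upper bound, the sum is \<open>0\<close> and the value of \<^const>\<open>pmeet\<close> is
  irrelevant.\<close>

definition face_relations :: "'a::order set \<Rightarrow> 'a qpoly set" where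
  "face_relations P =
     {pvar P a * pvar P b - pvar P (pmeet P a b) * (\<Sum>z \<in> minimal_upper_bounds P a b. pvar P z)
      | a b. a \<in> P - {pbot P} \<and> b \<in> P - {pbot P}}"

definition face_ideal :: "'a::order set \<Rightarrow> 'a qpoly set" where
  "face_ideal P = Idl\<^bsub>poly_of_poset P\<^esub> (face_relations P)"

definition face_ring :: "'a::order set \<Rightarrow> 'a qpoly set ring" where
  "face_ring P = poly_of_poset P Quot face_ideal P"

definition face_class :: "'a::order set \<Rightarrow> 'a qpoly \<Rightarrow> 'a qpoly set" where
  "face_class P p = face_ideal P +>\<^bsub>poly_of_poset P\<^esub> p"

definition scal :: "'a::order set \<Rightarrow> rat \<Rightarrow> 'a qpoly set" where
  "scal P c = face_class P (Poly_Mapping.single 0 c)"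

definition poset_elem :: "'a::order set \<Rightarrow> 'a \<Rightarrow> 'a qpoly set" where
  "poset_elem P y = face_class P (pvar P y)"

definition monom_deg :: "'a::order set \<Rightarrow> 'a monom \<Rightarrow> nat" where
  "monom_deg P m = (\<Sum>v \<in> Poly_Mapping.keys m. Poly_Mapping.lookup m v * prank P v)"

definition graded_piece :: "'a::order set \<Rightarrow> nat \<Rightarrow> 'a qpoly set set" where
  "graded_piece P k =
     face_class P ` {p \<in> carrier (poly_of_poset P). \<forall>m \<in> Poly_Mapping.keys p. monom_deg P m = k}"


section \<open>Linear systems of parameters and restriction to a face\<close>

text \<open>\<open>\<rat>[\<Theta>]\<close>, as a ring whose carrier is a subset of that of the face ring. The system
  is \<open>\<theta> 1, \<dots>, \<theta> d\<close> with \<open>d\<close> the rank of the poset.\<close>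

definition param_ring :: "'a::order set \<Rightarrow> (nat \<Rightarrow> 'a qpoly set) \<Rightarrow> 'a qpoly set ring" where
  "param_ring P \<theta> =
     (face_ring P)\<lparr>carrier := generate_ring (face_ring P) (range (scal P) \<union> \<theta> ` {1..poset_rank P})\<rparr>"

definition finite_module_over :: "('r, 's) ring_scheme \<Rightarrow> 'r set \<Rightarrow> bool" where
  "finite_module_over R S \<longleftrightarrow>
     (\<exists>M. finite M \<and> M \<subseteq> carrier R \<and>
        (\<forall>a \<in> carrier R. \<exists>c \<in> M \<rightarrow> S. a = (\<Oplus>\<^bsub>R\<^esub>m\<in>M. c m \<otimes>\<^bsub>R\<^esub> m)))"

definition lin_sys_params :: "'a::order set \<Rightarrow> (nat \<Rightarrow> 'a qpoly set) \<Rightarrow> bool" where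
  "lin_sys_params P \<theta> \<longleftrightarrow>
     (\<forall>i \<in> {1..poset_rank P}. \<theta> i \<in> graded_piece P 1) \<and>
     finite_module_over (face_ring P) (carrier (param_ring P \<theta>))"

text \<open>The epimorphism of \<open>\<rat>\<close>-algebras from the face ring of \<open>P\<close> to that of the interval below
  \<open>y\<close>. Extensionality makes it unique as a HOL function.\<close>

definition face_proj :: "'a::order set \<Rightarrow> 'a \<Rightarrow> 'a qpoly set \<Rightarrow> 'a qpoly set" where
  "face_proj P y = (THE h.
     h \<in> extensional (carrier (face_ring P)) \<and>
     h \<in> Ring.ring_hom (face_ring P) (face_ring (below P y)) \<and>
     (\<forall>c. h (scal P c) = scal (below P y) c) \<and>
     (\<forall>v \<in> P - {pbot P}. h (poset_elem P v) =
        (if v \<le> y then poset_elem (below P y) v else \<zero>\<^bsub>face_ring (below P y)\<^esub>)))"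

definition iota :: "'a::order set \<Rightarrow> (nat \<Rightarrow> 'a qpoly set) \<Rightarrow> 'a \<Rightarrow> 'a qpoly set \<Rightarrow> 'a qpoly set" where
  "iota P \<theta> y a = the_inv_into (carrier (param_ring P \<theta>)) (face_proj P y) (face_proj P y a)"

definition local_param ::
  "'a::order set \<Rightarrow> (nat \<Rightarrow> 'a qpoly set) \<Rightarrow> (nat \<Rightarrow> 'a) \<Rightarrow> 'a \<Rightarrow> nat \<Rightarrow> 'a qpoly set" where
  "local_param P \<theta> x y i = iota P \<theta> y (poset_elem P (x i))"


section \<open>Orientations and multiplicities\<close>

text \<open>Determinant of the \<open>\<rat>\<close>-linear endomorphism with \<open>u j \<mapsto> v j\<close> for \<open>j < d\<close>, where \<open>u\<close> is an
  ordered basis of a subspace of the face ring containing all \<open>v j\<close>.\<close>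

definition basis_map_det ::
  "'a::order set \<Rightarrow> nat \<Rightarrow> (nat \<Rightarrow> 'a qpoly set) \<Rightarrow> (nat \<Rightarrow> 'a qpoly set) \<Rightarrow> rat" where
  "basis_map_det P d u v = det (THE M. M \<in> carrier_mat d d \<and>
     (\<forall>j<d. v j = (\<Oplus>\<^bsub>face_ring P\<^esub>k\<in>{..<d}. scal P (M $$ (k, j)) \<otimes>\<^bsub>face_ring P\<^esub> u k)))"

text \<open>\<open>w\<close> is an ordering \<open>i\<^sub>1, \<dots>, i\<^sub>d\<close> of \<open>\<A>(y)\<close> for which
  the basis \<open>\<theta>\<^bsub>i\<^sub>1\<^esub>(y), \<dots>, \<theta>\<^bsub>i\<^sub>d\<^esub>(y)\<close> of \<open>\<Theta>\<close> is positive
  with respect to \<open>\<theta> 1, \<dots>, \<theta> d\<close>.\<close>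

definition positive_ordering ::
  "'a::order set \<Rightarrow> (nat \<Rightarrow> 'a qpoly set) \<Rightarrow> nat \<Rightarrow> (nat \<Rightarrow> 'a) \<Rightarrow> 'a \<Rightarrow> nat list \<Rightarrow> bool" where
  "positive_ordering P \<theta> n x y w \<longleftrightarrow>
     distinct w \<and> set w = atoms_below n x y \<and>
     basis_map_det P (poset_rank P) (\<lambda>k. \<theta> (Suc k)) (\<lambda>k. local_param P \<theta> x y (w ! k)) > 0"

definition multiplicity_at ::
  "'a::order set \<Rightarrow> (nat \<Rightarrow> 'a qpoly set) \<Rightarrow> (nat \<Rightarrow> 'a) \<Rightarrow> 'a \<Rightarrow> nat list \<Rightarrow> rat" where
  "multiplicity_at P \<theta> x y w =
     basis_map_det P (poset_rank P) (\<lambda>k. local_param P \<theta> x y (w ! k)) (\<lambda>k. \<theta> (Suc k))"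


section \<open>Cellular chains\<close>

text \<open>Chains are elements of the free abelian group on the elements of \<open>P\<close>: the generator \<open>z\<close> is the
  cell \<open>z\<close> oriented by listing its vertices \<open>x i\<close> with increasing indices. The smallest element
  occurs as a cell of dimension \<open>-1\<close>, that is, the complex is augmented; this affects only the
  boundary of rank-one elements.\<close>

definition list_sign :: "nat list \<Rightarrow> int" where
  "list_sign w = (- 1) ^ card {(i, j). i < j \<and> j < length w \<and> w ! j < w ! i}"

definition oriented_cell :: "'a \<Rightarrow> nat list \<Rightarrow> 'a \<Rightarrow>\<^sub>0 int" where
  "oriented_cell z w = frag_cmul (list_sign w) (frag_of z)"

definition cell_face :: "'a::order set \<Rightarrow> nat \<Rightarrow> (nat \<Rightarrow> 'a) \<Rightarrow> 'a \<Rightarrow> nat \<Rightarrow> 'a" where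
  "cell_face P n x z i =
     (THE u. u \<in> P \<and> u \<le> z \<and> prank P u + 1 = prank P z \<and>
             atoms_below n x u = atoms_below n x z - {i})"

definition cell_boundary :: "'a::order set \<Rightarrow> nat \<Rightarrow> (nat \<Rightarrow> 'a) \<Rightarrow> 'a \<Rightarrow> 'a \<Rightarrow>\<^sub>0 int" where
  "cell_boundary P n x z =
     (let w = sorted_list_of_set (atoms_below n x z)
      in \<Sum>k<length w. frag_cmul ((- 1) ^ k) (frag_of (cell_face P n x z (w ! k))))"

definition boundary :: "'a::order set \<Rightarrow> nat \<Rightarrow> (nat \<Rightarrow> 'a) \<Rightarrow> ('a \<Rightarrow>\<^sub>0 int) \<Rightarrow> ('a \<Rightarrow>\<^sub>0 int)" where
  "boundary P n x = frag_extend (cell_boundary P n x)"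


section \<open>The index\<close>

text \<open>\<open>K\<close> together with the embedding \<open>e\<close> is a fraction field of the ring \<open>R\<close>.\<close>

definition fraction_field :: "('r, 's) ring_scheme \<Rightarrow> ('k, 'l) ring_scheme \<Rightarrow> ('r \<Rightarrow> 'k) \<Rightarrow> bool" where
  "fraction_field R K e \<longleftrightarrow>
     Ring.field K \<and> e \<in> Ring.ring_hom R K \<and> inj_on e (carrier R) \<and>
     (\<forall>q \<in> carrier K. \<exists>a \<in> carrier R. \<exists>b \<in> carrier R - {\<zero>\<^bsub>R\<^esub>}.
        q = e a \<otimes>\<^bsub>K\<^esub> inv\<^bsub>K\<^esub> e b)"

definition ind_T ::
  "'a::order set \<Rightarrow> nat \<Rightarrow> (nat \<Rightarrow> 'a) \<Rightarrow> (nat \<Rightarrow> 'a qpoly set) \<Rightarrow> ('a \<Rightarrow> nat list) \<Rightarrow> ('a \<Rightarrow> int) \<Rightarrow>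
   ('k, 'l) ring_scheme \<Rightarrow> ('a qpoly set \<Rightarrow> 'k) \<Rightarrow> 'a qpoly set \<Rightarrow> 'k" where
  "ind_T P n x \<theta> w sg K e \<alpha> =
     (\<Oplus>\<^bsub>K\<^esub>y\<in>elements_of_rank P (poset_rank P).
        e (scal P (of_int (sg y)) \<otimes>\<^bsub>face_ring P\<^esub> iota P \<theta> y \<alpha>) \<otimes>\<^bsub>K\<^esub>
        inv\<^bsub>K\<^esub> e (scal P (multiplicity_at P \<theta> x y (w y)) \<otimes>\<^bsub>face_ring P\<^esub>
                 (\<Otimes>\<^bsub>face_ring P\<^esub>i\<in>atoms_below n x y. local_param P \<theta> x y i)))"

end

(*
Write R for a polynomial ring in variables t_1, ..., t_d; it maps isomorphically onto the parameter
ring by t_k |-> theta_k, and finiteness over the parameters forces the coefficient matrix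
(C k i), i in A(y), of the system at every facet y to be invertible: a kernel vector v would give a
homomorphism to Q[t] (the point t v of the face y) that kills all parameters but has infinite
dimensional image. Hence theta_i(y) corresponds to a linear form L_i(y) in R, the map iota_y to the
substitution u |-> product of L_i(y) over i in A(y) with x_i <= u, and m(y) to the determinant of the
columns of C listed in w y.

All denominators are products of prime linear forms, so it suffices to remove the poles along each
form l. The facets with a pole along l come in pairs y, y' sharing a wall u, with pole at L_i(y) and
L_i'(y') respectively. Inverting the matrix gives L_i(y) = c L_i'(y') and L_j(y) = L_j(y') modulo l for
the atoms j of u, where c is the quotient of the two determinants by Cramer's rule; since u is not in
the support of the boundary of the cycle, the two residues cancel.
*)
theory Submission
  imports
    Defs
    "HOL-Computational_Algebra.Fraction_Field"
    "HOL-Computational_Algebra.Factorial_Ring"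
begin

section \<open>Substitution homomorphisms of polynomial rings\<close>

text \<open>The residues cancel because one sign occurs in two places.
  \<open>list_sign (w y)\<close> orients the cell y, and it also relates the minor of
  \<open>C\<close> in the order \<open>w y\<close> to the sorted one; the sign of a face in the
  boundary is the cost of moving the column of the omitted vertex to the front. So the coefficient
  of u in the cycle compares the determinants with columns \<open>i # Z\<close> and
  \<open>i' # Z\<close>, \<open>Z\<close> listing the atoms of u. These differ in one column only,
  which is the situation of Cramer's rule.

  Poles are simple and sit at one wall per facet, because the forms L_i(y) of a single facet are
  linearly independent: a given l divides at most one of them.

  The face ring consists of cosets. Its elements are told apart by substitutions that kill the face
  relations; this also shows that the parameters are algebraically independent. The sum is first
  studied in the type \<open>nat qpoly fract\<close>, where divisibility by primes makes sense, and
  is carried at the end to the given fraction field by a homomorphism that is nonzero at every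
  denominator.\<close>

abbreviation pconst :: "rat \<Rightarrow> 'b qpoly" where
  "pconst c \<equiv> Poly_Mapping.single 0 c"

definition pX :: "'b \<Rightarrow> 'b qpoly" where
  "pX v = Poly_Mapping.single (Poly_Mapping.single v 1) 1"

lemma pconst_add: "pconst (a + b) = pconst a + pconst b"
  by (rule single_add)

lemma pconst_mult: "pconst (a * b) = pconst a * pconst b"
  by (simp add: mult_single)

lemma pconst_sum: "pconst (sum f A) = (\<Sum>i\<in>A. pconst (f i))"
  by (induction A rule: infinite_finite_induct) (simp_all add: pconst_add)

definition psubst_monom :: "('a \<Rightarrow> 'b qpoly) \<Rightarrow> 'a monom \<Rightarrow> 'b qpoly" where
  "psubst_monom f m = (\<Prod>v\<in>Poly_Mapping.keys m. f v ^ Poly_Mapping.lookup m v)"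

text \<open>Every homomorphism of polynomial rings below is a substitution of this kind:
  \<open>param_lift\<close>, \<open>face_subst\<close>, \<open>interval_subst\<close> and
  \<open>eliminate\<close> differ only in the values given to the variables.\<close>

definition psubst :: "('a \<Rightarrow> 'b qpoly) \<Rightarrow> 'a qpoly \<Rightarrow> 'b qpoly" where
  "psubst f p = (\<Sum>m\<in>Poly_Mapping.keys p. pconst (Poly_Mapping.lookup p m) * psubst_monom f m)"

lemma psubst_monom_superset:
  assumes "finite V" "Poly_Mapping.keys m \<subseteq> V"
  shows "psubst_monom f m = (\<Prod>v\<in>V. f v ^ Poly_Mapping.lookup m v)"
  unfolding psubst_monom_def
  by (rule prod.mono_neutral_left) (use assms in \<open>auto simp: in_keys_iff\<close>)

lemma psubst_superset:
  assumes "finite M" "Poly_Mapping.keys p \<subseteq> M"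
  shows "psubst f p = (\<Sum>m\<in>M. pconst (Poly_Mapping.lookup p m) * psubst_monom f m)"
  unfolding psubst_def
  by (rule sum.mono_neutral_left) (use assms in \<open>auto simp: in_keys_iff\<close>)

lemma psubst_monom_add: "psubst_monom f (m + m') = psubst_monom f m * psubst_monom f m'"
proof -
  let ?V = "Poly_Mapping.keys m \<union> Poly_Mapping.keys m'"
  have "psubst_monom f (m + m') = (\<Prod>v\<in>?V. f v ^ Poly_Mapping.lookup (m + m') v)"
    by (rule psubst_monom_superset) (use keys_add[of m m'] in auto)
  also have "\<dots> = (\<Prod>v\<in>?V. f v ^ Poly_Mapping.lookup m v) * (\<Prod>v\<in>?V. f v ^ Poly_Mapping.lookup m' v)"
    by (simp add: lookup_add power_add prod.distrib)
  also have "\<dots> = psubst_monom f m * psubst_monom f m'"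
    using psubst_monom_superset[of ?V m f] psubst_monom_superset[of ?V m' f] by simp
  finally show ?thesis .
qed

lemma psubst_zero [simp]: "psubst f 0 = 0"
  by (simp add: psubst_def)

lemma psubst_single: "psubst f (Poly_Mapping.single m c) = pconst c * psubst_monom f m"
  using psubst_superset[of "{m}" "Poly_Mapping.single m c" f] by (simp split: if_splits)

lemma psubst_pconst [simp]: "psubst f (pconst c) = pconst c"
  by (simp add: psubst_single psubst_monom_def)

lemma psubst_one [simp]: "psubst f 1 = 1"
  using psubst_pconst[of f 1] by simp

lemma psubst_pX [simp]: "psubst f (pX v) = f v"
  by (simp add: pX_def psubst_single psubst_monom_def)

lemma psubst_add: "psubst f (p + q) = psubst f p + psubst f q"
proof -
  let ?M = "Poly_Mapping.keys p \<union> Poly_Mapping.keys q"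
  have "psubst f (p + q) = (\<Sum>m\<in>?M. pconst (Poly_Mapping.lookup (p + q) m) * psubst_monom f m)"
    by (rule psubst_superset) (use keys_add[of p q] in auto)
  also have "\<dots> = (\<Sum>m\<in>?M. pconst (Poly_Mapping.lookup p m) * psubst_monom f m)
                + (\<Sum>m\<in>?M. pconst (Poly_Mapping.lookup q m) * psubst_monom f m)"
    by (simp add: lookup_add pconst_add distrib_right sum.distrib)
  also have "\<dots> = psubst f p + psubst f q"
    using psubst_superset[of ?M p f] psubst_superset[of ?M q f] by simp
  finally show ?thesis .
qed

lemma psubst_uminus: "psubst f (- p) = - psubst f p"
  using psubst_add[of f p "- p"] by (simp add: eq_neg_iff_add_eq_0 add.commute)

lemma psubst_diff: "psubst f (p - q) = psubst f p - psubst f q"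
  using psubst_add[of f p "- q"] by (simp add: psubst_uminus)

lemma psubst_sum: "psubst f (sum g A) = (\<Sum>i\<in>A. psubst f (g i))"
  by (induction A rule: infinite_finite_induct) (simp_all add: psubst_add)

lemma poly_mapping_eq_sum_single:
  fixes p :: "'a \<Rightarrow>\<^sub>0 'b::comm_monoid_add"
  shows "p = (\<Sum>m\<in>Poly_Mapping.keys p. Poly_Mapping.single m (Poly_Mapping.lookup p m))"
  by (rule poly_mapping_eqI)
     (auto simp: lookup_sum lookup_single when_def in_keys_iff)

lemma psubst_mult: "psubst f (p * q) = psubst f p * psubst f q"
proof -
  have single: "psubst f (Poly_Mapping.single m c * Poly_Mapping.single m' c')
      = psubst f (Poly_Mapping.single m c) * psubst f (Poly_Mapping.single m' c')" for m m' c c'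
  proof -
    have "psubst f (Poly_Mapping.single m c * Poly_Mapping.single m' c')
      = pconst (c * c') * (psubst_monom f m * psubst_monom f m')"
      by (simp only: mult_single psubst_single psubst_monom_add)
    then show ?thesis
      unfolding pconst_mult psubst_single by (simp only: mult_ac)
  qed
  define f1 where "f1 = (\<lambda>m. Poly_Mapping.single m (Poly_Mapping.lookup p m))"
  define f2 where "f2 = (\<lambda>m. Poly_Mapping.single m (Poly_Mapping.lookup q m))"
  have p: "p = sum f1 (Poly_Mapping.keys p)" and q: "q = sum f2 (Poly_Mapping.keys q)"
    unfolding f1_def f2_def by (rule poly_mapping_eq_sum_single)+
  \<comment> \<open>Arbitrary \<open>A\<close> and \<open>B\<close> keep \<open>p\<close> and
    \<open>q\<close> out of the claim; rewriting \<open>p\<close> by its own expansion would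
    reintroduce \<open>p\<close> in the index set.\<close>
  have "psubst f (sum f1 A * sum f2 B) = psubst f (sum f1 A) * psubst f (sum f2 B)" for A B
    unfolding sum_product psubst_sum by (simp add: f1_def f2_def single)
  then show ?thesis using p q by metis
qed

lemma psubst_prod: "psubst f (prod g A) = (\<Prod>i\<in>A. psubst f (g i))"
  by (induction A rule: infinite_finite_induct) (simp_all add: psubst_mult)

lemma psubst_power: "psubst f (p ^ k) = psubst f p ^ k"
  by (induction k) (simp_all add: psubst_mult)

lemmas psubst_simps = psubst_add psubst_diff psubst_uminus psubst_mult psubst_sum psubst_prod
  psubst_power

section \<open>Polynomials in a given set of variables\<close>

definition qpolys :: "'a set \<Rightarrow> 'a qpoly set" where
  "qpolys V = {p. \<forall>m \<in> Poly_Mapping.keys p. Poly_Mapping.keys m \<subseteq> V}"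

lemma qpolys_UNIV: "qpolys UNIV = UNIV"
  by (auto simp: qpolys_def)

lemma qpolys_pconst [simp]: "pconst c \<in> qpolys V"
  by (simp add: qpolys_def)

lemma qpolys_0 [simp]: "0 \<in> qpolys V" and qpolys_1 [simp]: "1 \<in> qpolys V"
  using qpolys_pconst[of 0 V] qpolys_pconst[of 1 V] by simp_all

lemma qpolys_pX [simp]: "v \<in> V \<Longrightarrow> pX v \<in> qpolys V"
  by (simp add: pX_def qpolys_def)

lemma qpolys_add: "p \<in> qpolys V \<Longrightarrow> q \<in> qpolys V \<Longrightarrow> p + q \<in> qpolys V"
  using keys_add[of p q] by (auto simp: qpolys_def)

lemma qpolys_uminus: "p \<in> qpolys V \<Longrightarrow> - p \<in> qpolys V"
  by (auto simp: qpolys_def)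

lemma qpolys_diff: "p \<in> qpolys V \<Longrightarrow> q \<in> qpolys V \<Longrightarrow> p - q \<in> qpolys V"
  using qpolys_add[of p V "- q"] qpolys_uminus[of q V] by simp

lemma qpolys_mult: 
  assumes "p \<in> qpolys V" "q \<in> qpolys V" 
  shows "p * q \<in> qpolys V"
  unfolding qpolys_def
proof safe
  fix m v assume "m \<in> Poly_Mapping.keys (p * q)" and v: "v \<in> Poly_Mapping.keys m"
  then obtain a b where "m = a + b" "a \<in> Poly_Mapping.keys p" "b \<in> Poly_Mapping.keys q"
    using keys_mult[of p q] by blast
  moreover have "v \<in> Poly_Mapping.keys a \<union> Poly_Mapping.keys b"
    using v keys_add[of a b] \<open>m = a + b\<close> by auto
  ultimately show "v \<in> V"
    using assms unfolding qpolys_def by blast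
qed

lemma qpolys_sum: "(\<And>i. i \<in> A \<Longrightarrow> f i \<in> qpolys V) \<Longrightarrow> sum f A \<in> qpolys V"
  by (induction A rule: infinite_finite_induct) (simp_all add: qpolys_add)

lemma qpolys_prod: "(\<And>i. i \<in> A \<Longrightarrow> f i \<in> qpolys V) \<Longrightarrow> prod f A \<in> qpolys V"
  by (induction A rule: infinite_finite_induct) (simp_all add: qpolys_mult)

lemma qpolys_power: "p \<in> qpolys V \<Longrightarrow> p ^ k \<in> qpolys V"
  by (induction k) (simp_all add: qpolys_mult)

lemmas qpolys_closed = qpolys_add qpolys_uminus qpolys_diff qpolys_mult qpolys_sum qpolys_prod
  qpolys_power

lemma pX_power: "pX v ^ k = Poly_Mapping.single (Poly_Mapping.single v k) 1"
proof (induction k)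
  case (Suc k)
  have "Poly_Mapping.single v 1 + Poly_Mapping.single v k = Poly_Mapping.single v (Suc k)"
    by (simp flip: single_add)
  with Suc show ?case by (simp add: pX_def mult_single)
qed simp

lemma monom_eq_psubst: "Poly_Mapping.single m c = pconst c * psubst_monom pX m"
proof -
  have "(\<Prod>v\<in>A. Poly_Mapping.single (g v) (1::rat)) = Poly_Mapping.single (\<Sum>v\<in>A. g v) 1"
    for A :: "'a set" and g :: "'a \<Rightarrow> 'a monom"
    by (induction A rule: infinite_finite_induct) (simp_all add: mult_single)
  moreover have "(\<Sum>v\<in>Poly_Mapping.keys m. Poly_Mapping.single v (Poly_Mapping.lookup m v)) = m"
    by (rule poly_mapping_eq_sum_single[symmetric])
  ultimately show ?thesis
    unfolding psubst_monom_def pX_power by (simp add: mult_single)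
qed

lemma qpolys_induct [consumes 1, case_names const var add mult]:
  assumes "p \<in> qpolys V"
    and const: "\<And>c. Q (pconst c)" and var: "\<And>v. v \<in> V \<Longrightarrow> Q (pX v)"
    and add: "\<And>p q. p \<in> qpolys V \<Longrightarrow> q \<in> qpolys V \<Longrightarrow> Q p \<Longrightarrow> Q q \<Longrightarrow> Q (p + q)"
    and mult: "\<And>p q. p \<in> qpolys V \<Longrightarrow> q \<in> qpolys V \<Longrightarrow> Q p \<Longrightarrow> Q q \<Longrightarrow> Q (p * q)"
  shows "Q p"
proof -
  \<comment> \<open>Membership in \<open>qpolys V\<close> is carried along with \<open>Q\<close>,
    since the closure hypotheses for sums and products ask for it.\<close>
  define T where "T p \<longleftrightarrow> p \<in> qpolys V \<and> Q p" for p
  have T: "T (pconst c)" "v \<in> V \<Longrightarrow> T (pX v)" "T p \<Longrightarrow> T q \<Longrightarrow> T (p + q)" "T p \<Longrightarrow> T q \<Longrightarrow> T (p * q)"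
    for c v p q
    using const var add mult by (auto simp: T_def qpolys_closed)
  have T01: "T 0" "T 1" using T(1)[of 0] T(1)[of 1] by simp_all
  have Tsum: "(\<And>i. i \<in> A \<Longrightarrow> T (f i)) \<Longrightarrow> T (sum f A)" for f and A :: "'a monom set"
    by (induction A rule: infinite_finite_induct) (simp_all add: T T01)
  have Tprod: "(\<And>i. i \<in> A \<Longrightarrow> T (f i)) \<Longrightarrow> T (prod f A)" for f and A :: "'a set"
    by (induction A rule: infinite_finite_induct) (simp_all add: T T01)
  have Tpow: "T q \<Longrightarrow> T (q ^ k)" for q k
    by (induction k) (simp_all add: T T01)
  have "T (Poly_Mapping.single m c)" if "Poly_Mapping.keys m \<subseteq> V" for m c
    by (subst monom_eq_psubst, unfold psubst_monom_def, intro T Tprod Tpow) (use that in auto)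
  then have "T (\<Sum>m\<in>Poly_Mapping.keys p. Poly_Mapping.single m (Poly_Mapping.lookup p m))"
    by (intro Tsum) (use assms(1) in \<open>auto simp: qpolys_def\<close>)
  then have "T p"
    by (simp only: poly_mapping_eq_sum_single[symmetric])
  then show ?thesis by (simp add: T_def)
qed

lemma psubst_in_qpolys:
  assumes "p \<in> qpolys V" "\<And>v. v \<in> V \<Longrightarrow> f v \<in> qpolys W"
  shows "psubst f p \<in> qpolys W"
  using assms(1) by (induction rule: qpolys_induct) (simp_all add: assms(2) psubst_simps qpolys_closed)

lemma psubst_psubst: "psubst g (psubst f p) = psubst (\<lambda>v. psubst g (f v)) p"
proof -
  have "p \<in> qpolys UNIV" by (simp add: qpolys_UNIV)
  then show ?thesis by (induction rule: qpolys_induct) (simp_all add: psubst_simps)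
qed

lemma psubst_id: "psubst pX p = p"
proof -
  have "p \<in> qpolys UNIV" by (simp add: qpolys_UNIV)
  then show ?thesis by (induction rule: qpolys_induct) (simp_all add: psubst_simps)
qed

text \<open>Homomorphisms that agree modulo \<open>l\<close> on the variables agree modulo
  \<open>l\<close> everywhere. With the identity as one of them this yields the kernel of
  \<open>eliminate\<close>; with the restrictions to two adjacent facets it compares their
  numerators.\<close>

lemma psubst_dvd_diff:
  assumes "p \<in> qpolys V" "\<And>v. v \<in> V \<Longrightarrow> l dvd f v - g v"
  shows "l dvd psubst f p - psubst g p"
  using assms(1)
proof (induction rule: qpolys_induct)
  case (add p q)
  have "psubst f (p + q) - psubst g (p + q) = (psubst f p - psubst g p) + (psubst f q - psubst g q)"
    by (simp add: psubst_add)
  then show ?case using add by (metis dvd_add)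
next
  case (mult p q)
  have "psubst f (p * q) - psubst g (p * q)
      = (psubst f p - psubst g p) * psubst f q + psubst g p * (psubst f q - psubst g q)"
    by (simp add: psubst_mult algebra_simps)
  then show ?case using mult by (metis dvd_add dvd_mult dvd_mult2)
qed (simp_all add: assms(2))

section \<open>Intervals of simplicial posets\<close>

lemma below_mem: "y \<in> P \<Longrightarrow> y \<in> below P y"
  by (simp add: below_def)

lemma below_below: "u \<le> y \<Longrightarrow> below (below P y) u = below P u"
  by (auto simp: below_def)

lemma prank_eq:
  assumes "has_rank P y i"
  shows "prank P y = i"
proof -
  have "card (below P y) = 2 ^ i" if "has_rank P y i" for i
    using that by (auto simp: has_rank_def card_Pow dest!: bij_betw_same_card)
  then have "j = i" if "has_rank P y j" for j
    using assms that by (metis one_less_numeral_iff power_inject_exp semiring_norm(76))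
  then show ?thesis
    unfolding prank_def using assms by (intro the_equality)
qed

lemma has_rank_below: "u \<le> y \<Longrightarrow> has_rank (below P y) u i \<longleftrightarrow> has_rank P u i"
  by (simp add: has_rank_def below_below)

lemma inj_on_subset_image_iff:
  assumes "inj_on f C" "A \<subseteq> C" "B \<subseteq> C"
  shows "f ` A \<subseteq> f ` B \<longleftrightarrow> A \<subseteq> B"
proof
  assume sub: "f ` A \<subseteq> f ` B"
  show "A \<subseteq> B"
  proof
    fix a assume "a \<in> A"
    then obtain b where "b \<in> B" "f a = f b" using sub by blast
    then show "a \<in> B" using assms \<open>a \<in> A\<close> by (metis inj_onD subsetD)
  qed
qed blast

definition atom_set :: "'a::order set \<Rightarrow> 'a \<Rightarrow> 'a set" where
  "atom_set P u = {a \<in> elements_of_rank P 1. a \<le> u}"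

text \<open>A labelling of the interval below \<open>y\<close> by subsets restricts to every smaller
  interval. The bijection \<open>g\<close> renumbers \<open>S\<close>, because
  \<open>has_rank\<close> asks for the index set \<open>{..<card S}\<close>.\<close>

lemma boolean_restrict:
  fixes i :: nat
  assumes f: "bij_betw f (Pow {..<i}) (below P y)"
    and mono: "\<And>A B. A \<subseteq> {..<i} \<Longrightarrow> B \<subseteq> {..<i} \<Longrightarrow> f A \<le> f B \<longleftrightarrow> A \<subseteq> B"
    and S: "S \<subseteq> {..<i}"
  shows "below P (f S) = f ` Pow S" and "has_rank P (f S) (card S)"
proof -
  have im: "f ` Pow {..<i} = below P y"
    using f by (simp add: bij_betw_def)
  have fS: "f S \<le> y"
    using im S by (auto simp: below_def)
  show eq: "below P (f S) = f ` Pow S"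
  proof (intro equalityI subsetI)
    fix u assume u: "u \<in> below P (f S)"
    then have "u \<in> below P y" using fS by (auto simp: below_def)
    then obtain T where T: "T \<subseteq> {..<i}" "u = f T" unfolding im[symmetric] by auto
    then have "T \<subseteq> S" using u mono[of T S] S by (simp add: below_def)
    then show "u \<in> f ` Pow S" using T by auto
  next
    fix u assume "u \<in> f ` Pow S"
    then obtain T where T: "T \<subseteq> S" "u = f T" by auto
    then have "u \<in> below P y" using im S by auto
    moreover have "u \<le> f S"
      unfolding \<open>u = f T\<close> by (subst mono) (use T S in auto)
    ultimately show "u \<in> below P (f S)" by (simp add: below_def)
  qed
  have "finite S" using finite_subset[OF S] by simp
  then obtain g where g: "bij_betw g {..<card S} S"
    using ex_bij_betw_nat_finite[of S] by (auto simp: atLeast0LessThan)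
  have "bij_betw f (Pow S) (below P (f S))"
    unfolding eq using f S by (intro bij_betw_subset[OF f]) auto
  then have "bij_betw (f \<circ> (`) g) (Pow {..<card S}) (below P (f S))"
    using bij_betw_Pow[OF g] by (rule bij_betw_trans[rotated])
  moreover have "f (g ` A) \<le> f (g ` B) \<longleftrightarrow> A \<subseteq> B" if AB: "A \<subseteq> {..<card S}" "B \<subseteq> {..<card S}" for A B
  proof -
    have "g ` A \<subseteq> {..<i}" "g ` B \<subseteq> {..<i}"
      using g AB S unfolding bij_betw_def by blast+
    then have "f (g ` A) \<le> f (g ` B) \<longleftrightarrow> g ` A \<subseteq> g ` B" by (rule mono)
    also have "\<dots> \<longleftrightarrow> A \<subseteq> B"
      using g AB by (intro inj_on_subset_image_iff[where C = "{..<card S}"]) (auto simp: bij_betw_def)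
    finally show ?thesis .
  qed
  ultimately show "has_rank P (f S) (card S)"
    unfolding has_rank_def by (intro exI[of _ "f \<circ> (`) g"]) auto
qed

locale simplicial =
  fixes P :: "'a::order set"
  assumes simplicial: "simplicial_poset P"
begin

lemma finite_P: "finite P"
  using simplicial by (simp add: simplicial_poset_def)

lemma finite_rank: "finite (elements_of_rank P i)"
  using finite_P by (simp add: elements_of_rank_def)

lemma pbot_mem: "pbot P \<in> P" and pbot_le: "u \<in> P \<Longrightarrow> pbot P \<le> u"
proof -
  obtain b where b: "b \<in> P" "\<forall>x\<in>P. b \<le> x"
    using simplicial by (auto simp: simplicial_poset_def)
  then have "pbot P = b" unfolding pbot_def by (intro Least_equality) auto
  then show "pbot P \<in> P" "u \<in> P \<Longrightarrow> pbot P \<le> u" using b by auto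
qed

lemma has_rank_prank: "y \<in> P \<Longrightarrow> has_rank P y (prank P y)"
  using simplicial prank_eq by (metis simplicial_poset_def)

lemma boolean_interval:
  assumes "y \<in> P"
  obtains f where "bij_betw f (Pow {..<prank P y}) (below P y)"
    "\<And>A B. A \<subseteq> {..<prank P y} \<Longrightarrow> B \<subseteq> {..<prank P y} \<Longrightarrow> f A \<le> f B \<longleftrightarrow> A \<subseteq> B"
    "\<And>A. A \<subseteq> {..<prank P y} \<Longrightarrow> prank P (f A) = card A"
    "\<And>A. A \<subseteq> {..<prank P y} \<Longrightarrow> atom_set P (f A) = (\<lambda>k. f {k}) ` A"
    "inj_on (\<lambda>k. f {k}) {..<prank P y}"
proof -
  let ?r = "prank P y"
  obtain f where f: "bij_betw f (Pow {..<?r}) (below P y)"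
    and mono: "\<And>A B. A \<subseteq> {..<?r} \<Longrightarrow> B \<subseteq> {..<?r} \<Longrightarrow> f A \<le> f B \<longleftrightarrow> A \<subseteq> B"
    using has_rank_prank[OF assms] by (auto simp: has_rank_def)
  have rank: "prank P (f A) = card A" if "A \<subseteq> {..<?r}" for A
    using boolean_restrict(2)[OF f mono that] by (rule prank_eq)
  have inP: "f A \<in> P" if "A \<subseteq> {..<?r}" for A
    using f that by (auto simp: bij_betw_def below_def)
  have atoms: "atom_set P (f A) = (\<lambda>k. f {k}) ` A" if A: "A \<subseteq> {..<?r}" for A
  proof (intro equalityI subsetI)
    fix a assume a: "a \<in> atom_set P (f A)"
    then have "a \<in> below P (f A)" by (auto simp: atom_set_def elements_of_rank_def below_def)
    then obtain T where T: "T \<subseteq> A" "a = f T"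
      using boolean_restrict(1)[OF f mono A] by auto
    then have "card T = 1" using rank[of T] a A by (auto simp: atom_set_def elements_of_rank_def)
    then obtain k where "T = {k}" by (rule card_1_singletonE)
    then show "a \<in> (\<lambda>k. f {k}) ` A" using T by auto
  next
    fix a assume "a \<in> (\<lambda>k. f {k}) ` A"
    then obtain k where k: "k \<in> A" "a = f {k}" by auto
    then have "{k} \<subseteq> {..<?r}" using A by auto
    then show "a \<in> atom_set P (f A)"
      using k rank[of "{k}"] inP[of "{k}"] mono[of "{k}" A] A
      by (simp add: atom_set_def elements_of_rank_def)
  qed
  have inj: "inj_on (\<lambda>k. f {k}) {..<?r}"
  proof (rule inj_onI)
    fix k l assume "k \<in> {..<?r}" "l \<in> {..<?r}" "f {k} = f {l}"
    then have "{k} = {l}" using inj_onD[of f "Pow {..<?r}" "{k}" "{l}"] f by (simp add: bij_betw_def)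
    then show "k = l" by simp
  qed
  show thesis by (rule that[OF f mono rank atoms inj])
qed

text \<open>The common upper bound \<open>y\<close> is essential: in a simplicial poset distinct
  elements may have the same atoms, but never below a common element. This is why the facts on atom
  sets are stated inside one interval.\<close>

lemma atom_set_le_iff:
  assumes "y \<in> P" "u \<in> below P y" "v \<in> below P y"
  shows "u \<le> v \<longleftrightarrow> atom_set P u \<subseteq> atom_set P v"
proof -
  obtain f where f: "bij_betw f (Pow {..<prank P y}) (below P y)"
    and mono: "\<And>A B. A \<subseteq> {..<prank P y} \<Longrightarrow> B \<subseteq> {..<prank P y} \<Longrightarrow> f A \<le> f B \<longleftrightarrow> A \<subseteq> B"
    and atoms: "\<And>A. A \<subseteq> {..<prank P y} \<Longrightarrow> atom_set P (f A) = (\<lambda>k. f {k}) ` A"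
    and inj: "inj_on (\<lambda>k. f {k}) {..<prank P y}"
    using boolean_interval[OF assms(1)] by metis
  have im: "below P y = f ` Pow {..<prank P y}"
    using f by (simp add: bij_betw_def)
  obtain A B where A: "A \<subseteq> {..<prank P y}" "u = f A" and B: "B \<subseteq> {..<prank P y}" "v = f B"
    using assms(2,3) unfolding im by blast
  have "(\<lambda>k. f {k}) ` A \<subseteq> (\<lambda>k. f {k}) ` B \<longleftrightarrow> A \<subseteq> B"
    using A B inj by (intro inj_on_subset_image_iff[where C = "{..<prank P y}"])
  then show ?thesis using mono atoms A B by simp
qed

lemma atom_set_inj:
  assumes "y \<in> P" "u \<in> below P y" "v \<in> below P y" "atom_set P u = atom_set P v"
  shows "u = v"
  using atom_set_le_iff[of y u v] atom_set_le_iff[of y v u] assms by (metis order.antisym order_refl)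

lemma atom_set_ex:
  assumes "y \<in> P" "B \<subseteq> atom_set P y"
  obtains u where "u \<in> below P y" "atom_set P u = B"
proof -
  obtain f where f: "bij_betw f (Pow {..<prank P y}) (below P y)"
    and atoms: "\<And>A. A \<subseteq> {..<prank P y} \<Longrightarrow> atom_set P (f A) = (\<lambda>k. f {k}) ` A"
    and inj: "inj_on (\<lambda>k. f {k}) {..<prank P y}"
    using boolean_interval[OF assms(1)] by metis
  have im: "below P y = f ` Pow {..<prank P y}"
    using f by (simp add: bij_betw_def)
  obtain A where A: "A \<subseteq> {..<prank P y}" "y = f A"
    using below_mem[OF assms(1)] unfolding im by blast
  then have "B \<subseteq> (\<lambda>k. f {k}) ` A" using assms(2) atoms by auto
  then obtain C where C: "C \<subseteq> A" "B = (\<lambda>k. f {k}) ` C" by (auto simp: subset_image_iff)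
  have "C \<subseteq> {..<prank P y}" using C A by blast
  then have "f C \<in> below P y" "atom_set P (f C) = B"
    using f atoms C by (auto simp: bij_betw_def)
  then show thesis by (rule that)
qed

lemma card_atom_set:
  assumes "y \<in> P"
  shows "card (atom_set P y) = prank P y"
proof -
  obtain f where f: "bij_betw f (Pow {..<prank P y}) (below P y)"
    and rank: "\<And>A. A \<subseteq> {..<prank P y} \<Longrightarrow> prank P (f A) = card A"
    and atoms: "\<And>A. A \<subseteq> {..<prank P y} \<Longrightarrow> atom_set P (f A) = (\<lambda>k. f {k}) ` A"
    and inj: "inj_on (\<lambda>k. f {k}) {..<prank P y}"
    using boolean_interval[OF assms(1)] by metis
  have im: "below P y = f ` Pow {..<prank P y}"
    using f by (simp add: bij_betw_def)
  obtain A where A: "A \<subseteq> {..<prank P y}" "y = f A"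
    using below_mem[OF assms(1)] unfolding im by blast
  have "inj_on (\<lambda>k. f {k}) A"
    using inj A(1) by (rule inj_on_subset)
  then show ?thesis using A rank atoms by (metis card_image)
qed

lemma finite_atom_set: "finite (atom_set P u)"
  using finite_rank[of 1] by (simp add: atom_set_def)

lemma atom_set_mono: "u \<le> v \<Longrightarrow> atom_set P u \<subseteq> atom_set P v"
  by (auto simp: atom_set_def)

lemma atom_set_eq_empty: "u \<in> P \<Longrightarrow> atom_set P u = {} \<longleftrightarrow> u = pbot P"
proof -
  have "atom_set P (pbot P) = {}"
  proof -
    have "below P (pbot P) = {pbot P}"
      using pbot_mem pbot_le by (auto simp: below_def intro: order.antisym)
    then have "bij_betw (\<lambda>_. pbot P) (Pow {..<0::nat}) (below P (pbot P))"
      by (simp add: bij_betw_def)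
    then have "has_rank P (pbot P) 0"
      unfolding has_rank_def by (intro exI[of _ "\<lambda>_. pbot P"]) simp
    then show ?thesis
      using card_atom_set[OF pbot_mem] finite_atom_set by (simp add: prank_eq)
  qed
  moreover assume "u \<in> P"
  ultimately show ?thesis
    using atom_set_inj[of u u "pbot P"] pbot_mem pbot_le[of u] by (auto simp: below_def)
qed

lemma atom_set_of_atom: "a \<in> elements_of_rank P 1 \<Longrightarrow> atom_set P a = {a}"
proof -
  assume a: "a \<in> elements_of_rank P 1"
  then have "card (atom_set P a) = 1" "a \<in> atom_set P a"
    using card_atom_set[of a] by (auto simp: elements_of_rank_def atom_set_def)
  then show ?thesis by (metis card_1_singletonE singletonD)
qed

text \<open>Below a common upper bound the greatest lower bound exists in all of \<open>P\<close>,
  because every lower bound of \<open>a\<close> again lies in the boolean interval. Elsewhere the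
  value of \<open>pmeet\<close> is arbitrary.\<close>

lemma pmeet_below:
  assumes "y \<in> P" "a \<in> below P y" "b \<in> below P y"
  shows "pmeet P a b \<in> below P y" "atom_set P (pmeet P a b) = atom_set P a \<inter> atom_set P b"
proof -
  obtain c where c: "c \<in> below P y" "atom_set P c = atom_set P a \<inter> atom_set P b"
    using atom_set_ex[OF assms(1), of "atom_set P a \<inter> atom_set P b"]
      atom_set_mono[of a y] assms(2) by (auto simp: below_def)
  have "pmeet P a b = c"
    unfolding pmeet_def
  proof (rule Greatest_equality)
    show "c \<in> P \<and> c \<le> a \<and> c \<le> b"
      using c atom_set_le_iff[OF assms(1), of c a] atom_set_le_iff[OF assms(1), of c b] assms(2,3)
      by (auto simp: below_def)
    fix v assume v: "v \<in> P \<and> v \<le> a \<and> v \<le> b"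
    then have "v \<in> below P y" using assms(2) by (auto simp: below_def)
    then show "v \<le> c"
      using atom_set_le_iff[OF assms(1), of v c] atom_set_mono[of v a] atom_set_mono[of v b] c v by simp
  qed
  then show "pmeet P a b \<in> below P y" "atom_set P (pmeet P a b) = atom_set P a \<inter> atom_set P b"
    using c by auto
qed

text \<open>In \<open>P\<close> there may be many minimal upper bounds, but only the boolean join
  lies below \<open>y\<close>. Hence the sum in a face relation shrinks to a single term after
  restriction to \<open>y\<close>.\<close>

lemma pjoin_below:
  assumes "y \<in> P" "a \<in> below P y" "b \<in> below P y"
  obtains j where "j \<in> below P y" "atom_set P j = atom_set P a \<union> atom_set P b"
    "{z \<in> minimal_upper_bounds P a b. z \<le> y} = {j}"
proof -
  obtain j where j: "j \<in> below P y" "atom_set P j = atom_set P a \<union> atom_set P b"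
    using atom_set_ex[OF assms(1), of "atom_set P a \<union> atom_set P b"]
      atom_set_mono[of a y] atom_set_mono[of b y] assms(2,3) by (auto simp: below_def)
  have le: "a \<le> j" "b \<le> j"
    using atom_set_le_iff[OF assms(1) _ j(1)] j assms(2,3) by auto
  have least: "j \<le> v" if "v \<in> below P y" "a \<le> v" "b \<le> v" for v
    using atom_set_le_iff[OF assms(1) j(1) that(1)] j atom_set_mono that by auto
  have "z = j" if "z \<in> minimal_upper_bounds P a b" "z \<le> y" for z
  proof -
    have "z \<in> below P y" "a \<le> z" "b \<le> z"
      using that by (auto simp: minimal_upper_bounds_def below_def)
    then have "j \<le> z" by (rule least)
    then show "z = j"
      using that(1) j(1) le unfolding minimal_upper_bounds_def below_def by blast
  qed
  moreover have "j \<in> minimal_upper_bounds P a b" "j \<le> y"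
  proof -
    show "j \<le> y" using j by (simp add: below_def)
    then have "w = j" if "w \<in> P" "a \<le> w" "b \<le> w" "w \<le> j" for w
      using least[of w] that by (auto simp: below_def intro: order.antisym)
    then show "j \<in> minimal_upper_bounds P a b"
      using j le by (auto simp: minimal_upper_bounds_def below_def)
  qed
  ultimately have "{z \<in> minimal_upper_bounds P a b. z \<le> y} = {j}" by blast
  with j show thesis by (rule that)
qed

lemma simplicial_below: "y \<in> P \<Longrightarrow> simplicial_poset (below P y)"
  unfolding simplicial_poset_def
proof (intro conjI ballI)
  assume y: "y \<in> P"
  show "finite (below P y)" using finite_P by (simp add: below_def)
  show "\<exists>b\<in>below P y. \<forall>x\<in>below P y. b \<le> x"
    using pbot_mem pbot_le y by (intro bexI[of _ "pbot P"]) (auto simp: below_def)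
  fix u assume "u \<in> below P y"
  then have "has_rank P u (prank P u)" "u \<le> y"
    using has_rank_prank[of u] by (auto simp: below_def)
  then show "\<exists>i. has_rank (below P y) u i"
    using has_rank_below[of u y P] by blast
qed

lemma pbot_below: "y \<in> P \<Longrightarrow> pbot (below P y) = pbot P"
  unfolding pbot_def[of "below P y"]
  using pbot_mem pbot_le by (intro Least_equality) (auto simp: below_def)

lemma pmeet_below_eq: "a \<le> y \<Longrightarrow> pmeet (below P y) a b = pmeet P a b"
proof -
  assume "a \<le> y"
  then have "(c \<in> below P y \<and> c \<le> a \<and> c \<le> b) = (c \<in> P \<and> c \<le> a \<and> c \<le> b)" for c
    by (auto simp: below_def)
  then show ?thesis by (simp add: pmeet_def)
qed

lemma minimal_upper_bounds_below:
  "minimal_upper_bounds (below P y) a b = {z \<in> minimal_upper_bounds P a b. z \<le> y}"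
  by (auto simp: minimal_upper_bounds_def below_def)

end

section \<open>The face ring as a quotient\<close>

lemma qpoly_ring_simps [simp]:
  "carrier (qpoly_ring V) = qpolys V" "p \<otimes>\<^bsub>qpoly_ring V\<^esub> q = p * q" "p \<oplus>\<^bsub>qpoly_ring V\<^esub> q = p + q"
  "\<one>\<^bsub>qpoly_ring V\<^esub> = 1" "\<zero>\<^bsub>qpoly_ring V\<^esub> = 0"
  by (simp_all add: qpoly_ring_def qpolys_def)

lemma cring_qpoly_ring: "cring (qpoly_ring V)"
proof (intro cringI abelian_groupI comm_monoidI)
  fix p assume "p \<in> carrier (qpoly_ring V)"
  then show "\<exists>q\<in>carrier (qpoly_ring V). q \<oplus>\<^bsub>qpoly_ring V\<^esub> p = \<zero>\<^bsub>qpoly_ring V\<^esub>"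
    by (intro bexI[of _ "- p"]) (simp_all add: qpolys_closed)
qed (simp_all add: qpolys_closed algebra_simps)

lemma ring_hom_psubst:
  assumes "\<And>v. v \<in> V \<Longrightarrow> f v \<in> qpolys W"
  shows "ring_hom_ring (qpoly_ring V) (qpoly_ring W) (psubst f)"
  using cring_qpoly_ring[of V] cring_qpoly_ring[of W] assms
  by (intro ring_hom_ringI2 ring_hom_memI)
     (auto intro: cring.axioms psubst_in_qpolys simp: psubst_simps)

context simplicial
begin

lemma pvar_eq: "pvar P u = (if u = pbot P then 1 else pX u)"
  by (simp add: pvar_def pX_def)

lemma pvar_mem: "u \<in> P \<Longrightarrow> pvar P u \<in> qpolys (P - {pbot P})"
  by (simp add: pvar_eq)

lemma face_relations_subset: "face_relations P \<subseteq> qpolys (P - {pbot P})"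
proof
  fix r assume "r \<in> face_relations P"
  then obtain a b where a: "a \<in> P" and b: "b \<in> P" and r: "r = pvar P a * pvar P b
      - pvar P (pmeet P a b) * (\<Sum>z \<in> minimal_upper_bounds P a b. pvar P z)"
    by (auto simp: face_relations_def)
  have "pvar P (pmeet P a b) * (\<Sum>z \<in> minimal_upper_bounds P a b. pvar P z) \<in> qpolys (P - {pbot P})"
  \<comment> \<open>Without upper bounds \<open>pmeet P a b\<close> may lie outside
    \<open>P\<close>; the empty sum then makes the product 0.\<close>
  proof (cases "minimal_upper_bounds P a b = {}")
    case False
    then obtain z where "z \<in> P" "a \<in> below P z" "b \<in> below P z"
      using a b by (auto simp: minimal_upper_bounds_def below_def)
    then have "pmeet P a b \<in> P"
      using pmeet_below(1)[of z a b] by (auto simp: below_def)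
    then show ?thesis
      by (intro qpolys_closed pvar_mem) (auto simp: minimal_upper_bounds_def)
  qed simp
  then show "r \<in> qpolys (P - {pbot P})"
    unfolding r using a b by (intro qpolys_diff qpolys_mult[OF pvar_mem pvar_mem])
qed

lemma cring_poly_of_poset: "cring (poly_of_poset P)"
  unfolding poly_of_poset_def by (rule cring_qpoly_ring)

lemma ideal_face_ideal: "ideal (face_ideal P) (poly_of_poset P)"
  unfolding face_ideal_def
  using face_relations_subset cring_poly_of_poset
  by (intro ring.genideal_ideal) (auto simp: poly_of_poset_def intro: cring.axioms)

lemma face_relations_in_ideal: "face_relations P \<subseteq> face_ideal P"
  unfolding face_ideal_def
  using face_relations_subset cring_poly_of_poset
  by (intro ring.genideal_self) (auto simp: poly_of_poset_def intro: cring.axioms)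

lemma cring_face_ring: "cring (face_ring P)"
  unfolding face_ring_def
  by (rule ideal.quotient_is_cring[OF ideal_face_ideal cring_poly_of_poset])

lemma ring_face_ring: "ring (face_ring P)"
  by (rule cring.axioms[OF cring_face_ring])

lemma face_class_hom: "face_class P \<in> Ring.ring_hom (qpoly_ring (P - {pbot P})) (face_ring P)"
  using ideal.rcos_ring_hom[OF ideal_face_ideal]
  by (simp add: face_class_def[abs_def] face_ring_def poly_of_poset_def)

lemma carrier_face_ring: "carrier (face_ring P) = face_class P ` qpolys (P - {pbot P})"
  by (auto simp: face_ring_def FactRing_def A_RCOSETS_def' face_class_def poly_of_poset_def)

lemma face_class_mem [simp]: "p \<in> qpolys (P - {pbot P}) \<Longrightarrow> face_class P p \<in> carrier (face_ring P)"
  by (simp add: carrier_face_ring)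

lemma face_class_mult:
  "p \<in> qpolys (P - {pbot P}) \<Longrightarrow> q \<in> qpolys (P - {pbot P}) \<Longrightarrow>
    face_class P (p * q) = face_class P p \<otimes>\<^bsub>face_ring P\<^esub> face_class P q"
  using Ring.ring_hom_mult[OF face_class_hom] by simp

lemma face_class_add:
  "p \<in> qpolys (P - {pbot P}) \<Longrightarrow> q \<in> qpolys (P - {pbot P}) \<Longrightarrow>
    face_class P (p + q) = face_class P p \<oplus>\<^bsub>face_ring P\<^esub> face_class P q"
  using Ring.ring_hom_add[OF face_class_hom] by simp

lemma face_class_one: "face_class P 1 = \<one>\<^bsub>face_ring P\<^esub>"
  using Ring.ring_hom_one[OF face_class_hom] by simp

lemma face_class_zero: "face_class P 0 = \<zero>\<^bsub>face_ring P\<^esub>"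
  using Ring.ring_hom_zero[OF face_class_hom] cring_qpoly_ring ring_face_ring by (auto dest: cring.axioms)

lemma face_class_uminus:
  assumes "p \<in> qpolys (P - {pbot P})"
  shows "face_class P (- p) = \<ominus>\<^bsub>face_ring P\<^esub> face_class P p"
proof -
  interpret ring "face_ring P" by (rule ring_face_ring)
  have "face_class P (- p) \<oplus>\<^bsub>face_ring P\<^esub> face_class P p = \<zero>\<^bsub>face_ring P\<^esub>"
    using face_class_add[of "- p" p] assms by (simp add: qpolys_closed face_class_zero)
  then show ?thesis
    using assms by (intro minus_equality[symmetric]) (simp_all add: qpolys_closed)
qed

lemma face_class_eq_iff:
  assumes "p \<in> qpolys (P - {pbot P})" "q \<in> qpolys (P - {pbot P})"
  shows "face_class P p = face_class P q \<longleftrightarrow> p - q \<in> face_ideal P"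
proof -
  interpret R: cring "poly_of_poset P" by (rule cring_poly_of_poset)
  interpret I: ideal "face_ideal P" "poly_of_poset P" by (rule ideal_face_ideal)
  have "\<ominus>\<^bsub>poly_of_poset P\<^esub> q = - q"
    using assms(2) by (intro R.minus_equality) (simp_all add: poly_of_poset_def qpolys_closed)
  then have "p \<ominus>\<^bsub>poly_of_poset P\<^esub> q = p - q"
    by (simp add: a_minus_def poly_of_poset_def)
  then show ?thesis
    unfolding face_class_def
    using R.quotient_eq_iff_same_a_r_cos[OF ideal_face_ideal, of p q] assms
    by (simp add: poly_of_poset_def)
qed

lemma face_class_sum:
  "(\<And>i. i \<in> A \<Longrightarrow> f i \<in> qpolys (P - {pbot P})) \<Longrightarrow>
    face_class P (sum f A) = (\<Oplus>\<^bsub>face_ring P\<^esub>i\<in>A. face_class P (f i))"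
proof (induction A rule: infinite_finite_induct)
  case (infinite A)
  interpret ring "face_ring P" by (rule ring_face_ring)
  from infinite show ?case by (simp add: face_class_zero finsum_infinite)
next
  case empty
  interpret ring "face_ring P" by (rule ring_face_ring)
  show ?case by (simp add: face_class_zero)
next
  case (insert i A)
  interpret ring "face_ring P" by (rule ring_face_ring)
  from insert show ?case by (subst finsum_insert) (auto simp: face_class_add qpolys_closed)
qed

lemma face_class_prod:
  assumes "finite A"
  shows "(\<And>i. i \<in> A \<Longrightarrow> f i \<in> qpolys (P - {pbot P})) \<Longrightarrow>
    face_class P (prod f A) = (\<Otimes>\<^bsub>face_ring P\<^esub>i\<in>A. face_class P (f i))"
  using assms
proof (induction A rule: finite_induct)
  case empty
  interpret cring "face_ring P" by (rule cring_face_ring)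
  show ?case by (simp add: face_class_one)
next
  case (insert i A)
  interpret cring "face_ring P" by (rule cring_face_ring)
  from insert show ?case by (subst finprod_insert) (auto simp: face_class_mult qpolys_closed)
qed

text \<open>The preimage of \<open>J\<close> is an ideal, so it contains the face ideal as soon as
  it contains the generators. A general \<open>J\<close> allows a target that is itself a quotient,
  namely the face ring of an interval.\<close>

lemma psubst_face_ideal:
  assumes J: "ideal J (qpoly_ring W)" and f: "\<And>v. v \<in> P - {pbot P} \<Longrightarrow> f v \<in> qpolys W"
    and rel: "\<And>r. r \<in> face_relations P \<Longrightarrow> psubst f r \<in> J" and p: "p \<in> face_ideal P"
  shows "psubst f p \<in> J"
proof -
  interpret h: ring_hom_ring "qpoly_ring (P - {pbot P})" "qpoly_ring W" "psubst f"
    by (rule ring_hom_psubst[OF f])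
  have "ideal {r \<in> qpolys (P - {pbot P}). psubst f r \<in> J} (poly_of_poset P)"
    using h.ideal_vimage[OF J] by (simp add: poly_of_poset_def)
  moreover have "face_relations P \<subseteq> {r \<in> qpolys (P - {pbot P}). psubst f r \<in> J}"
    using rel face_relations_subset by auto
  ultimately have "face_ideal P \<subseteq> {r \<in> qpolys (P - {pbot P}). psubst f r \<in> J}"
    unfolding face_ideal_def
    using cring_poly_of_poset by (intro ring.genideal_minimal) (auto intro: cring.axioms)
  then show ?thesis using p by auto
qed

lemma psubst_face_ideal_0:
  assumes rel: "\<And>r. r \<in> face_relations P \<Longrightarrow> psubst f r = 0" and p: "p \<in> face_ideal P"
  shows "psubst f p = 0"
proof -
  have "ideal {0} (qpoly_ring UNIV)"
    using ring.zeroideal[OF cring.axioms(1)[OF cring_qpoly_ring]] by simp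
  from psubst_face_ideal[OF this _ _ p, of f] show ?thesis
    using rel by (simp add: qpolys_UNIV)
qed

lemma psubst_face_class_eq:
  assumes "\<And>r. r \<in> face_relations P \<Longrightarrow> psubst f r = 0"
    and "p \<in> qpolys (P - {pbot P})" "q \<in> qpolys (P - {pbot P})" "face_class P p = face_class P q"
  shows "psubst f p = psubst f q"
  using psubst_face_ideal_0[OF assms(1), of "p - q"] assms(2-4)
  by (simp add: face_class_eq_iff psubst_diff)

end

section \<open>Evaluation at a face\<close>

text \<open>The face ring of the interval below \<open>y\<close> is a polynomial ring on the atoms
  of \<open>y\<close>, each element being the product of its atoms; this is the projection to it,
  followed by atom i being sent to \<open>f i\<close>. It is used with three choices of
  \<open>f\<close>: multiples of one variable (finiteness forces independence), the linear forms
  L_i(y) (the map \<open>iota\<close>), and the variables themselves (reading off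
  coefficients).\<close>

definition face_subst :: "nat \<Rightarrow> (nat \<Rightarrow> 'a::order) \<Rightarrow> 'a \<Rightarrow> (nat \<Rightarrow> 'b qpoly) \<Rightarrow> 'a \<Rightarrow> 'b qpoly" where
  "face_subst n x y f u = (if u \<le> y then \<Prod>i\<in>atoms_below n x u. f i else 0)"

definition interval_subst :: "'a::order \<Rightarrow> 'a \<Rightarrow> 'a qpoly" where
  "interval_subst y u = (if u \<le> y then pX u else 0)"

lemma face_relationsI:
  "a \<in> P - {pbot P} \<Longrightarrow> b \<in> P - {pbot P} \<Longrightarrow> pvar P a * pvar P b
    - pvar P (pmeet P a b) * (\<Sum>z \<in> minimal_upper_bounds P a b. pvar P z) \<in> face_relations P"
  unfolding face_relations_def by blast

lemma finite_atoms_below [simp]: "finite (atoms_below n x u)"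
  by (simp add: atoms_below_def)

lemma atoms_below_mono: "u \<le> v \<Longrightarrow> atoms_below n x u \<subseteq> atoms_below n x v"
  by (auto simp: atoms_below_def)

locale labelled = simplicial P for P :: "'a::order set" +
  fixes n :: nat and x :: "nat \<Rightarrow> 'a"
  assumes labelling: "bij_betw x {1..n} (elements_of_rank P 1)"
begin

lemma inj_label: "inj_on x {1..n}"
  using labelling by (simp add: bij_betw_def)

lemma label_atom: "i \<in> {1..n} \<Longrightarrow> x i \<in> elements_of_rank P 1"
  using labelling bij_betwE by blast

lemma atom_set_label: "atom_set P u = x ` atoms_below n x u"
proof -
  have "elements_of_rank P 1 = x ` {1..n}" using labelling by (simp add: bij_betw_def)
  then show ?thesis by (auto simp: atom_set_def atoms_below_def)
qed

lemma label_image_subset_iff: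
  "A \<subseteq> {1..n} \<Longrightarrow> B \<subseteq> {1..n} \<Longrightarrow> x ` A \<subseteq> x ` B \<longleftrightarrow> A \<subseteq> B"
  by (rule inj_on_subset_image_iff[OF inj_label])

lemma label_image_eq_iff:
  "A \<subseteq> {1..n} \<Longrightarrow> B \<subseteq> {1..n} \<Longrightarrow> x ` A = x ` B \<longleftrightarrow> A = B"
  by (rule inj_on_image_eq_iff[OF inj_label])

lemma atoms_below_subset: "atoms_below n x u \<subseteq> {1..n}"
  by (auto simp: atoms_below_def)

lemma atoms_below_le_iff:
  "y \<in> P \<Longrightarrow> u \<in> below P y \<Longrightarrow> v \<in> below P y \<Longrightarrow> u \<le> v \<longleftrightarrow> atoms_below n x u \<subseteq> atoms_below n x v"
  using atom_set_le_iff[of y u v] label_image_subset_iff[OF atoms_below_subset atoms_below_subset]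
  by (simp add: atom_set_label)

lemma atoms_below_inj:
  "y \<in> P \<Longrightarrow> u \<in> below P y \<Longrightarrow> v \<in> below P y \<Longrightarrow> atoms_below n x u = atoms_below n x v \<Longrightarrow> u = v"
  using atom_set_inj[of y u v] by (simp add: atom_set_label)

lemma atoms_below_ex:
  assumes "y \<in> P" "B \<subseteq> atoms_below n x y"
  obtains u where "u \<in> below P y" "atoms_below n x u = B"
proof -
  have "x ` B \<subseteq> atom_set P y" using assms(2) by (auto simp: atom_set_label)
  then obtain u where u: "u \<in> below P y" "atom_set P u = x ` B"
    using atom_set_ex[OF assms(1)] by metis
  have "B \<subseteq> {1..n}" using assms(2) atoms_below_subset[of y] by (rule subset_trans)
  then have "atoms_below n x u = B"
    using u(2) label_image_eq_iff[OF atoms_below_subset] by (simp add: atom_set_label)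
  with u(1) show thesis by (rule that)
qed

lemma card_atoms_below: "y \<in> P \<Longrightarrow> card (atoms_below n x y) = prank P y"
  using card_atom_set[of y] card_image[OF inj_on_subset[OF inj_label atoms_below_subset]]
  by (simp add: atom_set_label)

lemma atoms_below_eq_empty: "u \<in> P \<Longrightarrow> atoms_below n x u = {} \<longleftrightarrow> u = pbot P"
  using atom_set_eq_empty[of u] by (simp add: atom_set_label)

lemma atoms_below_pbot: "atoms_below n x (pbot P) = {}"
  using atoms_below_eq_empty[OF pbot_mem] by simp

lemma label_mem: "i \<in> {1..n} \<Longrightarrow> x i \<in> P - {pbot P}"
  and atoms_below_label: "i \<in> {1..n} \<Longrightarrow> atoms_below n x (x i) = {i}"
proof -
  assume i: "i \<in> {1..n}"
  have "x ` atoms_below n x (x i) = x ` {i}"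
    using atom_set_of_atom[OF label_atom[OF i]] by (simp add: atom_set_label)
  then show *: "atoms_below n x (x i) = {i}"
    using label_image_eq_iff[OF atoms_below_subset, of "{i}"] i by simp
  show "x i \<in> P - {pbot P}"
    using label_atom[OF i] * atoms_below_pbot by (auto simp: elements_of_rank_def)
qed

lemma psubst_face_subst_pvar:
  "y \<in> P \<Longrightarrow> psubst (face_subst n x y f) (pvar P u) = face_subst n x y f u"
  using pbot_le[of y] by (auto simp: pvar_eq face_subst_def atoms_below_pbot)

text \<open>Below \<open>y\<close> the meet and the join correspond to intersection and union of
  atom sets, and the product over A times the product over B is the product over the union times
  that over the intersection. If \<open>a\<close> or \<open>b\<close> is not below \<open>y\<close>,
  no upper bound is, and both terms vanish.\<close>

lemma face_subst_relations:
  assumes y: "y \<in> P" and r: "r \<in> face_relations P"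
  shows "psubst (face_subst n x y f) r = 0"
proof -
  obtain a b where a: "a \<in> P" and b: "b \<in> P" and r: "r = pvar P a * pvar P b
      - pvar P (pmeet P a b) * (\<Sum>z \<in> minimal_upper_bounds P a b. pvar P z)"
    using r by (auto simp: face_relations_def)
  let ?F = "face_subst n x y f"
  have fin: "finite (minimal_upper_bounds P a b)"
    using finite_P by (simp add: minimal_upper_bounds_def)
  have eq: "psubst ?F r = ?F a * ?F b - ?F (pmeet P a b) * (\<Sum>z \<in> minimal_upper_bounds P a b. ?F z)"
    unfolding r by (simp add: psubst_simps psubst_face_subst_pvar[OF y])
  also have "(\<Sum>z \<in> minimal_upper_bounds P a b. ?F z)
      = (\<Sum>z \<in> {z \<in> minimal_upper_bounds P a b. z \<le> y}. ?F z)"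
    using fin by (intro sum.mono_neutral_right) (auto simp: face_subst_def)
  finally have eq: "psubst ?F r = ?F a * ?F b
      - ?F (pmeet P a b) * (\<Sum>z \<in> {z \<in> minimal_upper_bounds P a b. z \<le> y}. ?F z)" .
  show ?thesis
  proof (cases "a \<le> y \<and> b \<le> y")
    case True
    then have ab: "a \<in> below P y" "b \<in> below P y" using a b by (auto simp: below_def)
    obtain j where j: "j \<in> below P y" "atom_set P j = atom_set P a \<union> atom_set P b"
      "{z \<in> minimal_upper_bounds P a b. z \<le> y} = {j}"
      using pjoin_below[OF y ab] by metis
    have "atoms_below n x j = atoms_below n x a \<union> atoms_below n x b"
      using j(2) label_image_eq_iff[of "atoms_below n x j" "atoms_below n x a \<union> atoms_below n x b"]
        atoms_below_subset by (simp add: atom_set_label image_Un)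
    moreover have "atoms_below n x (pmeet P a b) = atoms_below n x a \<inter> atoms_below n x b"
    proof -
      have "x ` atoms_below n x (pmeet P a b) = x ` (atoms_below n x a \<inter> atoms_below n x b)"
        using pmeet_below(2)[OF y ab] inj_on_image_Int[OF inj_label atoms_below_subset atoms_below_subset]
        by (simp add: atom_set_label)
      then show ?thesis
        using label_image_eq_iff[of "atoms_below n x (pmeet P a b)" "atoms_below n x a \<inter> atoms_below n x b"]
          atoms_below_subset by blast
    qed
    moreover have "j \<le> y" "pmeet P a b \<le> y"
      using j pmeet_below(1)[OF y ab] by (auto simp: below_def)
    ultimately show ?thesis
      unfolding eq j(3)
      using True prod.union_inter[of "atoms_below n x a" "atoms_below n x b" f]
      by (simp add: face_subst_def mult.commute)
  next
    case False
    moreover have "{z \<in> minimal_upper_bounds P a b. z \<le> y} = {}"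
      using False by (auto simp: minimal_upper_bounds_def)
    ultimately show ?thesis unfolding eq by (simp only:) (auto simp: face_subst_def)
  qed
qed

end

section \<open>The epimorphism of face rings onto an interval\<close>

context simplicial
begin

lemma zero_face_ideal: "0 \<in> face_ideal P"
  using ideal.axioms(1)[OF ideal_face_ideal, THEN additive_subgroup.zero_closed]
  by (simp add: poly_of_poset_def)

lemma interval_subst_mem:
  "y \<in> P \<Longrightarrow> v \<in> P - {pbot P} \<Longrightarrow> interval_subst y v \<in> qpolys (below P y - {pbot (below P y)})"
  by (simp add: interval_subst_def pbot_below) (simp add: below_def)

lemma psubst_interval_mem:
  "y \<in> P \<Longrightarrow> p \<in> qpolys (P - {pbot P}) \<Longrightarrow>
    psubst (interval_subst y) p \<in> qpolys (below P y - {pbot (below P y)})"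
  by (erule psubst_in_qpolys) (rule interval_subst_mem)

lemma psubst_interval_pvar:
  "y \<in> P \<Longrightarrow> psubst (interval_subst y) (pvar P u) = (if u \<le> y then pvar (below P y) u else 0)"
  using pbot_le[of y] by (auto simp: pvar_def pbot_below interval_subst_def pX_def[symmetric]
      simp del: One_nat_def)

text \<open>Each relation of \<open>P\<close> becomes either 0 or the relation of the interval for
  the same pair. This serves both ways: the interval map respects the ideals, and every relation of
  the interval comes from one of \<open>P\<close>.\<close>

lemma psubst_interval_relation:
  assumes y: "y \<in> P" and a: "a \<in> P" and b: "b \<in> P"
  shows "psubst (interval_subst y) (pvar P a * pvar P b
      - pvar P (pmeet P a b) * (\<Sum>z \<in> minimal_upper_bounds P a b. pvar P z))
    = (if a \<le> y \<and> b \<le> y then pvar (below P y) a * pvar (below P y) b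
      - pvar (below P y) (pmeet (below P y) a b)
        * (\<Sum>z \<in> minimal_upper_bounds (below P y) a b. pvar (below P y) z) else 0)"
proof -
  have fin: "finite (minimal_upper_bounds P a b)"
    using finite_P by (simp add: minimal_upper_bounds_def)
  have sum: "(\<Sum>z \<in> minimal_upper_bounds P a b. if z \<le> y then pvar (below P y) z else 0)
      = (\<Sum>z \<in> minimal_upper_bounds (below P y) a b. pvar (below P y) z)"
    unfolding minimal_upper_bounds_below using fin by (simp add: sum.inter_filter)
  show ?thesis
  proof (cases "a \<le> y \<and> b \<le> y")
    case True
    then have "a \<in> below P y" "b \<in> below P y" using a b by (auto simp: below_def)
    then have "pmeet P a b \<le> y" using pmeet_below(1)[OF y] by (auto simp: below_def)
    then show ?thesis
      using True by (simp add: psubst_simps psubst_interval_pvar[OF y] sum pmeet_below_eq)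
  next
    case False
    then have "minimal_upper_bounds (below P y) a b = {}"
      by (auto simp: minimal_upper_bounds_def below_def)
    then show ?thesis
      using False by (auto simp add: psubst_simps psubst_interval_pvar[OF y] sum)
  qed
qed

lemma psubst_interval_ideal:
  assumes y: "y \<in> P" and p: "p \<in> face_ideal P"
  shows "psubst (interval_subst y) p \<in> face_ideal (below P y)"
proof -
  interpret Q: simplicial "below P y"
    using simplicial_below[OF y] by unfold_locales
  show ?thesis
  proof (rule psubst_face_ideal[OF _ interval_subst_mem[OF y] _ p])
    show "ideal (face_ideal (below P y)) (qpoly_ring (below P y - {pbot (below P y)}))"
      using Q.ideal_face_ideal by (simp add: poly_of_poset_def)
    fix r assume "r \<in> face_relations P"
    then obtain a b where ab: "a \<in> P" "b \<in> P" "a \<noteq> pbot P" "b \<noteq> pbot P"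
      and r: "r = pvar P a * pvar P b
        - pvar P (pmeet P a b) * (\<Sum>z \<in> minimal_upper_bounds P a b. pvar P z)"
      by (auto simp: face_relations_def)
    show "psubst (interval_subst y) r \<in> face_ideal (below P y)"
    proof (cases "a \<le> y \<and> b \<le> y")
      case True
      have "pvar (below P y) a * pvar (below P y) b
        - pvar (below P y) (pmeet (below P y) a b)
          * (\<Sum>z \<in> minimal_upper_bounds (below P y) a b. pvar (below P y) z) \<in> face_relations (below P y)"
        by (intro face_relationsI) (use True ab pbot_below[OF y] in \<open>auto simp: below_def\<close>)
      then show ?thesis
        unfolding r psubst_interval_relation[OF y ab(1,2)] using True Q.face_relations_in_ideal by auto
    next
      case False
      then show ?thesis
        unfolding r psubst_interval_relation[OF y ab(1,2)] using False Q.zero_face_ideal by auto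
    qed
  qed
qed

lemma face_relations_below:
  assumes y: "y \<in> P" and r: "r \<in> face_relations (below P y)"
  obtains r' where "r' \<in> face_relations P" "r = psubst (interval_subst y) r'"
proof -
  obtain a b where ab: "a \<in> below P y" "b \<in> below P y" "a \<noteq> pbot P" "b \<noteq> pbot P"
    and r: "r = pvar (below P y) a * pvar (below P y) b
      - pvar (below P y) (pmeet (below P y) a b)
        * (\<Sum>z \<in> minimal_upper_bounds (below P y) a b. pvar (below P y) z)"
    using r by (auto simp: face_relations_def pbot_below[OF y])
  have "a \<in> P" "b \<in> P" "a \<le> y" "b \<le> y" using ab by (auto simp: below_def)
  then show thesis
    using ab psubst_interval_relation[OF y, of a b]
    by (intro that[of "pvar P a * pvar P b
      - pvar P (pmeet P a b) * (\<Sum>z \<in> minimal_upper_bounds P a b. pvar P z)"])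
      (auto simp: face_relations_def r)
qed

lemma face_ring_hom_eqI:
  assumes g: "g \<in> Ring.ring_hom (face_ring P) T" and h: "h \<in> Ring.ring_hom (face_ring P) T"
    and scal: "\<And>c. g (scal P c) = h (scal P c)"
    and gen: "\<And>v. v \<in> P - {pbot P} \<Longrightarrow> g (poset_elem P v) = h (poset_elem P v)"
    and a: "a \<in> carrier (face_ring P)"
  shows "g a = h a"
proof -
  have "g (face_class P p) = h (face_class P p)" if "p \<in> qpolys (P - {pbot P})" for p
    using that
  proof (induction rule: qpolys_induct)
    case (const c)
    then show ?case using scal by (simp add: scal_def)
  next
    case (var v)
    then show ?case using gen[of v] by (simp add: poset_elem_def pvar_eq split: if_splits)
  next
    case (add p q)
    then show ?case
      using Ring.ring_hom_add[OF g] Ring.ring_hom_add[OF h] by (simp add: face_class_add)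
  next
    case (mult p q)
    then show ?case
      using Ring.ring_hom_mult[OF g] Ring.ring_hom_mult[OF h] by (simp add: face_class_mult)
  qed
  then show ?thesis using a by (auto simp: carrier_face_ring)
qed

text \<open>This resolves the definite description in \<open>face_proj\<close>. Existence:
  \<open>h\<close> applies the substitution to a chosen representative, and another representative
  differs by an element of the ideal, which is mapped into the ideal of the interval. Uniqueness:
  homomorphisms agreeing on scalars and poset elements agree on the carrier, and extensionality
  settles the rest.\<close>

lemma face_proj_face_class:
  assumes y: "y \<in> P" and p: "p \<in> qpolys (P - {pbot P})"
  shows "face_proj P y (face_class P p) = face_class (below P y) (psubst (interval_subst y) p)"
proof -
  interpret Q: simplicial "below P y"
    using simplicial_below[OF y] by unfold_locales
  let ?V = "P - {pbot P}" and ?B = "face_ring (below P y)"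
  define rep where "rep a = (SOME p. p \<in> qpolys ?V \<and> face_class P p = a)" for a
  define h where "h = restrict (\<lambda>a. face_class (below P y) (psubst (interval_subst y) (rep a)))
    (carrier (face_ring P))"
  have h: "h (face_class P p) = face_class (below P y) (psubst (interval_subst y) p)"
    if p: "p \<in> qpolys ?V" for p
  proof -
    have "rep (face_class P p) \<in> qpolys ?V \<and> face_class P (rep (face_class P p)) = face_class P p"
      unfolding rep_def by (rule someI[of _ p]) (use p in simp)
    then have rep: "rep (face_class P p) \<in> qpolys ?V" "rep (face_class P p) - p \<in> face_ideal P"
      using p face_class_eq_iff by auto
    then show ?thesis
      using p psubst_interval_ideal[OF y rep(2)]
      by (simp add: h_def Q.face_class_eq_iff psubst_interval_mem[OF y] psubst_diff)
  qed
  have hom: "h \<in> Ring.ring_hom (face_ring P) ?B"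
  proof (rule Ring.ring_hom_memI)
    fix a assume "a \<in> carrier (face_ring P)"
    then show "h a \<in> carrier ?B"
      by (auto simp: carrier_face_ring h psubst_interval_mem[OF y])
  next
    fix a b assume "a \<in> carrier (face_ring P)" "b \<in> carrier (face_ring P)"
    then obtain p q where pq: "p \<in> qpolys ?V" "q \<in> qpolys ?V" "a = face_class P p" "b = face_class P q"
      by (auto simp: carrier_face_ring)
    then show "h (a \<otimes>\<^bsub>face_ring P\<^esub> b) = h a \<otimes>\<^bsub>?B\<^esub> h b"
      by (simp add: h psubst_mult psubst_interval_mem[OF y] qpolys_mult Q.face_class_mult
          flip: face_class_mult)
    from pq show "h (a \<oplus>\<^bsub>face_ring P\<^esub> b) = h a \<oplus>\<^bsub>?B\<^esub> h b"
      by (simp add: h psubst_add psubst_interval_mem[OF y] qpolys_add Q.face_class_add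
          flip: face_class_add)
  next
    show "h \<one>\<^bsub>face_ring P\<^esub> = \<one>\<^bsub>?B\<^esub>"
      using h[of 1] by (simp add: face_class_one Q.face_class_one)
  qed
  have gen: "h (poset_elem P v) = (if v \<le> y then poset_elem (below P y) v else \<zero>\<^bsub>?B\<^esub>)"
    if "v \<in> P - {pbot P}" for v
    using that h[of "pvar P v"]
    by (simp add: poset_elem_def pvar_mem psubst_interval_pvar[OF y] Q.face_class_zero)
  have scal: "h (scal P c) = scal (below P y) c" for c
    using h[of "pconst c"] by (simp add: scal_def)
  have "face_proj P y = h"
    unfolding face_proj_def
  proof (rule the_equality)
    show "h \<in> extensional (carrier (face_ring P)) \<and> h \<in> Ring.ring_hom (face_ring P) ?B \<and>
      (\<forall>c. h (scal P c) = scal (below P y) c) \<and>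
      (\<forall>v\<in>P - {pbot P}. h (poset_elem P v) = (if v \<le> y then poset_elem (below P y) v else \<zero>\<^bsub>?B\<^esub>))"
      using hom gen scal by (auto simp: h_def)
    fix g assume g: "g \<in> extensional (carrier (face_ring P)) \<and> g \<in> Ring.ring_hom (face_ring P) ?B \<and>
      (\<forall>c. g (scal P c) = scal (below P y) c) \<and>
      (\<forall>v\<in>P - {pbot P}. g (poset_elem P v) = (if v \<le> y then poset_elem (below P y) v else \<zero>\<^bsub>?B\<^esub>))"
    show "g = h"
    proof (rule extensionalityI[of _ "carrier (face_ring P)"])
      fix a assume "a \<in> carrier (face_ring P)"
      then show "g a = h a"
        by (rule face_ring_hom_eqI[rotated -1]) (use g hom gen scal in auto)
    qed (use g in \<open>auto simp: h_def\<close>)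
  qed
  then show ?thesis using h[OF p] by simp
qed

end

context labelled
begin

lemma face_subst_interval_subst: "psubst (face_subst n x y f) (psubst (interval_subst y) p)
    = psubst (face_subst n x y f) p"
proof -
  have "(\<lambda>v. psubst (face_subst n x y f) (interval_subst y v)) = face_subst n x y f"
    by (auto simp: interval_subst_def face_subst_def)
  then show ?thesis by (simp add: psubst_psubst)
qed

lemma face_subst_relations_below:
  assumes y: "y \<in> P" and r: "r \<in> face_relations (below P y)"
  shows "psubst (face_subst n x y f) r = 0"
  using face_relations_below[OF y r] face_subst_relations[OF y] face_subst_interval_subst by metis

text \<open>If \<open>u\<close> arises from \<open>v\<close> by omitting the atom \<open>i\<close>,
  then \<open>x i\<close> and \<open>u\<close> have meet the bottom and \<open>v\<close> as their
  only minimal upper bound in the interval, so their face relation reads x_i u = v. Induction on the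
  number of atoms splits off all of them. It follows that the face ring of an interval is generated
  by atoms.\<close>

lemma pvar_product_below:
  assumes y: "y \<in> P" and v: "v \<in> below P y"
  shows "pvar (below P y) v - (\<Prod>i\<in>atoms_below n x v. pX (x i)) \<in> face_ideal (below P y)"
proof -
  interpret Q: simplicial "below P y"
    using simplicial_below[OF y] by unfold_locales
  interpret I: ideal "face_ideal (below P y)" "poly_of_poset (below P y)"
    by (rule Q.ideal_face_ideal)
  let ?V = "below P y - {pbot (below P y)}"
  have sub: "v \<in> below P y \<Longrightarrow> atoms_below n x v \<subseteq> {1..n}" for v
    by (rule atoms_below_subset)
  have xV: "x i \<in> ?V" if "v \<in> below P y" "i \<in> atoms_below n x v" for v i
    unfolding pbot_below[OF y] using that label_mem[of i] by (auto simp: atoms_below_def below_def)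
  have "\<forall>v\<in>below P y. card (atoms_below n x v) = k \<longrightarrow>
      pvar (below P y) v - (\<Prod>i\<in>atoms_below n x v. pX (x i)) \<in> face_ideal (below P y)" for k
  proof (induction k)
    case 0
    show ?case
    proof (intro ballI impI)
      fix v assume v: "v \<in> below P y" "card (atoms_below n x v) = 0"
      then have "v = pbot P" by (simp add: below_def atoms_below_eq_empty)
      then show "pvar (below P y) v - (\<Prod>i\<in>atoms_below n x v. pX (x i)) \<in> face_ideal (below P y)"
        using Q.zero_face_ideal by (simp add: Q.pvar_eq pbot_below[OF y] atoms_below_pbot)
    qed
  next
    case (Suc k)
    show ?case
    proof (intro ballI impI)
      fix v assume v: "v \<in> below P y" and card: "card (atoms_below n x v) = Suc k"
      then obtain i where i: "i \<in> atoms_below n x v" by (metis card.empty ex_in_conv nat.distinct(1))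
      have vP: "v \<in> P" "v \<le> y" using v by (auto simp: below_def)
      obtain u where u: "u \<in> below P v" "atoms_below n x u = atoms_below n x v - {i}"
        using atoms_below_ex[OF vP(1), of "atoms_below n x v - {i}"] by blast
      have i_n: "i \<in> {1..n}" using i by (simp add: atoms_below_def)
      have uy: "u \<in> below P y" using u(1) vP(2) by (auto simp: below_def)
      have xy: "x i \<in> below P y" using xV[OF v i] by simp
      have IH: "pvar (below P y) u - (\<Prod>i\<in>atoms_below n x u. pX (x i)) \<in> face_ideal (below P y)"
        using Suc.IH uy u(2) card i by auto
      have mem: "(\<Prod>i\<in>atoms_below n x u. pX (x i)) \<in> qpolys ?V"
        by (intro qpolys_prod qpolys_pX xV[OF uy])
      have step: "pvar (below P y) v - pX (x i) * pvar (below P y) u \<in> face_ideal (below P y)"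
      \<comment> \<open>Face relations exist only for elements other than the bottom, so the case of
        a single atom is separate: there \<open>v = x i\<close> and the difference is 0.\<close>
      proof (cases "u = pbot P")
        case True
        then have "atoms_below n x v = {i}" using u(2) i atoms_below_pbot by auto
        then have "v = x i"
          using atoms_below_inj[OF y v xy] atoms_below_label[OF i_n] by simp
        then show ?thesis
          using Q.zero_face_ideal True xV[OF v i] by (simp add: Q.pvar_eq pbot_below[OF y])
      next
        case False
        obtain j where j: "j \<in> below P y" "atom_set P j = atom_set P (x i) \<union> atom_set P u"
          "{z \<in> minimal_upper_bounds P (x i) u. z \<le> y} = {j}"
          using pjoin_below[OF y xy uy] by metis
        have "atom_set P j = atom_set P v"
          using j(2) u(2) i by (auto simp: atom_set_label atoms_below_label[OF i_n])
        then have "j = v" using atom_set_inj[OF y j(1) v] by simp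
        then have mub: "minimal_upper_bounds (below P y) (x i) u = {v}"
          using j(3) by (simp add: minimal_upper_bounds_below)
        have "atom_set P (pmeet P (x i) u) = x ` {i} \<inter> x ` (atoms_below n x v - {i})"
          using pmeet_below(2)[OF y xy uy] by (simp add: atom_set_label u(2) atoms_below_label[OF i_n])
        also have "\<dots> = x ` ({i} \<inter> (atoms_below n x v - {i}))"
          by (rule inj_on_image_Int[OF inj_label, symmetric]) (use i_n sub[OF v] in auto)
        finally have "pmeet P (x i) u = pbot P"
          using pmeet_below(1)[OF y xy uy] atom_set_eq_empty[of "pmeet P (x i) u"] by (auto simp: below_def)
        then have meet: "pmeet (below P y) (x i) u = pbot (below P y)"
          using pmeet_below_eq[of "x i" y u] xy by (simp add: pbot_below[OF y]) (simp add: below_def)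
        have "pvar (below P y) (x i) * pvar (below P y) u - pvar (below P y) (pmeet (below P y) (x i) u)
          * (\<Sum>z \<in> minimal_upper_bounds (below P y) (x i) u. pvar (below P y) z)
          \<in> face_relations (below P y)"
          using uy xV[OF v i] False pbot_below[OF y] by (intro face_relationsI) auto
        then have "pX (x i) * pvar (below P y) u - pvar (below P y) v \<in> face_ideal (below P y)"
          using Q.face_relations_in_ideal xV[OF v i] unfolding mub meet by (auto simp: Q.pvar_eq)
        then have "face_class (below P y) (pX (x i) * pvar (below P y) u)
            = face_class (below P y) (pvar (below P y) v)"
          using xV[OF v i] uy v by (subst Q.face_class_eq_iff) (auto intro: qpolys_mult Q.pvar_mem)
        then show ?thesis
          using xV[OF v i] uy v by (subst (asm) eq_commute, subst (asm) Q.face_class_eq_iff)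
            (auto intro: qpolys_mult Q.pvar_mem)
      qed
      have "pX (x i) * (pvar (below P y) u - (\<Prod>i\<in>atoms_below n x u. pX (x i))) \<in> face_ideal (below P y)"
        using I.I_l_closed[OF IH, of "pX (x i)"] xV[OF v i] by (simp add: poly_of_poset_def)
      then have "(pvar (below P y) v - pX (x i) * pvar (below P y) u)
          + pX (x i) * (pvar (below P y) u - (\<Prod>i\<in>atoms_below n x u. pX (x i))) \<in> face_ideal (below P y)"
        using additive_subgroup.a_closed[OF ideal.axioms(1)[OF Q.ideal_face_ideal] step] by (simp add: poly_of_poset_def)
      also have "(pvar (below P y) v - pX (x i) * pvar (below P y) u)
          + pX (x i) * (pvar (below P y) u - (\<Prod>i\<in>atoms_below n x u. pX (x i)))
        = pvar (below P y) v - (\<Prod>i\<in>atoms_below n x v. pX (x i))"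
        using prod.remove[OF finite_atoms_below i, of "\<lambda>i. pX (x i)"] u(2)
        by (simp add: algebra_simps)
      finally show "pvar (below P y) v - (\<Prod>i\<in>atoms_below n x v. pX (x i)) \<in> face_ideal (below P y)" .
    qed
  qed
  then show ?thesis using v by blast
qed

end

section \<open>Minors of the coefficient matrix\<close>

text \<open>Matrix rows start at 0 and parameters at 1, hence \<open>Suc r\<close>. For a list of
  the d atoms of a facet this is a maximal minor of \<open>C\<close>, with columns in the order of
  the list.\<close>

definition column_mat :: "(nat \<Rightarrow> nat \<Rightarrow> rat) \<Rightarrow> nat list \<Rightarrow> rat mat" where
  "column_mat C w = mat (length w) (length w) (\<lambda>(r, c). C (Suc r) (w ! c))"

lemma column_mat_carrier: "column_mat C w \<in> carrier_mat (length w) (length w)"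
  by (simp add: column_mat_def)

lemma det_column_swap:
  "det (column_mat C (u @ a # b # v)) = - det (column_mat C (u @ b # a # v))"
proof -
  let ?n = "length u" and ?w = "u @ b # a # v"
  have nth: "(u @ a # b # v) ! c = (if ?n = c then ?w ! Suc ?n else if Suc ?n = c then ?w ! ?n else ?w ! c)" for c
  proof -
    consider "c < ?n" | "c = ?n" | "c = Suc ?n" | k where "c = Suc (Suc (?n + k))"
      by (metis add_Suc_right less_imp_Suc_add linorder_neqE_nat not_less_eq)
    then show ?thesis by cases (simp_all add: nth_append)
  qed
  have "column_mat C (u @ a # b # v) = swapcols ?n (Suc ?n) (column_mat C ?w)"
    by (rule eq_matI) (simp_all add: column_mat_def nth)
  then show ?thesis
    using det_swapcols[of ?n "length ?w" "Suc ?n", OF _ _ _ column_mat_carrier] by simp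
qed

text \<open>The column \<open>a\<close> moves right past each smaller entry of \<open>Z\<close>, one
  sign per transposition. The prefix \<open>u\<close> receives the columns already passed, which
  makes the induction possible.\<close>

lemma det_column_insort:
  assumes "sorted Z" "distinct (a # Z)"
  shows "det (column_mat C (u @ a # Z))
    = (- 1) ^ card {z \<in> set Z. z < a} * det (column_mat C (u @ insort a Z))"
  using assms
proof (induction Z arbitrary: u)
  case (Cons z Z)
  show ?case
  proof (cases "a \<le> z")
    case True
    then have "{y \<in> set (z # Z). y < a} = {}" using Cons.prems by auto
    then have "card {y \<in> set (z # Z). y < a} = 0" by (simp only: card.empty)
    then show ?thesis using True by (simp only: insort_key.simps if_True power_0 mult_1)
  next
    case False
    then have "{y \<in> set (z # Z). y < a} = insert z {y \<in> set Z. y < a}" by auto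
    moreover have "z \<notin> set Z" using Cons.prems by simp
    ultimately have card: "card {y \<in> set (z # Z). y < a} = Suc (card {y \<in> set Z. y < a})" by simp
    have "det (column_mat C (u @ z # a # Z))
        = (- 1) ^ card {y \<in> set Z. y < a} * det (column_mat C (u @ z # insort a Z))"
      using Cons.IH[of "u @ [z]"] Cons.prems by simp
    then show ?thesis
      unfolding card det_column_swap[of C u a z Z] using False by simp
  qed
qed simp

text \<open>Inversions involving position 0 correspond to the entries of \<open>w\<close> smaller
  than \<open>a\<close>; the remaining ones are those of \<open>w\<close>, shifted by one.\<close>

lemma list_sign_Cons:
  assumes "distinct w"
  shows "list_sign (a # w) = (- 1) ^ card {z \<in> set w. z < a} * list_sign w"
proof -
  let ?I = "\<lambda>w :: nat list. {(i, j). i < j \<and> j < length w \<and> w ! j < w ! i}"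
  let ?J = "{j. j < length w \<and> w ! j < a}"
  have fin: "finite (?I w)"
    by (rule finite_subset[of _ "{..<length w} \<times> {..<length w}"]) auto
  have I: "?I (a # w) = (\<lambda>j. (0, Suc j)) ` ?J \<union> (\<lambda>(i, j). (Suc i, Suc j)) ` ?I w"
  proof (intro equalityI subsetI)
    fix p assume "p \<in> ?I (a # w)"
    then obtain i j where p: "p = (i, j)" "i < j" "j < length (a # w)" "(a # w) ! j < (a # w) ! i"
      by auto
    then obtain j' where j: "j = Suc j'" by (cases j) auto
    show "p \<in> (\<lambda>j. (0, Suc j)) ` ?J \<union> (\<lambda>(i, j). (Suc i, Suc j)) ` ?I w"
    proof (cases i)
      case 0
      then show ?thesis using p j by auto
    next
      case (Suc i')
      then have "(i', j') \<in> ?I w" using p j by auto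
      then show ?thesis using p j Suc by (auto intro: rev_image_eqI)
    qed
  qed auto
  have "card (?I (a # w)) = card ((\<lambda>j. (0::nat, Suc j)) ` ?J) + card ((\<lambda>(i, j). (Suc i, Suc j)) ` ?I w)"
    unfolding I using fin by (intro card_Un_disjoint) auto
  also have "card ((\<lambda>j. (0::nat, Suc j)) ` ?J) = card ?J"
    by (intro card_image inj_onI) auto
  also have "card ((\<lambda>(i, j). (Suc i, Suc j)) ` ?I w) = card (?I w)"
    by (intro card_image inj_onI) auto
  also have "card ?J = card ((!) w ` ?J)"
    using assms by (intro card_image[symmetric] inj_onI) (auto simp: nth_eq_iff_index_eq)
  also have "(!) w ` ?J = {z \<in> set w. z < a}"
    by (auto simp: in_set_conv_nth)
  finally show ?thesis by (simp add: list_sign_def power_add)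
qed

text \<open>The link between multiplicities and chains: the sign that orients a cell is the sign by
  which the minor differs from its sorted form.\<close>

lemma det_column_sort:
  "distinct w \<Longrightarrow>
    det (column_mat C (u @ w)) = of_int (list_sign w) * det (column_mat C (u @ sort w))"
proof (induction w arbitrary: u)
  case Nil
  then show ?case by (simp add: list_sign_def)
next
  case (Cons a w)
  have "det (column_mat C (u @ a # w)) = of_int (list_sign w) * det (column_mat C (u @ a # sort w))"
    using Cons.IH[of "u @ [a]"] Cons.prems by simp
  also have "\<dots> = of_int (list_sign (a # w)) * det (column_mat C (u @ insort a (sort w)))"
    using det_column_insort[of "sort w" a C u] Cons.prems by (simp add: list_sign_Cons)
  finally show ?case by (simp add: sort_key_def)
qed

text \<open>The rows of \<open>B\<close> are indexed by atoms and its columns by 1, ..., d, so that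
  the inverse no longer refers to positions in \<open>w\<close>. In its definition
  \<open>the_inv_into\<close> finds the position of an atom and \<open>k - 1\<close> undoes the
  shift of \<open>column_mat\<close>.\<close>

lemma column_mat_inverse:
  assumes w: "distinct w" "length w = d" and det: "det (column_mat C w) \<noteq> 0"
  obtains B where
    "\<And>i j. i \<in> set w \<Longrightarrow> j \<in> set w \<Longrightarrow> (\<Sum>k\<in>{1..d}. B i k * C k j) = (if i = j then 1 else 0)"
    "\<And>k l. k \<in> {1..d} \<Longrightarrow> l \<in> {1..d} \<Longrightarrow> (\<Sum>i\<in>set w. C k i * B i l) = (if k = l then 1 else 0)"
proof -
  have M: "column_mat C w \<in> carrier_mat d d" using column_mat_carrier w by metis
  obtain N where N: "N \<in> carrier_mat d d" "N * column_mat C w = 1\<^sub>m d" "column_mat C w * N = 1\<^sub>m d"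
    using det_non_zero_imp_unit[OF M det, of "()"] by (auto simp: Units_def ring_mat_simps)
  define B where "B i k = N $$ (the_inv_into {..<d} ((!) w) i, k - 1)" for i k
  have bij: "bij_betw ((!) w) {..<d} (set w)"
    using bij_betw_nth[OF w(1), of "{..<d}" "set w"] w(2) by simp
  have B: "B (w ! c) (Suc k) = N $$ (c, k)" if "c < d" for c k
    using that bij the_inv_into_f_f[of "(!) w" "{..<d}" c] by (simp add: B_def bij_betw_def)
  have entry: "(\<Sum>k<d. X $$ (r, k) * Y $$ (k, c)) = (if r = c then 1 else 0)"
    if "X \<in> carrier_mat d d" "Y \<in> carrier_mat d d" "X * Y = 1\<^sub>m d" "r < d" "c < d" for X Y :: "rat mat" and r c
  proof -
    have "(X * Y) $$ (r, c) = (\<Sum>k<d. X $$ (r, k) * Y $$ (k, c))"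
      using that(1,2,4,5) by (simp add: scalar_prod_def atLeast0LessThan)
    then show ?thesis using that by simp
  qed
  have 1: "(\<Sum>k\<in>{1..d}. B i k * C k j) = (if i = j then 1 else 0)" if "i \<in> set w" "j \<in> set w" for i j
  proof -
    have "\<exists>r<length w. w ! r = i" "\<exists>c<length w. w ! c = j"
      using that by (simp_all add: in_set_conv_nth)
    then obtain r c where r: "r < d" "i = w ! r" and c: "c < d" "j = w ! c"
      unfolding w(2) by blast
    note rc = r c
    have "(\<Sum>k\<in>{1..d}. B i k * C k j) = (\<Sum>k<d. N $$ (r, k) * column_mat C w $$ (k, c))"
      unfolding One_nat_def sum.atLeast1_atMost_eq using rc w(2)
      by (intro sum.cong) (simp_all add: B column_mat_def)
    also have "\<dots> = (if r = c then 1 else 0)" by (rule entry[OF N(1) M N(2) r(1) c(1)])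
    finally show ?thesis using rc w by (simp add: nth_eq_iff_index_eq)
  qed
  have 2: "(\<Sum>i\<in>set w. C k i * B i l) = (if k = l then 1 else 0)" if "k \<in> {1..d}" "l \<in> {1..d}" for k l
  proof -
    define k' l' where "k' = k - 1" and "l' = l - 1"
    then have kl: "k = Suc k'" "k' < d" "l = Suc l'" "l' < d"
      using that by auto
    have "(\<Sum>i\<in>set w. C k i * B i l) = (\<Sum>c<d. C k (w ! c) * B (w ! c) l)"
      by (rule sum.reindex_bij_betw[OF bij, symmetric])
    also have "\<dots> = (\<Sum>c<d. column_mat C w $$ (k', c) * N $$ (c, l'))"
      using kl w(2) by (intro sum.cong) (simp_all add: B column_mat_def)
    also have "\<dots> = (if k' = l' then 1 else 0)" by (rule entry[OF M N(1,3) kl(2,4)])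
    finally show ?thesis using kl by simp
  qed
  show thesis using 1 2 by (rule that)
qed

lemma column_mat_kernel:
  assumes w: "distinct w" "length w = d" and det: "det (column_mat C w) = 0"
  obtains v i where "i \<in> set w" "v i \<noteq> 0" "\<And>k. k \<in> {1..d} \<Longrightarrow> (\<Sum>i\<in>set w. C k i * v i) = 0"
proof -
  have M: "column_mat C w \<in> carrier_mat d d" using column_mat_carrier w by metis
  obtain u where u: "u \<in> carrier_vec d" "u \<noteq> 0\<^sub>v d" "column_mat C w *\<^sub>v u = 0\<^sub>v d"
    using det det_0_iff_vec_prod_zero_field[OF M] by auto
  obtain c where c: "c < d" "u $ c \<noteq> 0"
    using u(1,2) by (metis carrier_vecD dim_vec eq_vecI index_zero_vec)
  define v where "v i = u $ (the_inv_into {..<d} ((!) w) i)" for i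
  have bij: "bij_betw ((!) w) {..<d} (set w)"
    using bij_betw_nth[OF w(1), of "{..<d}" "set w"] w(2) by simp
  have v: "v (w ! c) = u $ c" if "c < d" for c
    using that bij the_inv_into_f_f[of "(!) w" "{..<d}" c] by (simp add: v_def bij_betw_def)
  have "(\<Sum>i\<in>set w. C k i * v i) = 0" if k: "k \<in> {1..d}" for k
  proof -
    define k' where "k' = k - 1"
    then have k': "k = Suc k'" "k' < d" using k by auto
    have "(\<Sum>i\<in>set w. C k i * v i) = (\<Sum>c<d. C k (w ! c) * v (w ! c))"
      by (rule sum.reindex_bij_betw[OF bij, symmetric])
    also have "\<dots> = (column_mat C w *\<^sub>v u) $ k'"
      using k' w(2) u(1) by (simp add: column_mat_def scalar_prod_def atLeast0LessThan v)
    finally show ?thesis using u(3) k' by simp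
  qed
  then show thesis using that[of "w ! c" v] c w v by simp
qed

text \<open>Cramer's rule. Multiplying the changed matrix by the inverse of the original one gives
  \<open>U\<close>, which differs from the identity in its first column only. It is lower triangular
  with diagonal (B_i . C_i', 1, ..., 1).\<close>

lemma det_column_replace:
  assumes w: "distinct (i # Z)" "length (i # Z) = d"
    and B1: "\<And>a b. a \<in> set (i # Z) \<Longrightarrow> b \<in> set (i # Z) \<Longrightarrow>
      (\<Sum>k\<in>{1..d}. B a k * C k b) = (if a = b then 1 else 0)"
    and B2: "\<And>k l. k \<in> {1..d} \<Longrightarrow> l \<in> {1..d} \<Longrightarrow>
      (\<Sum>a\<in>set (i # Z). C k a * B a l) = (if k = l then 1 else 0)"
  shows "det (column_mat C (i' # Z)) = (\<Sum>k\<in>{1..d}. B i k * C k i') * det (column_mat C (i # Z))"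
proof -
  let ?w = "i # Z" and ?w' = "i' # Z"
  define U where "U = mat d d (\<lambda>(r, s). \<Sum>l\<in>{1..d}. B (?w ! r) l * C l (?w' ! s))"
  have M: "column_mat C ?w \<in> carrier_mat d d" using column_mat_carrier[of C ?w] w by simp
  have U: "U \<in> carrier_mat d d" by (simp add: U_def)
  have bij: "bij_betw ((!) ?w) {..<d} (set ?w)"
    using bij_betw_nth[OF w(1), of "{..<d}" "set ?w"] w(2) by simp
  have "column_mat C ?w' = column_mat C ?w * U"
  proof (rule eq_matI)
    fix r s assume "r < dim_row (column_mat C ?w * U)" "s < dim_col (column_mat C ?w * U)"
    then have rs: "r < d" "s < d" using M U by auto
    have "(column_mat C ?w * U) $$ (r, s)
        = (\<Sum>c<d. C (Suc r) (?w ! c) * (\<Sum>l\<in>{1..d}. B (?w ! c) l * C l (?w' ! s)))"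
      using rs w(2) M U by (simp add: scalar_prod_def atLeast0LessThan column_mat_def U_def)
    also have "\<dots> = (\<Sum>a\<in>set ?w. C (Suc r) a * (\<Sum>l\<in>{1..d}. B a l * C l (?w' ! s)))"
      by (rule sum.reindex_bij_betw[OF bij])
    also have "\<dots> = (\<Sum>a\<in>set ?w. \<Sum>l\<in>{1..d}. C (Suc r) a * B a l * C l (?w' ! s))"
      by (simp add: sum_distrib_left mult.assoc)
    also have "\<dots> = (\<Sum>l\<in>{1..d}. (\<Sum>a\<in>set ?w. C (Suc r) a * B a l) * C l (?w' ! s))"
      by (subst sum.swap) (simp only: sum_distrib_right)
    also have "\<dots> = (\<Sum>l\<in>{1..d}. (if Suc r = l then C l (?w' ! s) else 0))"
      using rs by (intro sum.cong refl) (subst B2, auto)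
    also have "\<dots> = C (Suc r) (?w' ! s)" using rs by (simp add: sum.delta')
    finally show "column_mat C ?w' $$ (r, s) = (column_mat C ?w * U) $$ (r, s)"
      using rs w(2) by (simp add: column_mat_def)
  qed (use w(2) U in \<open>auto simp: column_mat_def\<close>)
  then have "det (column_mat C ?w') = det U * det (column_mat C ?w)"
    using det_mult[OF M U] by simp
  also have "det U = prod_list (diag_mat U)"
  proof (rule det_lower_triangular[OF _ U])
    fix r s :: nat assume rs: "r < s" "s < d"
    then obtain s' where s': "s = Suc s'" by (cases s) auto
    have "U $$ (r, s) = (\<Sum>l\<in>{1..d}. B (?w ! r) l * C l (?w ! s))"
      using rs s' by (simp add: U_def)
    also have "\<dots> = (if ?w ! r = ?w ! s then 1 else 0)"
      using rs w(2) by (intro B1 nth_mem) auto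
    finally show "U $$ (r, s) = 0"
      using rs w by (subst (asm) nth_eq_iff_index_eq) auto
  qed
  also have "\<dots> = (\<Prod>r<d. U $$ (r, r))"
    using U by (simp add: diag_mat_def prod.list_conv_set_nth atLeast0LessThan)
  also have "\<dots> = (\<Prod>r<d. if r = 0 then (\<Sum>k\<in>{1..d}. B i k * C k i') else 1)"
  proof (rule prod.cong)
    fix r assume r: "r \<in> {..<d}"
    show "U $$ (r, r) = (if r = 0 then (\<Sum>k\<in>{1..d}. B i k * C k i') else 1)"
    proof (cases r)
      case (Suc r')
      have "U $$ (r, r) = (\<Sum>l\<in>{1..d}. B (?w ! r) l * C l (?w ! r))"
        using r Suc by (simp add: U_def)
      also have "\<dots> = 1" using r w(2) B1[of "?w ! r" "?w ! r"] nth_mem[of r ?w] by auto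
      finally show ?thesis using Suc by simp
    qed (use r in \<open>simp add: U_def\<close>)
  qed simp
  also have "\<dots> = (\<Sum>k\<in>{1..d}. B i k * C k i')"
    using w(2) by (simp add: prod.delta)
  finally show ?thesis .
qed

section \<open>Restriction to facets\<close>

definition linear_form :: "nat \<Rightarrow> (nat \<Rightarrow> rat) \<Rightarrow> nat qpoly" where
  "linear_form d b = (\<Sum>k\<in>{1..d}. pconst (b k) * pX k)"

lemma pconst_mult_pX: "pconst c * pX v = Poly_Mapping.single (Poly_Mapping.single v 1) c"
  by (simp add: pX_def mult_single)

lemma keys_pconst_mult: "Poly_Mapping.keys (pconst c * p) \<subseteq> Poly_Mapping.keys p"
  using keys_mult[of "pconst c" p] by (auto split: if_splits)

lemma pX_nonzero: "pX v \<noteq> 0"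
  using lookup_single_eq[of "Poly_Mapping.single v (1::nat)" "1::rat"] lookup_zero unfolding pX_def
  by (metis zero_neq_one)

lemma psubst_zero_fun: "\<exists>c. psubst (\<lambda>_. 0) p = pconst c"
proof -
  have "p \<in> qpolys UNIV" by (simp add: qpolys_UNIV)
  then show ?thesis
  proof (induction rule: qpolys_induct)
    case (var v)
    then show ?case by (intro exI[of _ 0]) simp
  next
    case (add p q)
    then show ?case by (metis psubst_add pconst_add)
  next
    case (mult p q)
    then show ?case by (metis psubst_mult pconst_mult)
  qed auto
qed

text \<open>\<open>C\<close> is the coefficient matrix of the parameters; it is available because
  degree one is spanned by the atoms (\<open>graded_piece_1_linear\<close>). Finiteness of the
  module enters through \<open>det_nonzero\<close>.\<close>

locale lsop = labelled P n x for P :: "'a::order set" and n :: nat and x :: "nat \<Rightarrow> 'a" +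
  fixes d :: nat and \<theta> :: "nat \<Rightarrow> 'a qpoly set" and C :: "nat \<Rightarrow> nat \<Rightarrow> rat"
  assumes rank: "poset_rank P = d"
    and theta: "\<And>k. k \<in> {1..d} \<Longrightarrow>
      \<theta> k = face_class P (\<Sum>i\<in>{1..n}. pconst (C k i) * pX (x i))"
    and finite_module: "finite_module_over (face_ring P) (carrier (param_ring P \<theta>))"
begin

text \<open>All natural numbers are variables of \<open>nat qpoly\<close>; those outside
  \<open>{1..d}\<close> are sent to 0. This makes \<open>param_eval\<close> defined on the whole
  type, at the price of a kernel, which \<open>param_eval_cutoff\<close> controls.\<close>

definition param_lift :: "nat \<Rightarrow> 'a qpoly" where
  "param_lift k = (if k \<in> {1..d} then \<Sum>i\<in>{1..n}. pconst (C k i) * pX (x i) else 0)"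

definition param_eval :: "nat qpoly \<Rightarrow> 'a qpoly set" where
  "param_eval r = face_class P (psubst param_lift r)"

lemma param_lift_mem: "param_lift k \<in> qpolys (P - {pbot P})"
  using label_mem by (auto simp: param_lift_def intro!: qpolys_sum qpolys_mult)

lemma psubst_param_lift_mem: "psubst param_lift r \<in> qpolys (P - {pbot P})"
  using psubst_in_qpolys[of r UNIV param_lift] param_lift_mem by (simp add: qpolys_UNIV)

lemma param_eval_mem: "param_eval r \<in> carrier (face_ring P)"
  by (simp add: param_eval_def psubst_param_lift_mem)

lemma param_eval_add: "param_eval (r + s) = param_eval r \<oplus>\<^bsub>face_ring P\<^esub> param_eval s"
  by (simp add: param_eval_def psubst_add psubst_param_lift_mem face_class_add)

lemma param_eval_mult: "param_eval (r * s) = param_eval r \<otimes>\<^bsub>face_ring P\<^esub> param_eval s"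
  by (simp add: param_eval_def psubst_mult psubst_param_lift_mem face_class_mult)

lemma param_eval_uminus: "param_eval (- r) = \<ominus>\<^bsub>face_ring P\<^esub> param_eval r"
  by (simp add: param_eval_def psubst_uminus psubst_param_lift_mem face_class_uminus)

lemma param_eval_pconst: "param_eval (pconst c) = scal P c"
  by (simp add: param_eval_def scal_def)

lemma param_eval_zero: "param_eval 0 = \<zero>\<^bsub>face_ring P\<^esub>"
  by (simp add: param_eval_def face_class_zero)

lemma param_eval_one: "param_eval 1 = \<one>\<^bsub>face_ring P\<^esub>"
  by (simp add: param_eval_def face_class_one)

lemma param_eval_pX: "param_eval (pX k) = (if k \<in> {1..d} then \<theta> k else \<zero>\<^bsub>face_ring P\<^esub>)"
  by (simp add: param_eval_def param_lift_def theta face_class_zero)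

lemma param_eval_prod:
  "finite A \<Longrightarrow> param_eval (prod f A) = (\<Otimes>\<^bsub>face_ring P\<^esub>i\<in>A. param_eval (f i))"
  unfolding param_eval_def psubst_prod by (rule face_class_prod) (simp_all add: psubst_param_lift_mem)

lemma carrier_param_ring: "carrier (param_ring P \<theta>) = range param_eval"
proof -
  let ?H = "range (scal P) \<union> \<theta> ` {1..d}"
  interpret ring "face_ring P" by (rule ring_face_ring)
  have H: "?H \<subseteq> range param_eval"
  proof
    fix a assume "a \<in> ?H"
    then consider c where "a = scal P c" | k where "k \<in> {1..d}" "a = \<theta> k" by blast
    then show "a \<in> range param_eval"
    proof cases
      case 1
      then show ?thesis using param_eval_pconst by (metis rangeI)
    next
      case 2
      then show ?thesis using param_eval_pX by (metis rangeI)
    qed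
  qed
  have "generate_ring (face_ring P) ?H = range param_eval"
  proof (intro equalityI subsetI)
    fix a assume "a \<in> generate_ring (face_ring P) ?H"
    then show "a \<in> range param_eval"
    proof (induction rule: generate_ring.induct)
      case one
      then show ?case using param_eval_one by (metis rangeI)
    next
      case (incl h)
      then show ?case using H by blast
    next
      case (a_inv h)
      then obtain r where "h = param_eval r" by blast
      then show ?case by (simp flip: param_eval_uminus)
    next
      case (eng_add h1 h2)
      then obtain r s where "h1 = param_eval r" "h2 = param_eval s" by blast
      then show ?case by (simp flip: param_eval_add)
    next
      case (eng_mult h1 h2)
      then obtain r s where "h1 = param_eval r" "h2 = param_eval s" by blast
      then show ?case by (simp flip: param_eval_mult)
    qed
  next
    fix a assume "a \<in> range param_eval"
    then obtain r where r: "a = param_eval r" by blast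
    have "r \<in> qpolys UNIV" by (simp add: qpolys_UNIV)
    then have "param_eval r \<in> generate_ring (face_ring P) ?H"
    proof (induction rule: qpolys_induct)
      case (const c)
      then show ?case by (intro generate_ring.incl) (simp add: param_eval_pconst)
    next
      case (var k)
      then show ?case
        by (auto simp: param_eval_pX zero_in_generate intro!: generate_ring.incl)
    next
      case (add p q)
      then show ?case by (simp add: param_eval_add generate_ring.eng_add)
    next
      case (mult p q)
      then show ?case by (simp add: param_eval_mult generate_ring.eng_mult)
    qed
    then show "a \<in> generate_ring (face_ring P) ?H" by (simp add: r)
  qed
  then show ?thesis by (simp add: param_ring_def rank)
qed

section \<open>Finiteness over the parameters makes the minors nonzero\<close>

lemma psubst_param_lift:
  assumes "\<And>i. i \<in> {1..n} \<Longrightarrow> \<not> x i \<le> y \<Longrightarrow> h (x i) = 0" and k: "k \<in> {1..d}"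
  shows "psubst h (param_lift k) = (\<Sum>i\<in>atoms_below n x y. pconst (C k i) * h (x i))"
proof -
  have "psubst h (param_lift k) = (\<Sum>i\<in>{1..n}. pconst (C k i) * h (x i))"
    using k by (simp add: param_lift_def psubst_simps)
  also have "\<dots> = (\<Sum>i\<in>atoms_below n x y. pconst (C k i) * h (x i))"
    using assms(1) by (intro sum.mono_neutral_right) (auto simp: atoms_below_def)
  finally show ?thesis .
qed

lemma face_subst_label: "i \<in> {1..n} \<Longrightarrow> face_subst n x y f (x i) = (if x i \<le> y then f i else 0)"
  by (simp add: face_subst_def atoms_below_label)

lemma length_atoms_list:
  "y \<in> P \<Longrightarrow> prank P y = d \<Longrightarrow> distinct w \<Longrightarrow> set w = atoms_below n x y \<Longrightarrow> length w = d"
  using card_atoms_below[of y] distinct_card[of w] by simp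

lemma det_nonzero:
  assumes y: "y \<in> P" "prank P y = d" and w: "distinct w" "set w = atoms_below n x y"
  shows "det (column_mat C w) \<noteq> 0"
proof
  assume "det (column_mat C w) = 0"
  then obtain v i where i: "i \<in> set w" "v i \<noteq> 0"
    and v: "\<And>k. k \<in> {1..d} \<Longrightarrow> (\<Sum>i\<in>set w. C k i * v i) = 0"
    using column_mat_kernel[OF w(1) length_atoms_list[OF y w]] by metis
  have i_n: "i \<in> {1..n}" and iy: "x i \<le> y" using i(1) w(2) by (auto simp: atoms_below_def)
  \<comment> \<open>\<open>pX 0\<close> plays the role of t, so \<open>g\<close> is evaluation at
    the point t v of the face y.\<close>
  define f :: "nat \<Rightarrow> nat qpoly" where "f = (\<lambda>i. pconst (v i) * pX 0)"
  define g where "g = psubst (face_subst n x y f)"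
  have "psubst (face_subst n x y f) (param_lift k) = 0" for k
  proof (cases "k \<in> {1..d}")
    case True
    have "psubst (face_subst n x y f) (param_lift k)
        = (\<Sum>i\<in>atoms_below n x y. pconst (C k i) * face_subst n x y f (x i))"
      by (rule psubst_param_lift[OF _ True]) (simp add: face_subst_label)
    also have "\<dots> = (\<Sum>i\<in>atoms_below n x y. pconst (C k i * v i) * pX 0)"
      by (rule sum.cong[OF refl])
        (simp only: atoms_below_def mem_Collect_eq face_subst_label if_True f_def pconst_mult mult.assoc)
    also have "\<dots> = pconst (\<Sum>i\<in>atoms_below n x y. C k i * v i) * pX 0"
      by (simp only: pconst_sum sum_distrib_right)
    finally show ?thesis using v[OF True] w(2) by simp
  next
    case False
    then have "param_lift k = 0" by (simp only: param_lift_def if_False)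
    then show ?thesis by simp
  qed
  then have g_param: "\<exists>c. g (psubst param_lift r) = pconst c" for r
    using psubst_zero_fun[of r] by (simp add: g_def psubst_psubst)
  obtain M where M: "finite M" "M \<subseteq> carrier (face_ring P)"
    and span: "\<And>a. a \<in> carrier (face_ring P) \<Longrightarrow> \<exists>c \<in> M \<rightarrow> carrier (param_ring P \<theta>).
      a = (\<Oplus>\<^bsub>face_ring P\<^esub>m\<in>M. c m \<otimes>\<^bsub>face_ring P\<^esub> m)"
    using finite_module by (auto simp: finite_module_over_def)
  have "\<forall>m\<in>M. \<exists>p. p \<in> qpolys (P - {pbot P}) \<and> face_class P p = m"
    using M(2) by (auto simp: carrier_face_ring)
  then obtain q where q: "\<And>m. m \<in> M \<Longrightarrow> q m \<in> qpolys (P - {pbot P}) \<and> face_class P (q m) = m"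
    by metis
  \<comment> \<open>The N-th power of \<open>x i\<close> is mapped to v_i^N t^N. Coefficients from
    the parameter ring become constants under \<open>g\<close>, so t^N must already occur in the
    image of one of the finitely many module generators. Letting N vary contradicts finiteness of
    their supports.\<close>
  have "Poly_Mapping.single 0 N \<in> (\<Union>m\<in>M. Poly_Mapping.keys (g (q m)))" for N
  proof -
    let ?p = "pX (x i) ^ N"
    have p: "?p \<in> qpolys (P - {pbot P})"
      using label_mem[OF i_n] by (intro qpolys_power) simp
    obtain c where c: "c \<in> M \<rightarrow> range param_eval"
      "face_class P ?p = (\<Oplus>\<^bsub>face_ring P\<^esub>m\<in>M. c m \<otimes>\<^bsub>face_ring P\<^esub> m)"
      using span[of "face_class P ?p"] p by (auto simp: carrier_param_ring)
    have "\<forall>m\<in>M. \<exists>r. c m = param_eval r" using c(1) by (auto simp: Pi_def)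
    then obtain r where r: "\<And>m. m \<in> M \<Longrightarrow> c m = param_eval (r m)" by metis
    let ?s = "\<lambda>m. psubst param_lift (r m) * q m"
    have s: "?s m \<in> qpolys (P - {pbot P})" if "m \<in> M" for m
      using that q by (simp add: qpolys_mult psubst_param_lift_mem)
    have "face_class P ?p = (\<Oplus>\<^bsub>face_ring P\<^esub>m\<in>M. face_class P (?s m))"
      unfolding c(2)
    proof (rule abelian_monoid.finsum_cong'[OF _ refl])
      show "abelian_monoid (face_ring P)"
        using ring_face_ring by (simp add: ring.is_abelian_group abelian_group.axioms(1))
      fix m assume m: "m \<in> M"
      then show "c m \<otimes>\<^bsub>face_ring P\<^esub> m = face_class P (?s m)"
        using q[OF m] by (simp add: r[OF m] param_eval_def face_class_mult psubst_param_lift_mem)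
    qed (use s in auto)
    also have "\<dots> = face_class P (\<Sum>m\<in>M. ?s m)"
      by (rule face_class_sum[symmetric]) (rule s)
    finally have "g ?p = g (\<Sum>m\<in>M. ?s m)"
      unfolding g_def
      by (intro psubst_face_class_eq[OF face_subst_relations[OF y(1)] p]) (auto intro: qpolys_sum s)
    also have "g ?p = Poly_Mapping.single (Poly_Mapping.single 0 N) (v i ^ N)"
    proof -
      have "g ?p = f i ^ N"
        using iy i_n by (simp add: g_def psubst_power face_subst_label)
      also have "\<dots> = pconst (v i) ^ N * pX 0 ^ N" by (simp add: f_def power_mult_distrib)
      also have "pconst (v i) ^ N = pconst (v i ^ N)"
        by (induction N) (simp_all add: mult_single)
      finally show ?thesis by (simp add: pX_power mult_single)
    qed
    also have "g (\<Sum>m\<in>M. ?s m) = (\<Sum>m\<in>M. g (psubst param_lift (r m)) * g (q m))"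
      by (simp add: g_def psubst_simps)
    finally have "Poly_Mapping.single 0 N \<in> Poly_Mapping.keys (\<Sum>m\<in>M. g (psubst param_lift (r m)) * g (q m))"
      using i(2) by (metis insertI1 keys_single power_not_zero)
    also have "\<dots> \<subseteq> (\<Union>m\<in>M. Poly_Mapping.keys (g (psubst param_lift (r m)) * g (q m)))"
      by (rule keys_sum)
    also have "\<dots> \<subseteq> (\<Union>m\<in>M. Poly_Mapping.keys (g (q m)))"
    proof (intro UN_mono order_refl)
      fix m
      obtain c where "g (psubst param_lift (r m)) = pconst c" using g_param by blast
      then show "Poly_Mapping.keys (g (psubst param_lift (r m)) * g (q m)) \<subseteq> Poly_Mapping.keys (g (q m))"
        by (simp add: keys_pconst_mult)
    qed
    finally show ?thesis .
  qed
  then have "range (Poly_Mapping.single (0::nat) :: nat \<Rightarrow> _) \<subseteq> (\<Union>m\<in>M. Poly_Mapping.keys (g (q m)))"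
    by blast
  then have "finite (range (Poly_Mapping.single (0::nat) :: nat \<Rightarrow> _))"
    using M(1) finite_subset by fastforce
  moreover have "inj (Poly_Mapping.single (0::nat) :: nat \<Rightarrow> _)"
    by simp
  ultimately show False
    using finite_imageD infinite_UNIV_nat by blast
qed

end

text \<open>\<open>B\<close> inverts the columns of \<open>C\<close> belonging to the atoms of
  \<open>y\<close>. Its row \<open>i\<close> holds the coefficients of L_i(y), the polynomial that
  represents the local parameter of atom \<open>i\<close>.\<close>

locale facet = lsop P n x d \<theta> C for P :: "'a::order set" and n x d \<theta> C +
  fixes y :: 'a and B :: "nat \<Rightarrow> nat \<Rightarrow> rat"
  assumes facet: "y \<in> P" "prank P y = d"
    and left_inverse: "\<And>i j. i \<in> atoms_below n x y \<Longrightarrow> j \<in> atoms_below n x y \<Longrightarrow>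
      (\<Sum>k\<in>{1..d}. B i k * C k j) = (if i = j then 1 else 0)"
    and right_inverse: "\<And>k l. k \<in> {1..d} \<Longrightarrow> l \<in> {1..d} \<Longrightarrow>
      (\<Sum>i\<in>atoms_below n x y. C k i * B i l) = (if k = l then 1 else 0)"
begin

definition restriction :: "'a qpoly \<Rightarrow> nat qpoly" where
  "restriction = psubst (face_subst n x y (\<lambda>i. linear_form d (B i)))"

lemma sum_linear_forms:
  assumes k: "k \<in> {1..d}"
  shows "(\<Sum>i\<in>atoms_below n x y. pconst (C k i) * linear_form d (B i)) = pX k"
proof -
  have "(\<Sum>i\<in>atoms_below n x y. pconst (C k i) * linear_form d (B i))
      = (\<Sum>i\<in>atoms_below n x y. \<Sum>l\<in>{1..d}. pconst (C k i * B i l) * pX l)"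
    unfolding linear_form_def sum_distrib_left by (simp only: pconst_mult mult.assoc)
  also have "\<dots> = (\<Sum>l\<in>{1..d}. pconst (\<Sum>i\<in>atoms_below n x y. C k i * B i l) * pX l)"
    by (subst sum.swap) (simp only: pconst_sum sum_distrib_right)
  also have "\<dots> = (\<Sum>l\<in>{1..d}. if k = l then pX l else 0)"
    using k by (intro sum.cong refl) (simp add: right_inverse)
  also have "\<dots> = pX k" using k by simp
  finally show ?thesis .
qed

text \<open>By the left inverse, L_i in the restricted parameters is the atom \<open>x i\<close>
  again. The arbitrary \<open>h\<close> covers both the evaluation in a polynomial ring and the map
  to the interval.\<close>

lemma psubst_linear_form:
  assumes h: "\<And>i. i \<in> {1..n} \<Longrightarrow> \<not> x i \<le> y \<Longrightarrow> h (x i) = 0" and i: "i \<in> atoms_below n x y"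
  shows "psubst h (psubst param_lift (linear_form d (B i))) = h (x i)"
proof -
  have hk: "psubst h (param_lift k) = (\<Sum>i\<in>atoms_below n x y. pconst (C k i) * h (x i))"
    if "k \<in> {1..d}" for k
    by (rule psubst_param_lift) (use h that in auto)
  have "psubst h (psubst param_lift (linear_form d (B i)))
      = (\<Sum>k\<in>{1..d}. pconst (B i k) * psubst h (param_lift k))"
    by (simp add: linear_form_def psubst_simps)
  also have "\<dots> = (\<Sum>k\<in>{1..d}. \<Sum>j\<in>atoms_below n x y. pconst (B i k * C k j) * h (x j))"
    by (intro sum.cong refl) (simp only: hk sum_distrib_left pconst_mult mult.assoc)
  also have "\<dots> = (\<Sum>j\<in>atoms_below n x y. pconst (\<Sum>k\<in>{1..d}. B i k * C k j) * h (x j))"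
    by (subst sum.swap) (simp only: pconst_sum sum_distrib_right)
  also have "\<dots> = (\<Sum>j\<in>atoms_below n x y. if i = j then h (x j) else 0)"
    by (intro sum.cong refl) (simp add: left_inverse[OF i, simplified])
  also have "\<dots> = h (x i)" using i by simp
  finally show ?thesis .
qed

lemma face_subst_linear_form:
  "i \<in> atoms_below n x y \<Longrightarrow>
    psubst (face_subst n x y f) (psubst param_lift (linear_form d (B i))) = f i"
  using psubst_linear_form[of "face_subst n x y f" i]
  by (auto simp: face_subst_label atoms_below_def)

lemma interval_subst_linear_form:
  "i \<in> atoms_below n x y \<Longrightarrow>
    psubst (interval_subst y) (psubst param_lift (linear_form d (B i))) = pX (x i)"
  using psubst_linear_form[of "interval_subst y" i]
  by (auto simp: interval_subst_def atoms_below_def)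

text \<open>The right inverse makes \<open>restriction\<close> a retraction onto polynomials in the
  parameters, up to discarding variables outside \<open>{1..d}\<close>.\<close>

lemma restriction_param_lift:
  "restriction (psubst param_lift r) = psubst (\<lambda>k. if k \<in> {1..d} then pX k else 0) r"
proof -
  have "restriction (param_lift k) = (if k \<in> {1..d} then pX k else 0)" for k
  proof (cases "k \<in> {1..d}")
    case True
    have "restriction (param_lift k)
        = (\<Sum>i\<in>atoms_below n x y. pconst (C k i) * face_subst n x y (\<lambda>i. linear_form d (B i)) (x i))"
      unfolding restriction_def by (rule psubst_param_lift[OF _ True]) (simp add: face_subst_label)
    also have "\<dots> = (\<Sum>i\<in>atoms_below n x y. pconst (C k i) * linear_form d (B i))"
      by (intro sum.cong refl) (simp add: face_subst_label atoms_below_def)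
    finally show ?thesis using sum_linear_forms[OF True] True by simp
  next
    case False
    then have "param_lift k = 0" by (simp only: param_lift_def if_False)
    then show ?thesis using False by (simp only: restriction_def psubst_zero if_False)
  qed
  then show ?thesis
    unfolding restriction_def psubst_psubst by presburger
qed

lemma param_eval_cutoff: "param_eval (psubst (\<lambda>k. if k \<in> {1..d} then pX k else 0) r) = param_eval r"
proof -
  have "(\<lambda>k. psubst param_lift (if k \<in> {1..d} then pX k else 0)) = param_lift"
    by (auto simp: param_lift_def)
  then show ?thesis by (simp add: param_eval_def psubst_psubst)
qed

text \<open>\<open>restriction\<close> kills the relations of the interval, hence can be applied
  after the projection. There it recovers the polynomial in the parameters up to the cutoff, on
  which \<open>param_eval\<close> does not depend.\<close>

lemma inj_face_proj: "inj_on (face_proj P y) (range param_eval)"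
proof (rule inj_onI)
  interpret Q: simplicial "below P y"
    using simplicial_below[OF facet(1)] by unfold_locales
  fix a b assume "a \<in> range param_eval" "b \<in> range param_eval" and eq: "face_proj P y a = face_proj P y b"
  then obtain r s where rs: "a = param_eval r" "b = param_eval s" by blast
  have "face_class (below P y) (psubst (interval_subst y) (psubst param_lift r))
      = face_class (below P y) (psubst (interval_subst y) (psubst param_lift s))"
    using eq by (simp add: rs param_eval_def face_proj_face_class[OF facet(1)] psubst_param_lift_mem)
  then have "restriction (psubst (interval_subst y) (psubst param_lift r))
      = restriction (psubst (interval_subst y) (psubst param_lift s))"
    unfolding restriction_def
    by (intro Q.psubst_face_class_eq[OF face_subst_relations_below[OF facet(1)]])
      (auto intro: psubst_interval_mem[OF facet(1)] psubst_param_lift_mem)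
  then have "restriction (psubst param_lift r) = restriction (psubst param_lift s)"
    unfolding restriction_def face_subst_interval_subst .
  then have "param_eval (restriction (psubst param_lift r)) = param_eval (restriction (psubst param_lift s))"
    by (rule arg_cong)
  then show "a = b"
    unfolding rs restriction_param_lift param_eval_cutoff .
qed

text \<open>Checked on generators: in the face ring of the interval a poset element is the product
  of its atoms (\<open>pvar_product_below\<close>), and each atom \<open>x i\<close> is the image of
  L_i. With injectivity this identifies \<open>iota\<close>.\<close>

lemma face_proj_restriction:
  assumes p: "p \<in> qpolys (P - {pbot P})"
  shows "face_proj P y (param_eval (restriction p)) = face_proj P y (face_class P p)"
proof -
  interpret Q: simplicial "below P y"
    using simplicial_below[OF facet(1)] by unfold_locales
  let ?h = "\<lambda>p. psubst (interval_subst y) (psubst param_lift (restriction p))"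
  have mem: "?h p \<in> qpolys (below P y - {pbot (below P y)})" for p
    by (intro psubst_interval_mem facet psubst_param_lift_mem)
  have "face_class (below P y) (?h p) = face_class (below P y) (psubst (interval_subst y) p)"
    using p
  proof (induction rule: qpolys_induct)
    case (const c)
    then show ?case by (simp add: restriction_def)
  next
    case (var v)
    show ?case
    proof (cases "v \<le> y")
      case True
      then have v: "v \<in> below P y" "v \<noteq> pbot (below P y)"
        using var pbot_below[OF facet(1)] by (auto simp: below_def)
      have "atoms_below n x v \<subseteq> atoms_below n x y" using True by (rule atoms_below_mono)
      then have h: "?h (pX v) = (\<Prod>i\<in>atoms_below n x v. pX (x i))"
        using True by (auto simp: restriction_def face_subst_def psubst_prod interval_subst_linear_form
          intro!: prod.cong)
      have "pX v - ?h (pX v) \<in> face_ideal (below P y)"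
        using pvar_product_below[OF facet(1) v(1)] v(2) by (simp add: h Q.pvar_eq)
      then show ?thesis
        using True v mem[of "pX v"] 
        by (subst (asm) Q.face_class_eq_iff[symmetric]) (simp_all add: interval_subst_def[of y v])
    qed (simp add: restriction_def face_subst_def interval_subst_def)
  next
    case (add p q)
    then show ?case
      using Q.face_class_add[OF mem mem, of p q] psubst_interval_mem[OF facet(1)]
      by (simp add: restriction_def psubst_add Q.face_class_add)
  next
    case (mult p q)
    then show ?case
      using Q.face_class_mult[OF mem mem, of p q] psubst_interval_mem[OF facet(1)]
      by (simp add: restriction_def psubst_mult Q.face_class_mult)
  qed
  then show ?thesis
    using p by (simp add: param_eval_def face_proj_face_class[OF facet(1)] psubst_param_lift_mem)
qed

lemma iota_face_class:
  assumes p: "p \<in> qpolys (P - {pbot P})"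
  shows "iota P \<theta> y (face_class P p) = param_eval (restriction p)"
  unfolding iota_def carrier_param_ring
  by (rule the_inv_into_f_eq[OF inj_face_proj face_proj_restriction[OF p]]) simp

lemma local_param_eq:
  assumes i: "i \<in> atoms_below n x y"
  shows "local_param P \<theta> x y i = param_eval (linear_form d (B i))"
proof -
  have "i \<in> {1..n}" "x i \<le> y" using i by (auto simp: atoms_below_def)
  then show ?thesis
    using iota_face_class[OF pvar_mem, of "x i"] label_mem[of i]
    by (simp add: local_param_def poset_elem_def restriction_def
      psubst_face_subst_pvar[OF facet(1)] face_subst_label)
qed

text \<open>Evaluation at the atoms of \<open>y\<close> is well defined on classes and sends L_i to
  the variable \<open>pX i\<close>.\<close>

lemma param_eval_linear_form_nonzero:
  assumes i: "i \<in> atoms_below n x y"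
  shows "param_eval (linear_form d (B i)) \<noteq> \<zero>\<^bsub>face_ring P\<^esub>"
proof
  assume "param_eval (linear_form d (B i)) = \<zero>\<^bsub>face_ring P\<^esub>"
  then have "face_class P (psubst param_lift (linear_form d (B i))) = face_class P 0"
    by (simp add: param_eval_def face_class_zero)
  then have "psubst (face_subst n x y pX) (psubst param_lift (linear_form d (B i)))
      = psubst (face_subst n x y pX) 0"
    by (intro psubst_face_class_eq[OF face_subst_relations[OF facet(1)]] psubst_param_lift_mem) simp_all
  then show False
    using face_subst_linear_form[OF i, of pX] pX_nonzero[of i] by simp
qed

text \<open>Since theta_j is the sum of C_ji L_i over the atoms i of y, the coordinates of theta_j
  form a row of \<open>column_mat C w\<close>. The matrix of the linear map has them as a column,
  hence the transpose.\<close>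

lemma multiplicity_at_eq:
  assumes w: "distinct w" "set w = atoms_below n x y"
  shows "multiplicity_at P \<theta> x y w = det (column_mat C w)"
proof -
  have len: "length w = d" using length_atoms_list[OF facet w] .
  let ?L = "\<lambda>k. linear_form d (B (w ! k))"
  have wy: "w ! k \<in> atoms_below n x y" if "k < d" for k
    using that len w(2) nth_mem by blast
  have sum_eq: "(\<Oplus>\<^bsub>face_ring P\<^esub>k\<in>{..<d}. scal P (M $$ (k, j)) \<otimes>\<^bsub>face_ring P\<^esub> local_param P \<theta> x y (w ! k))
      = param_eval (\<Sum>k<d. pconst (M $$ (k, j)) * ?L k)" for M :: "rat mat" and j
  proof -
    have "(\<Oplus>\<^bsub>face_ring P\<^esub>k\<in>{..<d}. scal P (M $$ (k, j)) \<otimes>\<^bsub>face_ring P\<^esub> local_param P \<theta> x y (w ! k))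
      = (\<Oplus>\<^bsub>face_ring P\<^esub>k\<in>{..<d}. face_class P (psubst param_lift (pconst (M $$ (k, j)) * ?L k)))"
    proof (rule abelian_monoid.finsum_cong'[OF _ refl])
      show "abelian_monoid (face_ring P)"
        using ring_face_ring by (simp add: ring.is_abelian_group abelian_group.axioms(1))
      fix k assume "k \<in> {..<d}"
      then show "scal P (M $$ (k, j)) \<otimes>\<^bsub>face_ring P\<^esub> local_param P \<theta> x y (w ! k)
          = face_class P (psubst param_lift (pconst (M $$ (k, j)) * ?L k))"
        using wy[of k] by (simp add: local_param_eq param_eval_mult flip: param_eval_pconst param_eval_def)
    qed (auto intro: psubst_param_lift_mem face_class_mem)
    also have "\<dots> = param_eval (\<Sum>k<d. pconst (M $$ (k, j)) * ?L k)"
      unfolding param_eval_def psubst_sum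
      by (rule face_class_sum[symmetric]) (rule psubst_param_lift_mem)
    finally show ?thesis .
  qed
  let ?M = "transpose_mat (column_mat C w)"
  have M: "?M \<in> carrier_mat d d" using column_mat_carrier[of C w] len by simp
  have M_sum: "(\<Sum>k<d. pconst (?M $$ (k, j)) * ?L k) = pX (Suc j)" if "j < d" for j
  proof -
    have bij: "bij_betw ((!) w) {..<d} (atoms_below n x y)"
      using bij_betw_nth[OF w(1), of "{..<d}" "atoms_below n x y"] w(2) len by simp
    have "(\<Sum>k<d. pconst (?M $$ (k, j)) * ?L k) = (\<Sum>k<d. pconst (C (Suc j) (w ! k)) * ?L k)"
      using that len by (intro sum.cong) (simp_all add: column_mat_def)
    also have "\<dots> = (\<Sum>i\<in>atoms_below n x y. pconst (C (Suc j) i) * linear_form d (B i))"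
      by (rule sum.reindex_bij_betw[OF bij])
    also have "\<dots> = pX (Suc j)" using that by (intro sum_linear_forms) simp
    finally show ?thesis .
  qed
  have "(THE M. M \<in> carrier_mat d d \<and> (\<forall>j<d. \<theta> (Suc j) = (\<Oplus>\<^bsub>face_ring P\<^esub>k\<in>{..<d}.
      scal P (M $$ (k, j)) \<otimes>\<^bsub>face_ring P\<^esub> local_param P \<theta> x y (w ! k)))) = ?M"
    unfolding sum_eq
  proof (rule the_equality)
    show "?M \<in> carrier_mat d d \<and> (\<forall>j<d. \<theta> (Suc j) = param_eval (\<Sum>k<d. pconst (?M $$ (k, j)) * ?L k))"
    proof (intro conjI allI impI M)
      fix j assume j: "j < d"
      show "\<theta> (Suc j) = param_eval (\<Sum>k<d. pconst (?M $$ (k, j)) * ?L k)"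
        unfolding M_sum[OF j] using j by (simp add: param_eval_pX)
    qed
    fix N assume N: "N \<in> carrier_mat d d \<and> (\<forall>j<d. \<theta> (Suc j) = param_eval (\<Sum>k<d. pconst (N $$ (k, j)) * ?L k))"
    \<comment> \<open>Evaluation at the atoms turns the local parameters into distinct variables, so
      matrix entries can be read off as coefficients; this gives uniqueness of the matrix.\<close>
    have image: "psubst (face_subst n x y pX) (psubst param_lift (\<Sum>k<d. pconst (X $$ (k, j)) * ?L k))
        = (\<Sum>k<d. pconst (X $$ (k, j)) * pX (w ! k))" for X j
      using wy by (simp add: psubst_simps face_subst_linear_form)
    have coeff: "Poly_Mapping.lookup (\<Sum>k<d. pconst (X $$ (k, j)) * pX (w ! k))
        (Poly_Mapping.single (w ! i) 1) = X $$ (i, j)" if "i < d" for X :: "rat mat" and i j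
    proof -
      have "Poly_Mapping.single (w ! k) (1::nat) = Poly_Mapping.single (w ! i) 1 \<longleftrightarrow> k = i" if "k < d" for k
        using that \<open>i < d\<close> w(1) len nth_eq_iff_index_eq[of w k i]
        by (metis keys_single singleton_inject zero_neq_one)
      then have "Poly_Mapping.lookup (\<Sum>k<d. pconst (X $$ (k, j)) * pX (w ! k))
          (Poly_Mapping.single (w ! i) 1) = (\<Sum>k<d. if k = i then X $$ (k, j) else 0)"
        unfolding lookup_sum pconst_mult_pX lookup_single
        by (intro sum.cong) (simp_all add: when_def)
      then show ?thesis using that by simp
    qed
    show "N = ?M"
    proof (rule eq_matI)
      fix i j assume "i < dim_row ?M" "j < dim_col ?M"
      then have ij: "i < d" "j < d" using M by auto
      have "param_eval (\<Sum>k<d. pconst (N $$ (k, j)) * ?L k) = param_eval (\<Sum>k<d. pconst (?M $$ (k, j)) * ?L k)"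
        using N ij by (simp only: M_sum) (simp add: param_eval_pX)
      then have "(\<Sum>k<d. pconst (N $$ (k, j)) * pX (w ! k)) = (\<Sum>k<d. pconst (?M $$ (k, j)) * pX (w ! k))"
        unfolding image[symmetric] param_eval_def
        by (intro psubst_face_class_eq[OF face_subst_relations[OF facet(1)]] psubst_param_lift_mem)
      then show "N $$ (i, j) = ?M $$ (i, j)"
        using coeff[OF ij(1), of N j] coeff[OF ij(1), of ?M j] by simp
    qed (use N M in auto)
  qed
  then show ?thesis
    unfolding multiplicity_at_def basis_map_det_def rank
    using det_transpose[OF column_mat_carrier[of C w]] by simp
qed

end

section \<open>Poles along linear forms\<close>

lemma lookup_linear_form:
  "k \<in> {1..d} \<Longrightarrow> Poly_Mapping.lookup (linear_form d b) (Poly_Mapping.single k 1) = b k"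
proof -
  assume k: "k \<in> {1..d}"
  have "Poly_Mapping.single j (1::nat) = Poly_Mapping.single k 1 \<longleftrightarrow> j = k" for j
    by (metis keys_single singleton_inject zero_neq_one)
  then have "Poly_Mapping.lookup (linear_form d b) (Poly_Mapping.single k 1)
      = (\<Sum>j\<in>{1..d}. if j = k then b j else 0)"
    unfolding linear_form_def lookup_sum pconst_mult_pX lookup_single
    by (intro sum.cong) (simp_all add: when_def)
  then show ?thesis using k by simp
qed

lemma linear_form_cmul: "linear_form d (\<lambda>k. c * b k) = pconst c * linear_form d b"
  by (simp only: linear_form_def sum_distrib_left pconst_mult mult.assoc)

lemma linear_form_diff: "linear_form d (\<lambda>k. a k - b k) = linear_form d a - linear_form d b"
  by (simp add: linear_form_def single_diff left_diff_distrib sum_subtractf)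

text \<open>Eliminating a variable that occurs in a linear form is a ring endomorphism whose kernel is
  the ideal generated by the form; hence linear forms are prime.\<close>

locale nonzero_linear_form =
  fixes d :: nat and b :: "nat \<Rightarrow> rat" and v :: nat
  assumes v: "v \<in> {1..d}" and b_nonzero: "b v \<noteq> 0"
begin

definition eliminate :: "nat qpoly \<Rightarrow> nat qpoly" where
  "eliminate = psubst (\<lambda>k. if k = v then pX v - pconst (1 / b v) * linear_form d b else pX k)"

lemma eliminate_linear_form:
  "eliminate (linear_form d a) = linear_form d a - pconst (a v / b v) * linear_form d b"
proof -
  have "eliminate (linear_form d a)
      = (\<Sum>k\<in>{1..d}. pconst (a k) * pX k - (if k = v then pconst (a k / b v) * linear_form d b else 0))"
    unfolding linear_form_def[of d a] eliminate_def psubst_sum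
  proof (intro sum.cong refl)
    fix k
    have quotient: "pconst (a k / b v) = pconst (a k) * pconst (1 / b v)"
      by (simp flip: pconst_mult)
    show "psubst (\<lambda>k. if k = v then pX v - pconst (1 / b v) * linear_form d b else pX k) (pconst (a k) * pX k)
      = pconst (a k) * pX k - (if k = v then pconst (a k / b v) * linear_form d b else 0)"
      unfolding psubst_mult psubst_pconst psubst_pX quotient
      by (cases "k = v") (simp_all only: if_True if_False right_diff_distrib mult.assoc
        diff_0_right simp_thms)
  qed
  also have "\<dots> = linear_form d a - pconst (a v / b v) * linear_form d b"
    using v by (simp add: sum_subtractf linear_form_def[of d a])
  finally show ?thesis .
qed

text \<open>\<open>eliminate\<close> changes the variable \<open>v\<close> by a multiple of the form
  and no other variable, so every \<open>p\<close> is congruent to \<open>eliminate p\<close> modulo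
  the form.\<close>

lemma linear_form_dvd_iff: "linear_form d b dvd p \<longleftrightarrow> eliminate p = 0"
proof
  assume "linear_form d b dvd p"
  then obtain q where "p = linear_form d b * q" by (rule dvdE)
  then show "eliminate p = 0"
    using eliminate_linear_form[of b] b_nonzero by (simp add: eliminate_def psubst_mult)
next
  assume "eliminate p = 0"
  have "linear_form d b dvd psubst pX p - eliminate p"
    unfolding eliminate_def by (rule psubst_dvd_diff[of _ UNIV]) (simp_all add: qpolys_UNIV)
  then show "linear_form d b dvd p"
    using \<open>eliminate p = 0\<close> by (simp add: psubst_id)
qed

lemma prime_elem_linear_form: "prime_elem (linear_form d b)"
  unfolding prime_elem_def
proof (intro conjI allI impI)
  show "linear_form d b \<noteq> 0"
    using lookup_linear_form[OF v, of b] b_nonzero by auto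
  show "\<not> linear_form d b dvd 1"
    by (simp add: linear_form_dvd_iff) (simp add: eliminate_def)
  fix p q assume "linear_form d b dvd p * q"
  then show "linear_form d b dvd p \<or> linear_form d b dvd q"
    by (simp add: linear_form_dvd_iff) (simp add: eliminate_def psubst_mult)
qed

lemma linear_form_dvd_linear_form:
  assumes "linear_form d b dvd linear_form d a"
  obtains c where "\<And>k. k \<in> {1..d} \<Longrightarrow> a k = c * b k"
proof -
  define c where "c = a v / b v"
  have "linear_form d (\<lambda>k. a k - c * b k) = 0"
    unfolding linear_form_diff linear_form_cmul
    using assms by (simp add: linear_form_dvd_iff eliminate_linear_form c_def)
  then have "a k - c * b k = 0" if "k \<in> {1..d}" for k
    using lookup_linear_form[OF that, of "\<lambda>k. a k - c * b k"] by simp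
  then show thesis using that[of c] by simp
qed

end

section \<open>Integrality at a prime of a domain\<close>

lemma pconst_dvd_cancel: "c \<noteq> 0 \<Longrightarrow> p dvd pconst c * q \<longleftrightarrow> p dvd q"
proof -
  assume c: "c \<noteq> 0"
  have q: "q = pconst (1 / c) * (pconst c * q)"
    using c by (simp add: mult_single flip: mult.assoc)
  show ?thesis
    by (metis q dvd_mult)
qed

text \<open>For prime \<open>p\<close> this is the localization at (p) inside the fraction field,
  that is, absence of a pole along \<open>p\<close>. Some representation, not every one, must have a
  denominator prime to \<open>p\<close>.\<close>

definition integral_at :: "'r::idom \<Rightarrow> 'r fract \<Rightarrow> bool" where
  "integral_at p F \<longleftrightarrow> (\<exists>a b. \<not> p dvd b \<and> F = Fract a b)"

lemma integral_at_Fract: "\<not> p dvd b \<Longrightarrow> integral_at p (Fract a b)"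
  by (auto simp: integral_at_def)

lemma integral_at_add:
  assumes "prime_elem p" "integral_at p F" "integral_at p G"
  shows "integral_at p (F + G)"
proof -
  obtain a b where F: "\<not> p dvd b" "F = Fract a b" using assms(2) by (auto simp: integral_at_def)
  obtain a' b' where G: "\<not> p dvd b'" "G = Fract a' b'" using assms(3) by (auto simp: integral_at_def)
  have "b \<noteq> 0" "b' \<noteq> 0" using F(1) G(1) by auto
  then have "F + G = Fract (a * b' + a' * b) (b * b')" using F G by simp
  then show ?thesis
    using F(1) G(1) assms(1) by (auto intro!: integral_at_Fract simp: prime_elem_dvd_mult_iff)
qed

lemma integral_at_sum:
  assumes "prime_elem p" "\<And>i. i \<in> A \<Longrightarrow> integral_at p (F i)"
  shows "integral_at p (sum F A)"
proof -
  have "integral_at p 0"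
    using integral_at_Fract[of p 1 0] assms(1) by (simp add: Zero_fract_def prime_elem_not_unit)
  with assms(2) show ?thesis
    by (induction A rule: infinite_finite_induct) (auto intro: integral_at_add[OF assms(1)])
qed

lemma not_prime_dvd_prod:
  "prime_elem p \<Longrightarrow> (\<And>i. i \<in> A \<Longrightarrow> \<not> p dvd f i) \<Longrightarrow> \<not> p dvd prod f A"
  by (induction A rule: infinite_finite_induct) (auto simp: prime_elem_dvd_mult_iff prime_elem_not_unit)

text \<open>Factors are cancelled one at a time: if also F = c / b with l not dividing b, then
  cross-multiplication shows that l divides a b, hence a. F itself is unchanged, so the hypothesis
  persists for the remaining factors, even if a prime is repeated.\<close>

lemma integral_if_integral_at:
  fixes l :: "'i \<Rightarrow> 'r::idom"
  assumes "finite J" "F = Fract a (\<Prod>j\<in>J. l j)"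
    "\<And>j. j \<in> J \<Longrightarrow> prime_elem (l j)" "\<And>j. j \<in> J \<Longrightarrow> integral_at (l j) F"
  shows "\<exists>f. F = Fract f 1"
  using assms
proof (induction J arbitrary: a rule: finite_induct)
  case (insert j J)
  have prime: "prime_elem (l j)" using insert.prems by simp
  have nz: "l j \<noteq> 0" "(\<Prod>j\<in>J. l j) \<noteq> 0"
    using insert.prems insert.hyps(1) by (auto simp: prime_elem_def)
  obtain c b where cb: "\<not> l j dvd b" "F = Fract c b"
    using insert.prems(3)[of j] by (auto simp: integral_at_def)
  have "b \<noteq> 0" using cb(1) by auto
  then have "a * b = c * (l j * (\<Prod>j\<in>J. l j))"
    using insert.prems(1) insert.hyps cb(2) nz eq_fract(1)[of "l j * (\<Prod>j\<in>J. l j)" b a c] by simp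
  then have "l j dvd a * b" by simp
  then have "l j dvd a" using prime cb(1) by (simp add: prime_elem_dvd_mult_iff)
  then obtain a' where a': "a = l j * a'" by (rule dvdE)
  have "F = Fract a' (\<Prod>j\<in>J. l j)"
    using insert.prems(1) insert.hyps nz by (simp add: a' mult_fract_cancel)
  then show ?case using insert by blast
qed auto

section \<open>Sums of fractions and their transfer to a field with a carrier\<close>

lemma sum_Fract:
  fixes D :: "'i \<Rightarrow> 'r::idom"
  assumes "finite Y" "\<And>y. y \<in> Y \<Longrightarrow> D y \<noteq> 0"
  shows "\<exists>N. (\<Sum>y\<in>Y. Fract (M y) (D y)) = Fract N (\<Prod>y\<in>Y. D y)"
  using assms
proof (induction Y rule: finite_induct)
  case empty
  then show ?case by (auto simp: Zero_fract_def)
next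
  case (insert y Y)
  then obtain N where "(\<Sum>y\<in>Y. Fract (M y) (D y)) = Fract N (\<Prod>y\<in>Y. D y)" by auto
  then show ?case using insert by auto
qed

lemma (in field) add_divide_eq:
  assumes "a \<in> carrier R" "c \<in> carrier R" "b \<in> carrier R - {\<zero>}" "d \<in> carrier R - {\<zero>}"
  shows "a \<otimes> inv b \<oplus> c \<otimes> inv d = (a \<otimes> d \<oplus> c \<otimes> b) \<otimes> inv (b \<otimes> d)"
proof -
  have U: "b \<in> Units R" "d \<in> Units R" using assms field_Units by auto
  have bd: "b \<in> carrier R" "d \<in> carrier R" "inv b \<in> carrier R" "inv d \<in> carrier R"
    using U assms by auto
  have inv: "inv (b \<otimes> d) = inv b \<otimes> inv d"
    using U bd by (intro comm_inv_char) (simp_all add: m_ac)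
  have "a \<otimes> d \<otimes> (inv b \<otimes> inv d) = a \<otimes> inv b \<otimes> (d \<otimes> inv d)"
    using assms bd by (simp add: m_ac)
  moreover have "c \<otimes> b \<otimes> (inv b \<otimes> inv d) = c \<otimes> inv d \<otimes> (b \<otimes> inv b)"
    using assms bd by (simp add: m_ac)
  ultimately show ?thesis
    using U assms bd by (simp add: inv l_distr)
qed

text \<open>\<open>E\<close> may have a kernel, so it has no extension to all fractions; being
  nonzero at the denominators in question is enough. It will be applied to \<open>param_eval\<close>
  followed by the embedding into the fraction field.\<close>

lemma (in field) finsum_divide_eq:
  fixes E :: "'r::idom \<Rightarrow> 'a" and D :: "'i \<Rightarrow> 'r"
  assumes E: "\<And>r. E r \<in> carrier R" "\<And>r s. E (r + s) = E r \<oplus> E s" "\<And>r s. E (r * s) = E r \<otimes> E s"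
      "E 1 = \<one>"
    and Y: "finite Y" and D: "\<And>y. y \<in> Y \<Longrightarrow> E (D y) \<noteq> \<zero>"
    and sum: "(\<Sum>y\<in>Y. Fract (M y) (D y)) = Fract f 1"
  shows "(\<Oplus>y\<in>Y. E (M y) \<otimes> inv E (D y)) = E f"
proof -
  have E0: "E 0 = \<zero>"
    using E(2)[of 0 0] E(1)[of 0] by (metis add.r_cancel_one' add_0 )
  have Dnz: "D y \<noteq> 0" if "y \<in> Y" for y using D[OF that] E0 by metis
  have prod: "E (prod D Z) \<noteq> \<zero>" if "finite Z" "Z \<subseteq> Y" for Z
    using that
  proof (induction Z rule: finite_induct)
    case (insert z Z)
    then show ?case using D[of z] E(1) by (simp add: E(3) integral_iff)
  qed (simp add: E(4))
  \<comment> \<open>One numerator \<open>N\<close> serves both sides: the same addition of fractions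
    is carried out in the type and in the field.\<close>
  have "\<exists>N. (\<Sum>y\<in>Z. Fract (M y) (D y)) = Fract N (prod D Z) \<and>
      (\<Oplus>y\<in>Z. E (M y) \<otimes> inv E (D y)) = E N \<otimes> inv E (prod D Z)" if "finite Z" "Z \<subseteq> Y" for Z
    using that
  proof (induction Z rule: finite_induct)
    case empty
    then show ?case by (intro exI[of _ 0]) (simp add: Zero_fract_def E E0)
  next
    case (insert z Z)
    then obtain N where N: "(\<Sum>y\<in>Z. Fract (M y) (D y)) = Fract N (prod D Z)"
      "(\<Oplus>y\<in>Z. E (M y) \<otimes> inv E (D y)) = E N \<otimes> inv E (prod D Z)" by auto
    have units: "E (D y) \<in> Units R" if "y \<in> Y" for y using D[OF that] E(1) field_Units by auto
    then have "(\<Oplus>y\<in>insert z Z. E (M y) \<otimes> inv E (D y))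
        = E (M z) \<otimes> inv E (D z) \<oplus> E N \<otimes> inv E (prod D Z)"
      using insert.hyps insert.prems N(2) E(1) by (subst finsum_insert) (auto simp: Pi_def)
    also have "\<dots> = (E (M z) \<otimes> E (prod D Z) \<oplus> E N \<otimes> E (D z)) \<otimes> inv (E (D z) \<otimes> E (prod D Z))"
      using insert.prems insert.hyps D prod[of Z] E(1) by (intro add_divide_eq) auto
    also have "\<dots> = E (M z * prod D Z + N * D z) \<otimes> inv E (prod D (insert z Z))"
      using insert.hyps by (simp add: E)
    finally have "(\<Oplus>y\<in>insert z Z. E (M y) \<otimes> inv E (D y))
        = E (M z * prod D Z + N * D z) \<otimes> inv E (prod D (insert z Z))" .
    moreover have "prod D Z \<noteq> 0" using insert.hyps(1) insert.prems Dnz by auto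
    then have "(\<Sum>y\<in>insert z Z. Fract (M y) (D y))
        = Fract (M z * prod D Z + N * D z) (prod D (insert z Z))"
      using insert.hyps insert.prems N(1) Dnz by simp
    ultimately show ?case by blast
  qed
  then obtain N where N: "(\<Sum>y\<in>Y. Fract (M y) (D y)) = Fract N (prod D Y)"
    "(\<Oplus>y\<in>Y. E (M y) \<otimes> inv E (D y)) = E N \<otimes> inv E (prod D Y)" using Y by blast
  have "prod D Y \<noteq> 0" using Y Dnz by auto
  then have "N = f * prod D Y"
    using N(1) sum eq_fract(1)[of "prod D Y" 1 N f] by simp
  moreover have "E (prod D Y) \<in> Units R" using prod[OF Y] E(1) field_Units by auto
  ultimately show ?thesis
    using E(1) by (simp add: N(2) E(3) m_assoc)
qed

section \<open>Adjacent facets\<close>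

lemma dvd_prod_diff:
  fixes l :: "'r::comm_ring_1"
  assumes "\<And>i. i \<in> A \<Longrightarrow> l dvd f i - g i"
  shows "l dvd prod f A - prod g A"
  using assms
proof (induction A rule: infinite_finite_induct)
  case (insert i A)
  have "prod f (insert i A) - prod g (insert i A)
      = (f i - g i) * prod f A + g i * (prod f A - prod g A)"
    using insert.hyps by (simp add: algebra_simps)
  then show ?case using insert by (metis dvd_add dvd_mult dvd_mult2 insertCI)
qed simp_all

text \<open>The cancellation of a simple pole. \<open>S\<close> and \<open>M\<close> stand for the
  sign and the multiplicity, \<open>K\<close> for the ratio, \<open>l\<close> for the common form,
  \<open>Q\<close> for the product of the other forms and \<open>n\<close> for the numerator. By
  \<open>res\<close> the combined numerator is a multiple of l (n Q' - n' Q), whose second factor is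
  again divisible by l because n = n' and Q = Q' modulo l.\<close>

lemma Fract_add_common_factor:
  fixes l :: "'r::idom"
  assumes nz: "l \<noteq> 0" "Q \<noteq> 0" "Q' \<noteq> 0" "M \<noteq> 0" "M' \<noteq> 0" "K \<noteq> 0"
    and res: "S * M' = - (S' * M * K)"
    and n: "n - n' = l * h" and Q: "Q - Q' = l * k"
  shows "Fract (S * n) (M * (K * l * Q)) + Fract (S' * n') (M' * (l * Q'))
    = Fract (S * (h * Q - n * k)) (M * K * Q * Q')"
proof -
  have "n * Q' - n' * Q = (n - n') * Q - n * (Q - Q')" by (simp add: algebra_simps)
  then have X: "n * Q' - n' * Q = l * (h * Q - n * k)" unfolding n Q by (simp add: algebra_simps)
  have "(S * n) * (M' * (l * Q')) + (S' * n') * (M * (K * l * Q))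
      = l * (S * M' * (n * Q') + S' * M * K * (n' * Q))" by (simp add: algebra_simps)
  also have "S' * M * K = - (S * M')" using res by simp
  finally have Y: "(S * n) * (M' * (l * Q')) + (S' * n') * (M * (K * l * Q))
      = l * (S * M') * (n * Q' - n' * Q)" by (simp add: algebra_simps)
  have "Fract (S * n) (M * (K * l * Q)) + Fract (S' * n') (M' * (l * Q'))
    = Fract ((S * n) * (M' * (l * Q')) + (S' * n') * (M * (K * l * Q))) ((M * (K * l * Q)) * (M' * (l * Q')))"
    using nz by simp
  also have "\<dots> = Fract ((l * l * M') * (S * (h * Q - n * k))) ((l * l * M') * (M * K * Q * Q'))"
    unfolding Y X by (simp only: mult_ac)
  also have "\<dots> = Fract (S * (h * Q - n * k)) (M * K * Q * Q')"
    using nz by (intro mult_fract_cancel) simp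
  finally show ?thesis .
qed

lemma sorted_nth_card:
  assumes "sorted w" "distinct w" "k < length w"
  shows "card {z \<in> set w. z < w ! k} = k"
proof -
  have "{z \<in> set w. z < w ! k} = (!) w ` {..<k}"
  proof (intro equalityI subsetI)
    fix z assume "z \<in> {z \<in> set w. z < w ! k}"
    then obtain j where j: "j < length w" "z = w ! j" "w ! j < w ! k" by (auto simp: in_set_conv_nth)
    then have "j < k" using sorted_nth_mono[OF assms(1), of k j] by (metis leD leI)
    then show "z \<in> (!) w ` {..<k}" using j by auto
  next
    fix z assume "z \<in> (!) w ` {..<k}"
    then obtain j where j: "j < k" "z = w ! j" by auto
    then have "w ! j \<le> w ! k" "w ! j \<noteq> w ! k"
      using assms sorted_nth_mono[OF assms(1), of j k] nth_eq_iff_index_eq[OF assms(2), of j k] by auto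
    then show "z \<in> {z \<in> set w. z < w ! k}" using j assms(3) by auto
  qed
  also have "card \<dots> = card {..<k}"
    using assms(2,3) by (intro card_image inj_onI) (simp add: nth_eq_iff_index_eq)
  finally show ?thesis by simp
qed

section \<open>Coefficients of the cellular boundary\<close>

context labelled
begin

lemma cell_face_eq:
  assumes "y \<in> P" "u \<in> below P y" "atoms_below n x y = insert i (atoms_below n x u)"
    "i \<notin> atoms_below n x u"
  shows "cell_face P n x y i = u"
  unfolding cell_face_def
proof (rule the_equality)
  have uP: "u \<in> P" "u \<le> y" using assms(2) by (auto simp: below_def)
  then show "u \<in> P \<and> u \<le> y \<and> prank P u + 1 = prank P y \<and>
      atoms_below n x u = atoms_below n x y - {i}"
    using assms by (simp flip: card_atoms_below)
  fix v assume "v \<in> P \<and> v \<le> y \<and> prank P v + 1 = prank P y \<and> atoms_below n x v = atoms_below n x y - {i}"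
  then show "v = u"
    using assms by (intro atoms_below_inj[OF assms(1)]) (auto simp: below_def)
qed

text \<open>The face omitting \<open>i\<close> carries the sign (-1)^k, where k is the position of
  \<open>i\<close> among the sorted atoms of \<open>y\<close>, hence the number of atoms of
  \<open>u\<close> smaller than \<open>i\<close>. In this form it matches the sign in
  \<open>det_column_insort\<close>.\<close>

lemma lookup_cell_boundary:
  assumes y: "y \<in> P" and u: "u \<in> P"
  shows "\<not> u \<le> y \<Longrightarrow> Poly_Mapping.lookup (cell_boundary P n x y) u = 0"
    and "u \<le> y \<Longrightarrow> atoms_below n x y = insert i (atoms_below n x u) \<Longrightarrow> i \<notin> atoms_below n x u \<Longrightarrow>
      Poly_Mapping.lookup (cell_boundary P n x y) u = (- 1) ^ card {z \<in> atoms_below n x u. z < i}"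
proof -
  let ?A = "atoms_below n x" and ?w = "sorted_list_of_set (atoms_below n x y)"
  have w: "sorted ?w" "distinct ?w" "set ?w = ?A y" by simp_all
  have face: "cell_face P n x y j \<in> below P y \<and> ?A (cell_face P n x y j) = ?A y - {j}"
    if j: "j \<in> ?A y" for j
  proof -
    obtain v where v: "v \<in> below P y" "?A v = ?A y - {j}"
      using atoms_below_ex[OF y, of "?A y - {j}"] by blast
    then have "cell_face P n x y j = v"
      using j by (intro cell_face_eq[OF y]) auto
    then show ?thesis using v by simp
  qed
  have lookup: "Poly_Mapping.lookup (cell_boundary P n x y) u
      = (\<Sum>k<length ?w. (- 1) ^ k * (if cell_face P n x y (?w ! k) = u then 1 else 0))"
    by (simp add: cell_boundary_def lookup_sum when_def eq_commute)
  show "\<not> u \<le> y \<Longrightarrow> Poly_Mapping.lookup (cell_boundary P n x y) u = 0"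
  proof -
    assume "\<not> u \<le> y"
    then have "cell_face P n x y (?w ! k) \<noteq> u" if "k < length ?w" for k
      using face[of "?w ! k"] nth_mem[OF that] w(3) by (auto simp: below_def)
    then show ?thesis by (simp add: lookup)
  qed
  assume uy: "u \<le> y" and i: "?A y = insert i (?A u)" "i \<notin> ?A u"
  then obtain k0 where k0: "k0 < length ?w" "?w ! k0 = i"
    using w(3) by (metis in_set_conv_nth insertI1)
  have u': "u \<in> below P y" using u uy by (simp add: below_def)
  have iff: "cell_face P n x y (?w ! k) = u \<longleftrightarrow> k = k0" if k: "k < length ?w" for k
  proof
    assume "cell_face P n x y (?w ! k) = u"
    then have "?A u = ?A y - {?w ! k}" "?w ! k \<in> ?A y"
      using face[of "?w ! k"] nth_mem[OF k] w(3) by auto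
    then have "?w ! k = i" using i by auto
    then show "k = k0" using nth_eq_iff_index_eq[OF w(2) k k0(1)] k0(2) by simp
  next
    assume "k = k0"
    then show "cell_face P n x y (?w ! k) = u"
      using cell_face_eq[OF y u' i] k0(2) by simp
  qed
  have "Poly_Mapping.lookup (cell_boundary P n x y) u
      = (\<Sum>k<length ?w. if k = k0 then (- 1) ^ k else 0)"
    unfolding lookup by (intro sum.cong) (auto simp: iff)
  also have "\<dots> = (- 1) ^ k0" using k0(1) by simp
  also have "k0 = card {z \<in> ?A y. z < i}"
    using sorted_nth_card[OF w(1,2) k0(1)] w(3) k0(2) by simp
  also have "{z \<in> ?A y. z < i} = {z \<in> ?A u. z < i}" using i by auto
  finally show "Poly_Mapping.lookup (cell_boundary P n x y) u = (- 1) ^ card {z \<in> ?A u. z < i}" .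
qed

lemma lookup_boundary:
  assumes "finite Y"
  shows "Poly_Mapping.lookup (boundary P n x (\<Sum>y\<in>Y. frag_cmul (s y) (oriented_cell y (w y)))) u
    = (\<Sum>y\<in>Y. s y * list_sign (w y) * Poly_Mapping.lookup (cell_boundary P n x y) u)"
  using assms
  by (simp add: boundary_def frag_extend_sum frag_extend_cmul oriented_cell_def lookup_sum mult.assoc o_def)

end

section \<open>Linear forms of a facet and of two facets sharing a wall\<close>

context lsop
begin

lemma dual_coefficients_exist:
  assumes "y \<in> elements_of_rank P d"
  shows "\<exists>B. facet P n x d \<theta> C y B"
proof -
  have y: "y \<in> P" "prank P y = d" using assms by (auto simp: elements_of_rank_def)
  let ?w = "sorted_list_of_set (atoms_below n x y)"
  have w: "distinct ?w" "set ?w = atoms_below n x y" by simp_all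
  show ?thesis
  proof (rule column_mat_inverse[OF w(1) length_atoms_list[OF y w] det_nonzero[OF y w]])
    fix B
    assume
      "\<And>i j. i \<in> set ?w \<Longrightarrow> j \<in> set ?w \<Longrightarrow> (\<Sum>k\<in>{1..d}. B i k * C k j) = (if i = j then 1 else 0)"
      "\<And>k l. k \<in> {1..d} \<Longrightarrow> l \<in> {1..d} \<Longrightarrow> (\<Sum>i\<in>set ?w. C k i * B i l) = (if k = l then 1 else 0)"
    then have "facet P n x d \<theta> C y B"
      unfolding w(2) by unfold_locales (rule y | assumption)+
    then show ?thesis by blast
  qed
qed

end

context facet
begin

lemma linear_form_nonzero:
  assumes i: "i \<in> atoms_below n x y"
  obtains v where "nonzero_linear_form d (B i) v"
proof -
  have "\<exists>v\<in>{1..d}. B i v \<noteq> 0"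
  proof (rule ccontr)
    assume "\<not> (\<exists>v\<in>{1..d}. B i v \<noteq> 0)"
    then have "(\<Sum>k\<in>{1..d}. B i k * C k i) = 0" by (intro sum.neutral) auto
    then show False using left_inverse[OF i i] by simp
  qed
  then show thesis using that by (auto simp: nonzero_linear_form_def)
qed

text \<open>Two forms divisible by the same linear form are proportional to it, and then the pairing
  with the columns \<open>i\<close> and \<open>j\<close> of \<open>C\<close> cannot be the identity.
  So a facet has at most one pole along a given form.\<close>

lemma linear_form_dvd_unique:
  assumes "nonzero_linear_form d b v" and i: "i \<in> atoms_below n x y" and j: "j \<in> atoms_below n x y"
    and dvd: "linear_form d b dvd linear_form d (B i)" "linear_form d b dvd linear_form d (B j)"
  shows "i = j"
proof (rule ccontr)
  assume "i \<noteq> j"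
  obtain c where c: "\<And>k. k \<in> {1..d} \<Longrightarrow> B i k = c * b k"
    using nonzero_linear_form.linear_form_dvd_linear_form[OF assms(1) dvd(1)] by metis
  obtain c' where c': "\<And>k. k \<in> {1..d} \<Longrightarrow> B j k = c' * b k"
    using nonzero_linear_form.linear_form_dvd_linear_form[OF assms(1) dvd(2)] by metis
  have eq: "(\<Sum>k\<in>{1..d}. B i k * C k l) = c * (\<Sum>k\<in>{1..d}. b k * C k l)"
    "(\<Sum>k\<in>{1..d}. B j k * C k l) = c' * (\<Sum>k\<in>{1..d}. b k * C k l)" for l
    unfolding sum_distrib_left by (intro sum.cong refl; simp only: c c' mult.assoc)+
  have "c * (\<Sum>k\<in>{1..d}. b k * C k i) = 1" "c' * (\<Sum>k\<in>{1..d}. b k * C k i) = 0"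
    "c' * (\<Sum>k\<in>{1..d}. b k * C k j) = 1"
    using left_inverse[OF i i] left_inverse[OF j i] left_inverse[OF j j] \<open>i \<noteq> j\<close>
    unfolding eq by simp_all
  then show False by auto
qed

end

text \<open>The atoms \<open>i\<close> and \<open>i'\<close> may coincide, since two facets of a
  simplicial poset may have the same atoms.\<close>

locale adjacent_facets = F: facet P n x d \<theta> C y B + F': facet P n x d \<theta> C y' B'
  for P :: "'a::order set" and n x d \<theta> C y B y' B' +
  fixes u :: 'a and i i' :: nat
  assumes u: "u \<in> P" "u \<le> y" "u \<le> y'"
    and i: "atoms_below n x y = insert i (atoms_below n x u)" "i \<notin> atoms_below n x u"
    and i': "atoms_below n x y' = insert i' (atoms_below n x u)" "i' \<notin> atoms_below n x u"
begin

text \<open>The constant c of the residue comparison. As a product of a row of \<open>B\<close> and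
  a column of \<open>C\<close> it is the coefficient of L_i'(y') in L_i(y); \<open>det_ratio\<close>
  identifies it with a quotient of determinants.\<close>

definition ratio :: rat where
  "ratio = (\<Sum>k\<in>{1..d}. B i k * C k i')"

text \<open>Each parameter is rewritten in the basis L_j'(y'). The two facets share the columns of
  \<open>C\<close> at the atoms of \<open>u\<close>, on which the rows of \<open>B\<close> give
  Kronecker deltas; only the column \<open>i'\<close> contributes something new.\<close>

lemma linear_form_expand:
  assumes j: "j \<in> atoms_below n x y"
  shows "linear_form d (B j) = (if j = i then 0 else linear_form d (B' j))
    + pconst (\<Sum>k\<in>{1..d}. B j k * C k i') * linear_form d (B' i')"
proof -
  have "linear_form d (B j) = (\<Sum>k\<in>{1..d}. pconst (B j k) *
      (\<Sum>j'\<in>atoms_below n x y'. pconst (C k j') * linear_form d (B' j')))"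
    unfolding linear_form_def[of d "B j"] by (intro sum.cong refl) (simp only: F'.sum_linear_forms)
  also have "\<dots> = (\<Sum>k\<in>{1..d}. \<Sum>j'\<in>atoms_below n x y'. pconst (B j k * C k j') * linear_form d (B' j'))"
    by (simp only: sum_distrib_left pconst_mult mult.assoc)
  also have "\<dots> = (\<Sum>j'\<in>atoms_below n x y'. pconst (\<Sum>k\<in>{1..d}. B j k * C k j') * linear_form d (B' j'))"
    by (subst sum.swap) (simp only: pconst_sum sum_distrib_right)
  also have "\<dots> = (\<Sum>j'\<in>atoms_below n x u. pconst (\<Sum>k\<in>{1..d}. B j k * C k j') * linear_form d (B' j'))
      + pconst (\<Sum>k\<in>{1..d}. B j k * C k i') * linear_form d (B' i')"
    using i' by (simp add: add.commute)
  also have "(\<Sum>j'\<in>atoms_below n x u. pconst (\<Sum>k\<in>{1..d}. B j k * C k j') * linear_form d (B' j'))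
      = (\<Sum>j'\<in>atoms_below n x u. if j = j' then linear_form d (B' j') else 0)"
    using i(1) by (intro sum.cong refl) (simp add: F.left_inverse[OF j, simplified])
  also have "\<dots> = (if j = i then 0 else linear_form d (B' j))"
    using i j by auto
  finally show ?thesis .
qed

lemma linear_form_ratio: "linear_form d (B i) = pconst ratio * linear_form d (B' i')"
  using linear_form_expand[of i] i by (simp add: ratio_def)

lemma linear_form_dvd_diff:
  assumes "j \<in> atoms_below n x u"
  shows "linear_form d (B' i') dvd linear_form d (B j) - linear_form d (B' j)"
proof -
  have "j \<noteq> i" "j \<in> atoms_below n x y" using assms i by auto
  then show ?thesis using linear_form_expand[of j] by simp
qed

lemma det_ratio:
  assumes "distinct Z" "set Z = atoms_below n x u"
  shows "det (column_mat C (i' # Z)) = ratio * det (column_mat C (i # Z))"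
    and "det (column_mat C (i # Z)) \<noteq> 0" and "ratio \<noteq> 0"
proof -
  have Z: "distinct (i # Z)" "set (i # Z) = atoms_below n x y" using assms i by auto
  have Z': "distinct (i' # Z)" "set (i' # Z) = atoms_below n x y'" using assms i' by auto
  show 1: "det (column_mat C (i' # Z)) = ratio * det (column_mat C (i # Z))"
    unfolding ratio_def using F.length_atoms_list[OF F.facet Z] F.left_inverse F.right_inverse
    unfolding Z(2)[symmetric] by (intro det_column_replace[OF Z(1)])
  show "det (column_mat C (i # Z)) \<noteq> 0" by (rule F.det_nonzero[OF F.facet Z])
  show "ratio \<noteq> 0" using 1 F.det_nonzero[OF F'.facet Z'] by auto
qed

text \<open>Checked on poset elements. Below \<open>u\<close> both images are products over the same
  atoms of congruent forms. An element below \<open>y\<close> but not below \<open>u\<close> has the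
  atom \<open>i\<close>, so its image contains L_i(y), a multiple of the form; likewise for
  \<open>y'\<close>. Elements below both facets but not below \<open>u\<close> are thereby
  included.\<close>

lemma restriction_dvd_diff:
  assumes p: "p \<in> qpolys (P - {pbot P})"
  shows "linear_form d (B' i') dvd F.restriction p - F'.restriction p"
  unfolding F.restriction_def F'.restriction_def
proof (rule psubst_dvd_diff[OF p])
  fix v assume v: "v \<in> P - {pbot P}"
  let ?f = "face_subst n x y (\<lambda>i. linear_form d (B i)) v"
    and ?f' = "face_subst n x y' (\<lambda>i. linear_form d (B' i)) v"
  show "linear_form d (B' i') dvd ?f - ?f'"
  proof (cases "v \<le> u")
    case True
    then have "atoms_below n x v \<subseteq> atoms_below n x u" by (rule atoms_below_mono)
    then have "linear_form d (B' i') dvd (\<Prod>i\<in>atoms_below n x v. linear_form d (B i))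
        - (\<Prod>i\<in>atoms_below n x v. linear_form d (B' i))"
      by (intro dvd_prod_diff linear_form_dvd_diff) auto
    then show ?thesis using True u by (auto simp: face_subst_def)
  next
    case False
    have "linear_form d (B' i') dvd ?f"
    proof (cases "v \<le> y")
      case True
      then have "\<not> atoms_below n x v \<subseteq> atoms_below n x u" "atoms_below n x v \<subseteq> atoms_below n x y"
        using F.atoms_below_le_iff[OF F.facet(1), of v u] v u False atoms_below_mono[of v y n x]
        by (auto simp: below_def)
      then have "i \<in> atoms_below n x v" using i by auto
      then have "linear_form d (B i) dvd ?f"
        using True by (auto simp: face_subst_def intro: dvd_prodI)
      then show ?thesis unfolding linear_form_ratio by (rule dvd_mult_right)
    qed (simp add: face_subst_def)
    moreover have "linear_form d (B' i') dvd ?f'"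
    proof (cases "v \<le> y'")
      case True
      then have "\<not> atoms_below n x v \<subseteq> atoms_below n x u" "atoms_below n x v \<subseteq> atoms_below n x y'"
        using F.atoms_below_le_iff[OF F'.facet(1), of v u] v u False atoms_below_mono[of v y' n x]
        by (auto simp: below_def)
      then have "i' \<in> atoms_below n x v" using i' by auto
      then show ?thesis
        using True by (auto simp: face_subst_def intro: dvd_prodI)
    qed (simp add: face_subst_def)
    ultimately show ?thesis by (rule dvd_diff)
  qed
qed

end

section \<open>Cancellation of poles\<close>

locale oriented_lsop = lsop P n x d \<theta> C
  for P :: "'a::order set" and n x d \<theta> C +
  fixes B :: "'a \<Rightarrow> nat \<Rightarrow> nat \<Rightarrow> rat" and w :: "'a \<Rightarrow> nat list" and sg :: "'a \<Rightarrow> int"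
  assumes facets: "\<And>y. y \<in> elements_of_rank P d \<Longrightarrow> facet P n x d \<theta> C y (B y)"
    and ordering: "\<And>y. y \<in> elements_of_rank P d \<Longrightarrow> distinct (w y) \<and> set (w y) = atoms_below n x y"
    and two_facets: "\<And>z. z \<in> P \<Longrightarrow> prank P z + 1 = d \<Longrightarrow> card {y \<in> elements_of_rank P d. z \<le> y} = 2"
    and cycle: "boundary P n x
      (\<Sum>y \<in> elements_of_rank P d. frag_cmul (sg y) (oriented_cell y (w y))) = 0"
begin

definition local_numerator :: "'a qpoly \<Rightarrow> 'a \<Rightarrow> nat qpoly" where
  "local_numerator p y =
     pconst (of_int (sg y)) * psubst (face_subst n x y (\<lambda>i. linear_form d (B y i))) p"

definition local_denominator :: "'a \<Rightarrow> nat qpoly" where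
  "local_denominator y =
     pconst (det (column_mat C (w y))) * (\<Prod>i\<in>atoms_below n x y. linear_form d (B y i))"

definition local_term :: "'a qpoly \<Rightarrow> 'a \<Rightarrow> nat qpoly fract" where
  "local_term p y = Fract (local_numerator p y) (local_denominator y)"

lemma facet_rank: "y \<in> elements_of_rank P d \<Longrightarrow> y \<in> P \<and> prank P y = d"
  by (simp add: elements_of_rank_def)

lemma det_ordering_nonzero: "y \<in> elements_of_rank P d \<Longrightarrow> det (column_mat C (w y)) \<noteq> 0"
  using det_nonzero facet_rank ordering by blast

lemma linear_form_facet_nonzero:
  "y \<in> elements_of_rank P d \<Longrightarrow> i \<in> atoms_below n x y \<Longrightarrow> \<exists>v. nonzero_linear_form d (B y i) v"
  using facet.linear_form_nonzero[OF facets] by metis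

lemma prime_linear_form:
  "y \<in> elements_of_rank P d \<Longrightarrow> i \<in> atoms_below n x y \<Longrightarrow> prime_elem (linear_form d (B y i))"
  using linear_form_facet_nonzero nonzero_linear_form.prime_elem_linear_form by blast

lemma missing_atom:
  assumes "y \<in> elements_of_rank P d" "u \<in> P" "prank P u + 1 = d" "u \<le> y"
  obtains i where "atoms_below n x y = insert i (atoms_below n x u)" "i \<notin> atoms_below n x u"
proof -
  have sub: "atoms_below n x u \<subseteq> atoms_below n x y" using assms(4) by (rule atoms_below_mono)
  have "card (atoms_below n x y - atoms_below n x u) = 1"
    using card_Diff_subset[OF _ sub] card_atoms_below[of u] card_atoms_below[of y] assms facet_rank[of y]
    by simp
  then obtain i where "atoms_below n x y - atoms_below n x u = {i}" by (rule card_1_singletonE)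
  then show thesis using sub by (intro that[of i]) auto
qed

text \<open>The normal form puts the atom outside \<open>u\<close> first and the atoms of
  \<open>u\<close> after it in increasing order, so that the two facets at \<open>u\<close> give
  matrices differing in the first column. The resulting sign is the coefficient of \<open>u\<close>
  in the boundary of the oriented cell.\<close>

lemma det_ordering:
  assumes y: "y \<in> elements_of_rank P d" and i: "atoms_below n x y = insert i (atoms_below n x u)"
    "i \<notin> atoms_below n x u"
  shows "det (column_mat C (w y))
    = of_int (list_sign (w y) * (- 1) ^ card {z \<in> atoms_below n x u. z < i})
      * det (column_mat C (i # sorted_list_of_set (atoms_below n x u)))"
proof -
  let ?Z = "sorted_list_of_set (atoms_below n x u)" and ?k = "card {z \<in> atoms_below n x u. z < i}"
  have "sort (w y) = sorted_list_of_set (set (w y))"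
    using sorted_list_of_set_sort_remdups[of "w y"] ordering[OF y] by (simp add: distinct_remdups_id)
  also have "\<dots> = insort i ?Z"
    using ordering[OF y] i by (simp add: sorted_list_of_set.fold_insort_key.insert_remove)
  finally have "det (column_mat C (w y)) = of_int (list_sign (w y)) * det (column_mat C (insort i ?Z))"
    using det_column_sort[of "w y" C "[]"] ordering[OF y] by simp
  moreover have "det (column_mat C (i # ?Z)) = (- 1) ^ ?k * det (column_mat C (insort i ?Z))"
    using det_column_insort[of ?Z i C "[]"] i(2) by simp
  moreover have "(- 1) ^ ?k * ((- 1) ^ ?k * det (column_mat C (insort i ?Z))) = det (column_mat C (insort i ?Z))"
    by (simp flip: mult.assoc power_mult_distrib)
  ultimately show ?thesis by simp
qed

lemma list_sign_square: "list_sign v * list_sign v = 1"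
  by (simp add: list_sign_def flip: power_mult_distrib)

text \<open>The coefficient of \<open>u\<close> in the boundary of the cycle: only the facets above
  \<open>u\<close> contribute.\<close>

lemma cycle_coefficient:
  assumes u: "u \<in> P" and facets_u: "{y \<in> elements_of_rank P d. u \<le> y} = {y, y'}" "y \<noteq> y'"
    and i: "atoms_below n x y = insert i (atoms_below n x u)" "i \<notin> atoms_below n x u"
    and i': "atoms_below n x y' = insert i' (atoms_below n x u)" "i' \<notin> atoms_below n x u"
  shows "sg y * (list_sign (w y) * (- 1) ^ card {z \<in> atoms_below n x u. z < i})
    + sg y' * (list_sign (w y') * (- 1) ^ card {z \<in> atoms_below n x u. z < i'}) = 0"
proof -
  let ?Y = "elements_of_rank P d"
  let ?c = "\<lambda>y. sg y * list_sign (w y) * Poly_Mapping.lookup (cell_boundary P n x y) u"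
  have mem: "y \<in> P" "y' \<in> P" "u \<le> y" "u \<le> y'"
    using facets_u(1) facet_rank by blast+
  have "0 = (\<Sum>y\<in>?Y. ?c y)"
    using lookup_boundary[OF finite_rank, of sg w d u] cycle by simp
  also have "\<dots> = (\<Sum>y\<in>{y \<in> ?Y. u \<le> y}. ?c y)"
    using finite_rank facet_rank lookup_cell_boundary(1)[OF _ u] by (intro sum.mono_neutral_right) auto
  also have "\<dots> = ?c y + ?c y'" using facets_u by simp
  finally show ?thesis
    using lookup_cell_boundary(2)[OF mem(1) u mem(3) i] lookup_cell_boundary(2)[OF mem(2) u mem(4) i']
    by (simp add: mult.assoc)
qed

text \<open>Cancelling L_i'(y') leaves the denominator m ratio Q Q', with Q and Q' the products over
  the atoms of \<open>u\<close>. The form divides no factor of these, because at each facet it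
  already divides the form of the atom outside \<open>u\<close>.\<close>

lemma integral_at_pair:
  assumes p: "p \<in> qpolys (P - {pbot P})" and u: "u \<in> P"
    and facets_u: "{y \<in> elements_of_rank P d. u \<le> y} = {y, y'}" "y \<noteq> y'"
    and i: "atoms_below n x y = insert i (atoms_below n x u)" "i \<notin> atoms_below n x u"
    and i': "atoms_below n x y' = insert i' (atoms_below n x u)" "i' \<notin> atoms_below n x u"
    and b: "nonzero_linear_form d b v"
    and dvd: "linear_form d b dvd linear_form d (B y i)" "linear_form d b dvd linear_form d (B y' i')"
  shows "integral_at (linear_form d b) (local_term p y + local_term p y')"
proof -
  have y: "y \<in> elements_of_rank P d" "u \<le> y" and y': "y' \<in> elements_of_rank P d" "u \<le> y'"
    using facets_u(1) by blast+
  note coefficient = cycle_coefficient[OF u facets_u i i']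
  interpret F: facet P n x d \<theta> C y "B y" by (rule facets[OF y(1)])
  interpret F': facet P n x d \<theta> C y' "B y'" by (rule facets[OF y'(1)])
  interpret adjacent_facets P n x d \<theta> C y "B y" y' "B y'" u i i'
    by unfold_locales (use u y y' i i' in auto)
  let ?A = "atoms_below n x u"
  let ?Z = "sorted_list_of_set ?A"
  let ?D = "det (column_mat C (i # ?Z))"
  define \<epsilon> where "\<epsilon> = list_sign (w y) * (- 1) ^ card {z \<in> ?A. z < i}"
  define \<epsilon>' where "\<epsilon>' = list_sign (w y') * (- 1) ^ card {z \<in> ?A. z < i'}"
  define m where "m = det (column_mat C (w y))"
  define m' where "m' = det (column_mat C (w y'))"
  have Z: "distinct ?Z" "set ?Z = ?A" by simp_all
  have m: "m = of_int \<epsilon> * ?D" "m' = of_int \<epsilon>' * (ratio * ?D)"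
    using det_ordering[OF y(1) i] det_ordering[OF y'(1) i'] det_ratio(1)[OF Z]
    by (simp_all add: m_def m'_def \<epsilon>_def \<epsilon>'_def)
  have nz: "m \<noteq> 0" "m' \<noteq> 0" "ratio \<noteq> 0"
    using det_ordering_nonzero y(1) y'(1) det_ratio(3)[OF Z] by (simp_all add: m_def m'_def)
  have square: "\<epsilon> * \<epsilon> = 1" "\<epsilon>' * \<epsilon>' = 1"
  proof -
    have "(l * (- 1) ^ k) * (l * (- 1) ^ k) = (1::int)" if "l * l = 1" for l :: int and k :: nat
      using that by (simp add: mult_ac flip: power_mult_distrib mult.assoc)
    then show "\<epsilon> * \<epsilon> = 1" "\<epsilon>' * \<epsilon>' = 1"
      unfolding \<epsilon>_def \<epsilon>'_def using list_sign_square by blast+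
  qed
  have "sg y * \<epsilon> + sg y' * \<epsilon>' = 0"
    using coefficient by (simp add: \<epsilon>_def \<epsilon>'_def)
  \<comment> \<open>Both signs square to 1, so multiplying by their product exchanges them, as
    needed to compare \<open>sg y * m'\<close> with \<open>sg y' * m\<close>.\<close>
  then have "(sg y * \<epsilon> + sg y' * \<epsilon>') * (\<epsilon> * \<epsilon>') = 0" by simp
  then have "sg y * \<epsilon>' * (\<epsilon> * \<epsilon>) + sg y' * \<epsilon> * (\<epsilon>' * \<epsilon>') = 0" by (simp add: algebra_simps)
  then have "sg y * \<epsilon>' = - (sg y' * \<epsilon>)" using square by simp
  then have "of_int (sg y * \<epsilon>') = (of_int (- (sg y' * \<epsilon>)) :: rat)" by (rule arg_cong)
  then have "of_int (sg y * \<epsilon>') * (ratio * ?D) = of_int (- (sg y' * \<epsilon>)) * (ratio * ?D)" by (rule arg_cong)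
  then have res: "of_int (sg y) * m' = - (of_int (sg y') * m * ratio)"
    unfolding m by (simp add: mult_ac)
  let ?L = "\<lambda>j. linear_form d (B y j)" and ?L' = "\<lambda>j. linear_form d (B y' j)"
  define Q where "Q = (\<Prod>j\<in>?A. ?L j)"
  define Q' where "Q' = (\<Prod>j\<in>?A. ?L' j)"
  have nzL: "?L j \<noteq> 0" if "j \<in> atoms_below n x y" for j
    using prime_linear_form[OF y(1) that] by (auto simp: prime_elem_def)
  have nzL': "?L' j \<noteq> 0" if "j \<in> atoms_below n x y'" for j
    using prime_linear_form[OF y'(1) that] by (auto simp: prime_elem_def)
  have nzQ: "?L' i' \<noteq> 0" "Q \<noteq> 0" "Q' \<noteq> 0"
    using nzL nzL' i(1) i'(1) by (auto simp: Q_def Q'_def)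
  have nz_const: "pconst c \<noteq> (0 :: nat qpoly)" if "c \<noteq> 0" for c
    using that by (metis lookup_single_eq lookup_zero)
  obtain h where h: "F.restriction p - F'.restriction p = ?L' i' * h"
    using restriction_dvd_diff[OF p] by (rule dvdE)
  have "?L' i' dvd Q - Q'"
    unfolding Q_def Q'_def by (intro dvd_prod_diff linear_form_dvd_diff)
  then obtain k where k: "Q - Q' = ?L' i' * k" by (rule dvdE)
  have residue: "pconst (of_int (sg y)) * pconst m' = - (pconst (of_int (sg y')) * pconst m * pconst ratio :: nat qpoly)"
    unfolding pconst_mult[symmetric] res by (rule single_uminus)
  \<comment> \<open>The factor of atom \<open>i\<close> is split off the denominator and replaced by
    \<open>ratio\<close> times that of \<open>i'\<close>, so that both fractions show the same
    form.\<close>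
  have "local_term p y + local_term p y'
      = Fract (pconst (of_int (sg y)) * F.restriction p) (pconst m * (pconst ratio * ?L' i' * Q))
      + Fract (pconst (of_int (sg y')) * F'.restriction p) (pconst m' * (?L' i' * Q'))"
    using i i' linear_form_ratio
    by (simp add: local_term_def local_numerator_def local_denominator_def F.restriction_def
        F'.restriction_def m_def m'_def Q_def Q'_def)
  also have "\<dots> = Fract (pconst (of_int (sg y)) * (h * Q - F.restriction p * k))
      (pconst m * pconst ratio * Q * Q')"
    by (rule Fract_add_common_factor[OF nzQ nz_const[OF nz(1)] nz_const[OF nz(2)] nz_const[OF nz(3)] residue h k])
  finally have eq: "local_term p y + local_term p y'
    = Fract (pconst (of_int (sg y)) * (h * Q - F.restriction p * k)) (pconst m * pconst ratio * Q * Q')" .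
  have prime: "prime_elem (linear_form d b)"
    using b by (rule nonzero_linear_form.prime_elem_linear_form)
  have "\<not> linear_form d b dvd Q"
    unfolding Q_def
    by (rule not_prime_dvd_prod[OF prime])
      (use F.linear_form_dvd_unique[OF b _ _ dvd(1)] i in blast)
  moreover have "\<not> linear_form d b dvd Q'"
    unfolding Q'_def
    by (rule not_prime_dvd_prod[OF prime])
      (use F'.linear_form_dvd_unique[OF b _ _ dvd(2)] i' in blast)
  ultimately have "\<not> linear_form d b dvd Q * Q'"
    by (simp add: prime_elem_dvd_mult_iff[OF prime])
  then have "\<not> linear_form d b dvd pconst m * pconst ratio * Q * Q'"
    unfolding mult.assoc pconst_dvd_cancel[OF nz(1)] pconst_dvd_cancel[OF nz(3)] .
  then show ?thesis unfolding eq by (rule integral_at_Fract)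
qed

text \<open>\<open>S\<close> consists of the facets with a pole, and it is split into the fibres of
  \<open>wall\<close>. The fibre over u is the whole pair of facets above u: the second facet
  inherits the pole through \<open>linear_form_ratio\<close>, and by uniqueness its pole belongs to
  the atom outside u, so its wall is u as well.\<close>

lemma integral_at_local_sum:
  assumes p: "p \<in> qpolys (P - {pbot P})" and b: "nonzero_linear_form d b v"
  shows "integral_at (linear_form d b) (\<Sum>y\<in>elements_of_rank P d. local_term p y)"
proof -
  let ?Y = "elements_of_rank P d" and ?A = "atoms_below n x" and ?l = "linear_form d b"
  let ?L = "\<lambda>y i. linear_form d (B y i)"
  have prime: "prime_elem ?l"
    using b by (rule nonzero_linear_form.prime_elem_linear_form)
  define S where "S = {y \<in> ?Y. \<exists>i\<in>?A y. ?l dvd ?L y i}"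
  have S: "S \<subseteq> ?Y" "finite S" using finite_rank by (auto simp: S_def)
  have "\<forall>y\<in>S. \<exists>i u. i \<in> ?A y \<and> ?l dvd ?L y i \<and> u \<in> below P y \<and> ?A u = ?A y - {i}"
  proof
    fix y assume "y \<in> S"
    then obtain i where i: "y \<in> ?Y" "i \<in> ?A y" "?l dvd ?L y i" by (auto simp: S_def)
    then obtain u where "u \<in> below P y" "?A u = ?A y - {i}"
      using atoms_below_ex[of y "?A y - {i}"] facet_rank by blast
    then show "\<exists>i u. i \<in> ?A y \<and> ?l dvd ?L y i \<and> u \<in> below P y \<and> ?A u = ?A y - {i}"
      using i by blast
  qed
  then obtain pole wall where pole: "\<And>y. y \<in> S \<Longrightarrow> pole y \<in> ?A y" "\<And>y. y \<in> S \<Longrightarrow> ?l dvd ?L y (pole y)"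
    and wall: "\<And>y. y \<in> S \<Longrightarrow> wall y \<in> below P y" "\<And>y. y \<in> S \<Longrightarrow> ?A (wall y) = ?A y - {pole y}"
    by metis
  have outside: "integral_at ?l (local_term p y)" if "y \<in> ?Y - S" for y
  proof -
    have "\<not> ?l dvd (\<Prod>i\<in>?A y. ?L y i)"
      by (rule not_prime_dvd_prod[OF prime]) (use that in \<open>auto simp: S_def\<close>)
    then have "\<not> ?l dvd local_denominator y"
      using that det_ordering_nonzero[of y] by (simp add: local_denominator_def pconst_dvd_cancel)
    then show ?thesis unfolding local_term_def by (rule integral_at_Fract)
  qed
  have group: "integral_at ?l (\<Sum>y\<in>{y \<in> S. wall y = u}. local_term p y)" if u_wall: "u \<in> wall ` S" for u
  proof -
    obtain y where y: "y \<in> S" "u = wall y" using u_wall by blast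
    have yY: "y \<in> ?Y" using y S by blast
    have u: "u \<in> P" "u \<le> y" using wall(1)[OF y(1)] y(2) by (auto simp: below_def)
    have A: "?A y = insert (pole y) (?A u)" "pole y \<notin> ?A u"
      using wall(2)[OF y(1)] pole(1)[OF y(1)] y(2) by auto
    have "prank P u + 1 = d"
      using card_atoms_below[of y] card_atoms_below[of u] facet_rank[OF yY] u A by simp
    then have card: "card {y \<in> ?Y. u \<le> y} = 2" and rank_u: "prank P u + 1 = d" using two_facets u by auto
    obtain y' where y': "{y \<in> ?Y. u \<le> y} = {y, y'}" "y \<noteq> y'"
    proof -
      obtain a c where ac: "{y \<in> ?Y. u \<le> y} = {a, c}" "a \<noteq> c" using card by (auto simp: card_2_iff)
      have "y \<in> {y \<in> ?Y. u \<le> y}" using yY u by simp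
      then consider "y = a" | "y = c" using ac by auto
      then show thesis using ac that by cases (auto simp: insert_commute)
    qed
    have y'Y: "y' \<in> ?Y" "u \<le> y'" using y'(1) by blast+
    obtain i' where A': "?A y' = insert i' (?A u)" "i' \<notin> ?A u"
      using missing_atom[OF y'Y(1) u(1) rank_u y'Y(2)] by metis
    interpret F: facet P n x d \<theta> C y "B y" by (rule facets[OF yY])
    interpret F': facet P n x d \<theta> C y' "B y'" by (rule facets[OF y'Y(1)])
    interpret adjacent_facets P n x d \<theta> C y "B y" y' "B y'" u "pole y" i'
      by unfold_locales (use u y'Y A A' in auto)
    have dvd: "?l dvd ?L y (pole y)" by (rule pole(2)[OF y(1)])
    have "ratio \<noteq> 0" by (rule det_ratio(3)[of "sorted_list_of_set (?A u)"]) simp_all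
    then have dvd': "?l dvd ?L y' i'"
      using dvd unfolding linear_form_ratio by (simp add: pconst_dvd_cancel)
    have y'S: "y' \<in> S" using y'Y A' dvd' by (auto simp: S_def)
    have "pole y' = i'"
      using F'.linear_form_dvd_unique[OF b pole(1)[OF y'S] _ pole(2)[OF y'S] dvd'] A' by simp
    then have "?A (wall y') = ?A u" using wall(2)[OF y'S] A' by simp
    then have "wall y' = u"
      using atoms_below_inj[OF F'.facet(1) wall(1)[OF y'S], of u] u y'Y by (simp add: below_def)
    moreover have "{z \<in> S. wall z = u} \<subseteq> {y \<in> ?Y. u \<le> y}"
    proof
      fix z assume "z \<in> {z \<in> S. wall z = u}"
      then have "z \<in> ?Y" "wall z = u" "wall z \<in> below P z" using wall(1) S(1) by auto
      then show "z \<in> {y \<in> ?Y. u \<le> y}" by (simp add: below_def)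
    qed
    ultimately have "{z \<in> S. wall z = u} = {y, y'}" unfolding y'(1) using y y'S by auto
    then show ?thesis
      using integral_at_pair[OF p u(1) y' A A' b dvd dvd'] y'(2) by simp
  qed
  have "integral_at ?l (\<Sum>y\<in>?Y - S. local_term p y)"
    by (rule integral_at_sum[OF prime outside])
  moreover have "integral_at ?l (\<Sum>y\<in>S. local_term p y)"
    unfolding sum.image_gen[OF S(2), of _ wall] by (rule integral_at_sum[OF prime group])
  moreover have "(\<Sum>y\<in>?Y. local_term p y) = (\<Sum>y\<in>?Y - S. local_term p y) + (\<Sum>y\<in>S. local_term p y)"
    by (rule sum.subset_diff[OF S(1) finite_rank])
  ultimately show ?thesis using integral_at_add[OF prime] by metis
qed

lemma local_sum_integral:
  assumes p: "p \<in> qpolys (P - {pbot P})"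
  shows "\<exists>f. (\<Sum>y\<in>elements_of_rank P d. local_term p y) = Fract f 1"
proof -
  let ?Y = "elements_of_rank P d" and ?A = "atoms_below n x"
  let ?L = "\<lambda>y i. linear_form d (B y i)"
  let ?F = "\<Sum>y\<in>?Y. local_term p y"
  \<comment> \<open>The determinant is a unit and moves to the numerator; what remains below is a
    product of prime forms.\<close>
  define M where "M y = pconst (1 / det (column_mat C (w y))) * local_numerator p y" for y
  have nz: "(\<Prod>i\<in>?A y. ?L y i) \<noteq> 0" if "y \<in> ?Y" for y
    using prime_linear_form[OF that] by (auto simp: prime_elem_def)
  have term_eq: "local_term p y = Fract (M y) (\<Prod>i\<in>?A y. ?L y i)" if y: "y \<in> ?Y" for y
  proof -
    let ?m = "det (column_mat C (w y))"
    have m: "?m \<noteq> 0" by (rule det_ordering_nonzero[OF y])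
    then have unit: "pconst ?m * pconst (1 / ?m) = (1 :: nat qpoly)"
      by (simp flip: pconst_mult)
    then have "pconst ?m \<noteq> (0 :: nat qpoly)" by auto
    moreover have "local_numerator p y = pconst ?m * M y"
      unfolding M_def mult.assoc[symmetric] unit by simp
    ultimately show ?thesis
      unfolding local_term_def local_denominator_def by (simp only: mult_fract_cancel simp_thms)
  qed
  obtain N where "(\<Sum>y\<in>?Y. Fract (M y) (\<Prod>i\<in>?A y. ?L y i)) = Fract N (\<Prod>y\<in>?Y. \<Prod>i\<in>?A y. ?L y i)"
    using sum_Fract[where Y = "?Y" and D = "\<lambda>y. \<Prod>i\<in>?A y. ?L y i" and M = M, OF finite_rank nz]
    by blast
  then have N: "?F = Fract N (\<Prod>(y, i)\<in>Sigma ?Y ?A. ?L y i)"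
    using term_eq finite_rank by (simp add: prod.Sigma)
  show ?thesis
  proof (rule integral_if_integral_at[OF _ N])
    show "finite (Sigma ?Y ?A)" using finite_rank by (intro finite_SigmaI) simp_all
    fix j assume "j \<in> Sigma ?Y ?A"
    then obtain y i where j: "j = (y, i)" "y \<in> ?Y" "i \<in> ?A y" by blast
    show "prime_elem (case j of (y, i) \<Rightarrow> ?L y i)"
      using prime_linear_form[OF j(2,3)] by (simp add: j(1))
    obtain v where "nonzero_linear_form d (B y i) v"
      using linear_form_facet_nonzero[OF j(2,3)] by blast
    then show "integral_at (case j of (y, i) \<Rightarrow> ?L y i) ?F"
      using integral_at_local_sum[OF p] by (simp add: j(1))
  qed
qed

lemma ind_T_mem:
  assumes K: "fraction_field (param_ring P \<theta>) K e" and \<alpha>: "\<alpha> \<in> carrier (face_ring P)"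
  shows "ind_T P n x \<theta> w sg K e \<alpha> \<in> e ` carrier (param_ring P \<theta>)"
proof -
  let ?Y = "elements_of_rank P d"
  \<comment> \<open>\<open>E\<close> starts from the polynomial type and vanishes on the variables
    outside \<open>{1..d}\<close>, so nonvanishing at the denominators is derived from
    \<open>param_eval\<close> at each facet.\<close>
  define E where "E r = e (param_eval r)" for r
  have field: "Ring.field K" and e: "e \<in> Ring.ring_hom (param_ring P \<theta>) K"
    and inj: "inj_on e (carrier (param_ring P \<theta>))"
    using K by (auto simp: fraction_field_def)
  interpret K: Ring.field K by (rule field)
  have mem: "param_eval r \<in> carrier (param_ring P \<theta>)" for r by (simp add: carrier_param_ring)
  have E: "E r \<in> carrier K" "E (r + s) = E r \<oplus>\<^bsub>K\<^esub> E s" "E (r * s) = E r \<otimes>\<^bsub>K\<^esub> E s"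
      "E 1 = \<one>\<^bsub>K\<^esub>" for r s
    using Ring.ring_hom_closed[OF e mem, of r] Ring.ring_hom_add[OF e mem mem, of r s]
      Ring.ring_hom_mult[OF e mem mem, of r s] Ring.ring_hom_one[OF e]
    by (simp_all add: E_def param_eval_add param_eval_mult param_eval_one param_ring_def)
  have E0: "E 0 = \<zero>\<^bsub>K\<^esub>"
    using E(1)[of 0] E(2)[of 0 0] by (metis K.add.r_cancel_one' add_0)
  have E_nonzero: "E r \<noteq> \<zero>\<^bsub>K\<^esub>" if r: "param_eval r \<noteq> \<zero>\<^bsub>face_ring P\<^esub>" for r
  proof
    assume "E r = \<zero>\<^bsub>K\<^esub>"
    then have "e (param_eval r) = e (param_eval 0)" using E0 by (simp add: E_def)
    then have "param_eval r = param_eval 0" by (rule inj_onD[OF inj]) (rule mem)+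
    then show False using r by (simp add: param_eval_zero)
  qed
  have E_prod: "E (prod f A) \<noteq> \<zero>\<^bsub>K\<^esub>" if "finite A" "\<And>i. i \<in> A \<Longrightarrow> E (f i) \<noteq> \<zero>\<^bsub>K\<^esub>" for f and A :: "nat set"
    using that by (induction A rule: finite_induct) (simp_all add: E K.integral_iff)
  obtain p where p: "p \<in> qpolys (P - {pbot P})" "\<alpha> = face_class P p"
    using \<alpha> by (auto simp: carrier_face_ring)
  obtain f where f: "(\<Sum>y\<in>?Y. Fract (local_numerator p y) (local_denominator y)) = Fract f 1"
    using local_sum_integral[OF p(1)] by (auto simp: local_term_def)
  have D: "E (local_denominator y) \<noteq> \<zero>\<^bsub>K\<^esub>" if y: "y \<in> ?Y" for y
  proof -
    interpret facet P n x d \<theta> C y "B y" by (rule facets[OF y])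
    let ?m = "det (column_mat C (w y))"
    have "E (pconst ?m) \<otimes>\<^bsub>K\<^esub> E (pconst (1 / ?m)) = \<one>\<^bsub>K\<^esub>"
      using det_ordering_nonzero[OF y] by (simp add: E(4) flip: E(3) pconst_mult)
    then have "E (pconst ?m) \<noteq> \<zero>\<^bsub>K\<^esub>" using E(1) by auto
    moreover have "E (\<Prod>i\<in>atoms_below n x y. linear_form d (B y i)) \<noteq> \<zero>\<^bsub>K\<^esub>"
      using param_eval_linear_form_nonzero by (intro E_prod E_nonzero) simp_all
    ultimately show ?thesis
      using E(1) by (simp add: local_denominator_def E(3) K.integral_iff)
  qed
  have "ind_T P n x \<theta> w sg K e \<alpha>
      = (\<Oplus>\<^bsub>K\<^esub>y\<in>?Y. E (local_numerator p y) \<otimes>\<^bsub>K\<^esub> inv\<^bsub>K\<^esub> E (local_denominator y))"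
    unfolding ind_T_def rank
  proof (rule K.finsum_cong'[OF refl])
    show "(\<lambda>y. E (local_numerator p y) \<otimes>\<^bsub>K\<^esub> inv\<^bsub>K\<^esub> E (local_denominator y)) \<in> ?Y \<rightarrow> carrier K"
      using D E(1) K.field_Units by auto
    fix y assume y: "y \<in> ?Y"
    interpret facet P n x d \<theta> C y "B y" by (rule facets[OF y])
    interpret cring "face_ring P" by (rule cring_face_ring)
    have num: "scal P (of_int (sg y)) \<otimes>\<^bsub>face_ring P\<^esub> iota P \<theta> y \<alpha> = param_eval (local_numerator p y)"
      using iota_face_class[OF p(1)]
      by (simp add: p(2) local_numerator_def param_eval_mult param_eval_pconst restriction_def
          del: single_of_int)
    have "(\<Otimes>\<^bsub>face_ring P\<^esub>i\<in>atoms_below n x y. local_param P \<theta> x y i)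
        = (\<Otimes>\<^bsub>face_ring P\<^esub>i\<in>atoms_below n x y. param_eval (linear_form d (B y i)))"
      by (rule finprod_cong') (use local_param_eq param_eval_mem in auto)
    then have den: "scal P (multiplicity_at P \<theta> x y (w y)) \<otimes>\<^bsub>face_ring P\<^esub>
        (\<Otimes>\<^bsub>face_ring P\<^esub>i\<in>atoms_below n x y. local_param P \<theta> x y i) = param_eval (local_denominator y)"
      using multiplicity_at_eq[of "w y"] ordering[OF y]
      by (simp add: local_denominator_def param_eval_mult param_eval_pconst param_eval_prod)
    show "e (scal P (of_int (sg y)) \<otimes>\<^bsub>face_ring P\<^esub> iota P \<theta> y \<alpha>) \<otimes>\<^bsub>K\<^esub>
        inv\<^bsub>K\<^esub> e (scal P (multiplicity_at P \<theta> x y (w y)) \<otimes>\<^bsub>face_ring P\<^esub>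
          (\<Otimes>\<^bsub>face_ring P\<^esub>i\<in>atoms_below n x y. local_param P \<theta> x y i))
      = E (local_numerator p y) \<otimes>\<^bsub>K\<^esub> inv\<^bsub>K\<^esub> E (local_denominator y)"
      unfolding num den E_def ..
  qed
  also have "\<dots> = E f"
    by (rule K.finsum_divide_eq[OF E finite_rank D f])
  finally show ?thesis using mem by (simp add: E_def)
qed

end

text \<open>Every variable has positive rank, since the bottom is not a variable. A monomial of
  degree 1 is therefore a single variable of rank 1 with exponent 1, that is, an atom.\<close>

lemma (in labelled) graded_piece_1_linear:
  assumes "a \<in> graded_piece P 1"
  shows "\<exists>c. a = face_class P (\<Sum>i\<in>{1..n}. pconst (c i) * pX (x i))"
proof -
  obtain p where p: "p \<in> qpolys (P - {pbot P})" "a = face_class P p"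
    and deg: "\<And>m. m \<in> Poly_Mapping.keys p \<Longrightarrow> monom_deg P m = 1"
    using assms by (auto simp: graded_piece_def poly_of_poset_def)
  let ?X = "\<lambda>i. Poly_Mapping.single (x i) (1::nat)"
  have keys: "Poly_Mapping.keys p \<subseteq> ?X ` {1..n}"
  proof
    fix m assume m: "m \<in> Poly_Mapping.keys p"
    have V: "Poly_Mapping.keys m \<subseteq> P - {pbot P}" using p(1) m by (auto simp: qpolys_def)
    have sum: "(\<Sum>v\<in>Poly_Mapping.keys m. Poly_Mapping.lookup m v * prank P v) = 1"
      using deg[OF m] by (simp add: monom_deg_def)
    then have "Poly_Mapping.keys m \<noteq> {}" by force
    then obtain v where v: "v \<in> Poly_Mapping.keys m" by blast
    have pos: "Poly_Mapping.lookup m u * prank P u \<ge> 1" if "u \<in> Poly_Mapping.keys m" for u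
    proof -
      have "prank P u \<noteq> 0"
        using V that card_atoms_below[of u] atoms_below_eq_empty[of u] by auto
      then show ?thesis using that by (simp add: in_keys_iff Suc_le_eq)
    qed
    have split: "Poly_Mapping.lookup m v * prank P v
        + (\<Sum>u\<in>Poly_Mapping.keys m - {v}. Poly_Mapping.lookup m u * prank P u) = 1"
      using sum v by (simp add: sum.remove)
    then have one: "Poly_Mapping.lookup m v * prank P v = 1"
      and zero: "(\<Sum>u\<in>Poly_Mapping.keys m - {v}. Poly_Mapping.lookup m u * prank P u) = 0"
      using pos[OF v] by linarith+
    have "Poly_Mapping.keys m - {v} = {}"
    proof (rule equals0I)
      fix u assume u: "u \<in> Poly_Mapping.keys m - {v}"
      then have "Poly_Mapping.lookup m u * prank P u = 0"
        using zero by (simp only: sum_eq_0_iff finite_Diff finite_keys)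
      then show False using pos[of u] u by simp
    qed
    then have "Poly_Mapping.keys m = {v}" using v by blast
    moreover have "Poly_Mapping.lookup m v = 1" "prank P v = 1" using one by simp_all
    ultimately have "m = Poly_Mapping.single v 1"
      by (intro poly_mapping_eqI) (metis in_keys_iff lookup_single_eq lookup_single_not_eq singletonD)
    moreover have "v \<in> elements_of_rank P 1"
      using V v \<open>prank P v = 1\<close> by (auto simp: elements_of_rank_def)
    then obtain i where "i \<in> {1..n}" "v = x i"
      unfolding bij_betw_imp_surj_on[OF labelling, symmetric] by blast
    ultimately show "m \<in> ?X ` {1..n}" by blast
  qed
  have inj: "inj_on ?X {1..n}"
  proof (rule inj_onI)
    fix i j assume "i \<in> {1..n}" "j \<in> {1..n}" "?X i = ?X j"
    moreover from this(3) have "x i = x j" by (metis keys_single singleton_inject zero_neq_one)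
    ultimately show "i = j" using inj_label by (auto dest: inj_onD)
  qed
  have "p = (\<Sum>m\<in>Poly_Mapping.keys p. Poly_Mapping.single m (Poly_Mapping.lookup p m))"
    by (rule poly_mapping_eq_sum_single)
  also have "\<dots> = (\<Sum>m\<in>?X ` {1..n}. Poly_Mapping.single m (Poly_Mapping.lookup p m))"
    using keys by (intro sum.mono_neutral_left) (auto simp: in_keys_iff)
  also have "\<dots> = (\<Sum>i\<in>{1..n}. pconst (Poly_Mapping.lookup p (?X i)) * pX (x i))"
    by (simp only: sum.reindex[OF inj] pconst_mult_pX o_def)
  finally have "a = face_class P (\<Sum>i\<in>{1..n}. pconst (Poly_Mapping.lookup p (?X i)) * pX (x i))"
    unfolding p(2) by (rule arg_cong)
  then show ?thesis by (rule exI[of _ "\<lambda>i. Poly_Mapping.lookup p (?X i)"])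
qed

theorem theorem4p1:
  fixes P :: "'a::order set"
    and d n :: nat
    and x :: "nat \<Rightarrow> 'a"
    and \<theta> :: "nat \<Rightarrow> 'a qpoly set"
    and w :: "'a \<Rightarrow> nat list"
    and sg :: "'a \<Rightarrow> int"
    and K :: "('k, 'l) ring_scheme"
    and e :: "'a qpoly set \<Rightarrow> 'k"
  assumes "simplicial_poset P"
    and "poset_rank P = d"
    and "bij_betw x {1..n} (elements_of_rank P 1)"
    and "lin_sys_params P \<theta>"
    and "\<And>y. y \<in> elements_of_rank P d \<Longrightarrow> positive_ordering P \<theta> n x y (w y)"
    and "\<And>z. z \<in> P \<Longrightarrow> prank P z + 1 = d \<Longrightarrow> card {y \<in> elements_of_rank P d. z \<le> y} = 2"
    and "\<And>y. y \<in> elements_of_rank P d \<Longrightarrow> sg y = 1 \<or> sg y = - 1"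
    and "boundary P n x
           (\<Sum>y \<in> elements_of_rank P d. frag_cmul (sg y) (oriented_cell y (w y))) = 0"
    and "fraction_field (param_ring P \<theta>) K e"
  shows "\<forall>\<alpha> \<in> carrier (face_ring P).
           ind_T P n x \<theta> w sg K e \<alpha> \<in> e ` carrier (param_ring P \<theta>)"
proof
  fix \<alpha> assume \<alpha>: "\<alpha> \<in> carrier (face_ring P)"
  interpret labelled P n x
    using assms(1,3) by unfold_locales
  have "\<forall>k\<in>{1..d}. \<exists>c. \<theta> k = face_class P (\<Sum>i\<in>{1..n}. pconst (c i) * pX (x i))"
    using assms(2,4) graded_piece_1_linear by (auto simp: lin_sys_params_def)
  then obtain C where C: "\<And>k. k \<in> {1..d} \<Longrightarrow>
      \<theta> k = face_class P (\<Sum>i\<in>{1..n}. pconst (C k i) * pX (x i))"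
    by metis
  interpret lsop P n x d \<theta> C
    using assms(2,4) C by unfold_locales (simp_all add: lin_sys_params_def)
  have "\<forall>y\<in>elements_of_rank P d. \<exists>B. facet P n x d \<theta> C y B"
    using dual_coefficients_exist by blast
  then obtain B where B: "\<And>y. y \<in> elements_of_rank P d \<Longrightarrow> facet P n x d \<theta> C y (B y)"
    by metis
  interpret oriented_lsop P n x d \<theta> C B w sg
  proof (intro oriented_lsop.intro oriented_lsop_axioms.intro)
    show "lsop P n x d \<theta> C" by (rule lsop_axioms)
  qed (use assms(5,6,8) B in \<open>simp_all add: positive_ordering_def\<close>)
  show "ind_T P n x \<theta> w sg K e \<alpha> \<in> e ` carrier (param_ring P \<theta>)"
    by (rule ind_T_mem[OF assms(9) \<alpha>])
qed

end
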